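(* If $s>5$, then with probability $1$ $$N(\nabla u,R)\sim\frac{N(|f|')}{\pi}\,R\qquad\text{as }R\to\infty,$$ where $N(|f|'):=\#\{\phi\in\mathbb{T}:|f|'(\phi)=0\}$ is the number of critical points of the random function $|f|$. In particular, $N(\nabla u,R)$ grows linearly in $R$ almost surely.
   Context: Fix $s\in\mathbb{R}$. Let $(a_l)_{l\in\mathbb{Z}\setminus\{0\}}$ be complex random variables such that the real and imaginary parts of $a_l$, $l\ge1$, are all independent standard Gaussian random variables (mean $0$, variance $1$), subject to the constraint $a_l=(-1)^l\overline{a_{-l}}$ for all $l\neq0$. In polar coordinates $(r,\theta)$ on $\mathbb{R}^2$, define the real-valued Gaussian random function $$u(x)=\sum_{l\in\mathbb{Z}\setminus\{0\}}a_l\,|l|^{-s}\,e^{il\theta}J_l(r),$$ where $J_l$ is the Bessel function of the first kind of order $l$, and on $\mathbb{T}=\mathbb{R}/2\pi\mathbb{Z}$ the (complex-valued) Gaussian random density $$f(\phi)=\frac1{2\pi}\sum_{l\in\mathbb{Z}\setminus\{0\}}i^l a_l|l|^{-s}e^{il\phi},$$ so that $u(x)=\int_{\mathbb{T}}e^{-ix\cdot(\cos\phi,\sin\phi)}f(\phi)\,d\phi$. For $R>0$, $B_R$ is the disk of radius $R$ centered at the origin and $N(\nabla u,R):=\#\{x\in B_R:\nabla u(x)=0\}$. The notation $q(R)\sim Q(R)$ means $q(R)/Q(R)\to1$ as $R\to\infty$. *)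

theory Defs
  imports "HOL-Probability.Probability"
begin

text \<open>The series with the reciprocal Gamma function is uniform in the integer order: for
  negative \<open>l\<close>, the factor \<open>rGamma (m + l + 1)\<close> vanishes for all \<open>m < - l\<close>, so no negative power
  of \<open>r / 2\<close> contributes, and the definition gives \<open>J\<^bsub>-l\<^esub> = (- 1)\<^sup>l J\<^sub>l\<close>.\<close>

definition bessel_J :: "int \<Rightarrow> real \<Rightarrow> real" where
  "bessel_J l r =
     (\<Sum>m::nat. (-1) ^ m / fact m * rGamma (of_int (int m + l + 1)) * (r / 2) powi (2 * int m + l))"

text \<open>In the following, \<open>a\<close> is one realisation of the family of random coefficients; its value at
  \<open>0\<close> is never used.\<close>

definition polar_r :: "real ^ 2 \<Rightarrow> real" where
  "polar_r x = norm x"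

definition polar_theta :: "real ^ 2 \<Rightarrow> real" where
  "polar_theta x = Arg (Complex (x $ 1) (x $ 2))"

text \<open>If \<open>a l = (- 1)\<^sup>l * cnj (a (- l))\<close> for all \<open>l \<noteq> 0\<close>, the terms for \<open>l\<close> and \<open>- l\<close> are complex
  conjugates, so the sum is real; \<open>Re\<close> only changes the type. At the origin the choice of the
  angle is irrelevant because \<open>J\<^sub>l\<close> vanishes there for \<open>l \<noteq> 0\<close>.\<close>

definition wave :: "real \<Rightarrow> (int \<Rightarrow> complex) \<Rightarrow> real ^ 2 \<Rightarrow> real" where
  "wave s a x = Re (\<Sum>\<^sub>\<infinity>l\<in>-{0}. a l * of_real (\<bar>real_of_int l\<bar> powr (-s))
     * exp (\<i> * of_int l * of_real (polar_theta x)) * of_real (bessel_J l (polar_r x)))"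

definition wave_density :: "real \<Rightarrow> (int \<Rightarrow> complex) \<Rightarrow> real \<Rightarrow> complex" where
  "wave_density s a \<phi> = 1 / (2 * of_real pi) *
     (\<Sum>\<^sub>\<infinity>l\<in>-{0}. \<i> powi l * a l * of_real (\<bar>real_of_int l\<bar> powr (-s))
       * exp (\<i> * of_int l * of_real \<phi>))"

definition wave_crit :: "real \<Rightarrow> (int \<Rightarrow> complex) \<Rightarrow> real \<Rightarrow> (real ^ 2) set" where
  "wave_crit s a R = {x \<in> ball 0 R. GDERIV (wave s a) x :> 0}"

text \<open>The circle \<open>\<real> / 2\<pi>\<int>\<close> is represented by its fundamental domain \<open>{0..<2 * pi}\<close>; the density
  is a \<open>2\<pi>\<close>-periodic function on the whole real line, so the derivative at \<open>0\<close> is two-sided.\<close>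

definition density_crit :: "real \<Rightarrow> (int \<Rightarrow> complex) \<Rightarrow> real set" where
  "density_crit s a =
     {\<phi> \<in> {0..<2 * pi}. ((\<lambda>t. cmod (wave_density s a t)) has_real_derivative 0) (at \<phi>)}"

end

theory Submission
  imports Defs "HOL-Real_Asymp.Real_Asymp"
begin

text \<open>
  Write \<open>b\<^sub>k\<close> for the real and imaginary parts of \<open>a\<^sub>1, a\<^sub>2, \<dots>\<close>, in this order. Because of the symmetry
  of \<open>a\<close>, the wave is in polar coordinates a real series \<open>u(r,\<theta>) = \<Sum> b\<^sub>k e\<^sub>k(\<theta>) J\<^sub>n(r)\<close>, where \<open>n\<close> is the
  frequency of the trigonometric function \<open>e\<^sub>k\<close>, and the density is \<open>F / (2 \<pi>)\<close> with
  \<open>F(\<theta>) = \<Sum> b\<^sub>k e\<^sub>k(\<theta>) \<i>\<^sup>n\<close>. As \<open>s > 5\<close>, almost surely the series of \<open>\<bar>b\<^sub>k\<bar> n powr (4 - s)\<close> converges, so all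
  the derivatives that occur can be taken term by term.

  \<^bold>\<open>Asymptotics.\<close> There is a complex \<open>g \<noteq> 0\<close> such that \<open>sqrt r * J\<^sub>l(r)\<close> approaches
  \<open>Re (g \<i>\<^sup>l exp (- \<i> r))\<close> for every \<open>l\<close>, and \<open>\<bar>sqrt r * J\<^sub>l(r)\<bar>\<close> is at most linear in \<open>l\<close>, uniformly in
  \<open>r \<ge> 1\<close>. Both follow from Bessel's equation and the three-term recurrence. Tannery's theorem
  (\<open>ufield_asymptotic\<close>) then shows that \<open>sqrt r\<close> times the polar gradient \<open>(u\<^sub>r, u\<^sub>\<theta>)\<close> is
  close in \<open>C\<^sup>1\<close>, uniformly in the angle, to the gradient of \<open>L(r,\<theta>) = Re (g exp (- \<i> r) F(\<theta>))\<close>, which has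
  period \<open>2 \<pi>\<close> in both variables. If \<open>F\<close> has no zero, \<open>\<nabla> L = 0\<close> means that \<open>g exp (- \<i> r) F(\<theta>)\<close> is real and
  \<open>\<bar>F\<bar>\<close> is critical at \<open>\<theta>\<close>. So each critical point of \<open>\<bar>F\<bar>\<close> gives exactly two zeros of \<open>\<nabla> L\<close> per
  period in \<open>r\<close>, which is the rate \<open>1 / \<pi>\<close> of the theorem.

  \<^bold>\<open>Stability.\<close> The number of zeros in a compact set of a vector field with non-degenerate zeros, none of
  them on the boundary, does not change under \<open>C\<^sup>1\<close>-small perturbations (\<open>zero_count_stable\<close>).
  Hence far out every annulus of width \<open>2 \<pi>\<close> contains the same number of critical points of \<open>u\<close> as one period
  cell contains zeros of \<open>\<nabla> L\<close>, and a disk contains finitely many because those of \<open>u\<close> are isolated.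

  \<^bold>\<open>Non-degeneracy.\<close> It remains to see that almost surely \<open>F\<close> has no zero and that the zeros of the gradients
  of \<open>u\<close> and \<open>L\<close> are non-degenerate. All three follow from one statement on random series
  \<open>\<Sum> b\<^sub>k A\<^sub>k\<close> of plane vector fields (\<open>AE_nondegenerate_zeros\<close>): where two of the fields \<open>A\<^sub>k\<close> are
  linearly independent, almost surely no zero is degenerate. With all other coefficients fixed, the
  two coefficients for which \<open>x\<close> is a zero are a function of \<open>x\<close>, and a degenerate zero makes the
  pair of coefficients a critical value of that function; critical values are negligible by
  Sard's theorem.
\<close>

section \<open>Bessel functions of integer order\<close>

definition bessel_coeff :: "nat \<Rightarrow> nat \<Rightarrow> real" where
  "bessel_coeff n m = (-1) ^ m / (fact m * fact (m + n))"

text \<open>The entire function in \<open>J\<^sub>n(r) = (r / 2)\<^sup>n bessel_entire n ((r / 2)\<^sup>2)\<close>; identities between Bessel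
  functions of order \<open>n \<ge> 0\<close> become identities between these power series, with no negative powers of \<open>r\<close>.\<close>

definition bessel_entire :: "nat \<Rightarrow> real \<Rightarrow> real" where
  "bessel_entire n t = (\<Sum>m. bessel_coeff n m * t ^ m)"

lemma bessel_coeff_bound: "\<bar>bessel_coeff n m * t ^ m\<bar> \<le> inverse (fact n) * (inverse (fact m) * \<bar>t\<bar> ^ m)"
proof -
  have "fact n \<le> (fact (m + n) :: real)" by (rule fact_mono) simp
  hence "inverse (fact (m + n)) \<le> (inverse (fact n) :: real)" by (simp add: le_imp_inverse_le)
  hence "inverse (fact (m + n)) * (inverse (fact m) * \<bar>t\<bar> ^ m) \<le> inverse (fact n) * (inverse (fact m) * \<bar>t\<bar> ^ m)"
    by (intro mult_right_mono) auto
  thus ?thesis by (simp add: bessel_coeff_def abs_mult power_abs field_simps)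
qed

lemma summable_exp_abs: "summable (\<lambda>m. inverse (fact n) * (inverse (fact m) * \<bar>t::real\<bar> ^ m))"
  by (intro summable_mult summable_exp)

lemma summable_bessel_entire: "summable (\<lambda>m. bessel_coeff n m * t ^ m)"
  by (rule summable_comparison_test'[OF summable_exp_abs[of n t], of 0]) (use bessel_coeff_bound in auto)

lemma bessel_entire_sums: "(\<lambda>m. bessel_coeff n m * t ^ m) sums bessel_entire n t"
  unfolding bessel_entire_def by (rule summable_sums[OF summable_bessel_entire])

lemma bessel_entire_bound: "\<bar>bessel_entire n t\<bar> \<le> exp \<bar>t\<bar> / fact n"
proof -
  have "\<bar>bessel_entire n t\<bar> \<le> (\<Sum>m. inverse (fact n) * (inverse (fact m) * \<bar>t\<bar> ^ m))"
    unfolding bessel_entire_def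
    using norm_suminf_le[OF _ summable_exp_abs, of "\<lambda>m. bessel_coeff n m * t ^ m" n t] bessel_coeff_bound by auto
  also have "\<dots> = exp \<bar>t\<bar> / fact n"
    by (subst suminf_mult[OF summable_exp]) (simp add: exp_def scaleR_conv_of_real field_simps)
  finally show ?thesis .
qed

lemma bessel_coeff_Suc: "real (Suc m) * bessel_coeff n (Suc m) = - bessel_coeff (Suc n) m"
  unfolding bessel_coeff_def by (simp add: divide_simps del: of_nat_Suc)

lemma bessel_entire_deriv: "(bessel_entire n has_field_derivative - bessel_entire (Suc n) t) (at t)"
proof -
  have "((\<lambda>t. bessel_entire n t) has_field_derivative (\<Sum>m. diffs (bessel_coeff n) m * t ^ m)) (at t)"
    unfolding bessel_entire_def by (rule termdiffs_strong_converges_everywhere[OF summable_bessel_entire])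
  moreover have "(\<lambda>m. diffs (bessel_coeff n) m * t ^ m) = (\<lambda>m. - (bessel_coeff (Suc n) m * t ^ m))"
    unfolding diffs_def bessel_coeff_Suc by simp
  ultimately show ?thesis
    unfolding bessel_entire_def using suminf_minus[OF summable_bessel_entire[of "Suc n" t]] by simp
qed

lemma bessel_entire_rec: "bessel_entire n t = real (Suc n) * bessel_entire (Suc n) t - t * bessel_entire (Suc (Suc n)) t"
proof -
  have c: "bessel_coeff n m = real (Suc n) * bessel_coeff (Suc n) m + real m * bessel_coeff (Suc n) m" for m
  proof -
    have "real (Suc n) * bessel_coeff (Suc n) m + real m * bessel_coeff (Suc n) m
        = real (Suc (m + n)) * ((-1) ^ m / (fact m * (real (Suc (m + n)) * fact (m + n))))"
      unfolding bessel_coeff_def of_nat_Suc of_nat_add add_Suc_right fact_Suc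
      by (simp only: distrib_right of_nat_add of_nat_Suc)
    also have "\<dots> = bessel_coeff n m" unfolding bessel_coeff_def by (simp del: of_nat_Suc)
    finally show ?thesis ..
  qed
  have "(\<lambda>m. real m * bessel_coeff (Suc n) m * t ^ m) sums (- t * bessel_entire (Suc (Suc n)) t)"
  proof -
    have "(\<lambda>m. - t * (bessel_coeff (Suc (Suc n)) m * t ^ m)) sums (- t * bessel_entire (Suc (Suc n)) t)"
      by (intro sums_mult bessel_entire_sums)
    also have "(\<lambda>m. - t * (bessel_coeff (Suc (Suc n)) m * t ^ m)) =
        (\<lambda>m. real (Suc m) * bessel_coeff (Suc n) (Suc m) * t ^ Suc m)"
      unfolding bessel_coeff_Suc by (simp add: mult_ac)
    finally show ?thesis by (subst (asm) sums_Suc_iff) simp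
  qed
  from sums_add[OF sums_mult[OF bessel_entire_sums[of "Suc n" t], of "real (Suc n)"] this]
  have "(\<lambda>m. bessel_coeff n m * t ^ m) sums (real (Suc n) * bessel_entire (Suc n) t - t * bessel_entire (Suc (Suc n)) t)"
    unfolding c by (simp add: algebra_simps)
  with bessel_entire_sums show ?thesis by (rule sums_unique2)
qed

lemma rGamma_nat: "rGamma (real n + 1) = inverse (fact n)"
  by (metis add.commute Gamma_fact rGamma_inverse_Gamma of_nat_fact)

lemma bessel_J_nonneg: "bessel_J (int n) r = (r / 2) ^ n * bessel_entire n ((r / 2) ^ 2)"
proof -
  have t: "(-1) ^ m / fact m * rGamma (of_int (int m + int n + 1)) * (r / 2) powi (2 * int m + int n)
      = (r / 2) ^ n * (bessel_coeff n m * ((r/2) ^ 2) ^ m)" for m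
  proof -
    have "of_int (int m + int n + 1) = real (m + n) + 1" by simp
    moreover have "(r / 2) powi (2 * int m + int n) = (r/2) ^ (2 * m + n)"
      by (metis int_ops(7) of_nat_add of_nat_numeral power_int_of_nat)
    ultimately show ?thesis
      by (simp only: rGamma_nat bessel_coeff_def power_add power_mult)
        (simp only: divide_inverse inverse_mult_distrib mult_ac)
  qed
  show ?thesis unfolding bessel_J_def t bessel_entire_def
    by (rule suminf_mult[OF summable_bessel_entire])
qed

text \<open>The factors \<open>rGamma\<close> in the first \<open>n\<close> terms are at poles of the Gamma function, and the
  remaining terms are those of \<open>J\<^sub>n\<close> shifted by \<open>n\<close>.\<close>

lemma bessel_J_minus_nat: "bessel_J (- int n) r = (-1) ^ n * bessel_J (int n) r"
proof -
  let ?f = "\<lambda>m. (-1) ^ m / fact m * rGamma (of_int (int m + - int n + 1)) * (r / 2) powi (2 * int m + - int n)"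
  have 0: "?f m = 0" if "m < n" for m
  proof -
    have "real_of_int (int m + - int n + 1) = - real (n - Suc m)" using that by simp
    moreover have "\<dots> \<in> \<int>\<^sub>\<le>\<^sub>0" by simp
    ultimately have "rGamma (real_of_int (int m + - int n + 1)) = 0" by (metis rGamma_eq_zero_iff)
    thus ?thesis by simp
  qed
  have 1: "?f (m + n) = (-1) ^ n * (r / 2) ^ n * (bessel_coeff n m * ((r/2) ^ 2) ^ m)" for m
  proof -
    have "real_of_int (int (m+n) + - int n + 1) = real m + 1" by simp
    moreover have "(r / 2) powi (2 * int (m+n) + - int n) = (r/2) ^ (2 * m + n)"
    proof -
      have "2 * int (m+n) + - int n = int (2 * m + n)" by simp
      thus ?thesis by (simp only: power_int_of_nat)
    qed
    ultimately show ?thesis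
      by (simp only: rGamma_nat bessel_coeff_def power_add power_mult)
        (simp only: divide_inverse inverse_mult_distrib mult_ac)
  qed
  have sum0: "(\<Sum>i<n. ?f i) = 0" by (rule sum.neutral) (use 0 in blast)
  have "(\<lambda>m. ?f (m + n)) sums ((-1) ^ n * (r / 2) ^ n * bessel_entire n ((r/2)^2))"
    unfolding 1 by (intro sums_mult bessel_entire_sums)
  hence "?f sums ((-1) ^ n * (r / 2) ^ n * bessel_entire n ((r/2)^2))"
    unfolding sums_iff_shift[of ?f n] sum0 add_0_right .
  hence "bessel_J (- int n) r = (-1) ^ n * (r / 2) ^ n * bessel_entire n ((r/2)^2)"
    unfolding bessel_J_def by (rule sums_unique[symmetric])
  thus ?thesis unfolding bessel_J_nonneg by simp
qed

lemma bessel_J_minus: "bessel_J (- l) r = (-1) powi l * bessel_J l r"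
proof (cases "l \<ge> 0")
  case True
  then obtain n where "l = int n" using nonneg_int_cases by blast
  thus ?thesis by (simp add: bessel_J_minus_nat)
next
  case False
  then obtain n where "l = - int n" by (metis nonneg_int_cases linear neg_0_le_iff_le add.inverse_inverse)
  thus ?thesis by (simp add: bessel_J_minus_nat power_int_minus)
qed

text \<open>Stated without division by \<open>r\<close>, so that it holds at the origin and for all integer orders at once.\<close>

lemma bessel_J_rec: "r * (bessel_J (l - 1) r + bessel_J (l + 1) r) = 2 * of_int l * bessel_J l r"
proof -
  have pos: "r * (bessel_J (int (Suc n) - 1) r + bessel_J (int (Suc n) + 1) r) = 2 * real (Suc n) * bessel_J (int (Suc n)) r" for n
  proof -
    have "int (Suc n) - 1 = int n" "int (Suc n) + 1 = int (Suc (Suc n))" by auto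
    then show ?thesis unfolding bessel_J_nonneg
      by (simp only: bessel_J_nonneg bessel_entire_rec[of n]) (simp add: field_simps power2_eq_square)
  qed
  consider "l = 0" | n where "l = int (Suc n)" | n where "l = - int (Suc n)"
    by (metis not0_implies_Suc int_cases2 of_nat_0 add.inverse_neutral)
  thus ?thesis
  proof cases
    case 1
    have "bessel_J (0 - 1) r = - bessel_J (0+1) r" using bessel_J_minus[of 1 r] by simp
    thus ?thesis unfolding 1 by simp
  next
    case 2 thus ?thesis using pos[of n] by simp
  next
    case 3
    have a: "bessel_J (l - 1) r = (-1) ^ (n+2) * bessel_J (int (Suc n) + 1) r"
      using bessel_J_minus_nat[of "n+2" r] unfolding 3 by (simp add: algebra_simps)
    have b: "bessel_J (l + 1) r = (-1) ^ n * bessel_J (int (Suc n) - 1) r"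
      using bessel_J_minus_nat[of "n" r] unfolding 3 by (simp add: algebra_simps)
    have c: "bessel_J l r = - ((-1) ^ n * bessel_J (int (Suc n)) r)"
      using bessel_J_minus_nat[of "Suc n" r] unfolding 3 by simp
    have "r * (bessel_J (l - 1) r + bessel_J (l + 1) r) = (-1) ^ n * (r * (bessel_J (int (Suc n) - 1) r + bessel_J (int (Suc n) + 1) r))"
      unfolding a b by (simp add: algebra_simps)
    also have "\<dots> = 2 * of_int l * bessel_J l r" unfolding pos c by (simp add: 3 algebra_simps)
    finally show ?thesis .
  qed
qed

lemma bessel_J_deriv:
  "(bessel_J l has_field_derivative (bessel_J (l - 1) r - bessel_J (l + 1) r) / 2) (at r)"
proof -
  have d: "(bessel_J (int n) has_field_derivative
      real n * (r/2) ^ (n - 1) / 2 * bessel_entire n ((r/2)^2) - (r/2) ^ n * (r / 2) * bessel_entire (Suc n) ((r/2)^2)) (at r)" for n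
    unfolding bessel_J_nonneg[abs_def]
    by (rule derivative_eq_intros DERIV_chain2[OF bessel_entire_deriv] refl | simp add: field_simps power2_eq_square)+
  have pos: "(bessel_J (int (Suc n)) has_field_derivative (bessel_J (int (Suc n) - 1) r - bessel_J (int (Suc n) + 1) r) / 2) (at r)" for n
  proof -
    have e: "int (Suc n) - 1 = int n" "int (Suc n) + 1 = int (Suc (Suc n))" by auto
    show ?thesis unfolding e
      by (rule DERIV_cong[OF d]) (simp only: bessel_J_nonneg bessel_entire_rec[of n], simp add: field_simps power2_eq_square)
  qed
  consider "l = 0" | n where "l = int (Suc n)" | n where "l = - int (Suc n)"
    by (metis not0_implies_Suc int_cases2 of_nat_0 add.inverse_neutral)
  thus ?thesis
  proof cases
    case 1
    have "bessel_J (0 - 1) r = - bessel_J (0+1) r" using bessel_J_minus[of 1 r] by simp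
    moreover have "bessel_J (0 + 1) r = (r / 2) * bessel_entire (Suc 0) ((r/2)^2)" using bessel_J_nonneg[of 1 r] by simp
    ultimately have "(bessel_J (0 - 1) r - bessel_J (0 + 1) r) / 2 = - (r * bessel_entire (Suc 0) ((r/2)^2) / 2)" by simp
    thus ?thesis unfolding 1 using d[of 0] by simp
  next
    case 2 thus ?thesis using pos[of n] by simp
  next
    case 3
    have a: "bessel_J (l - 1) r = (-1) ^ (n+2) * bessel_J (int (Suc n) + 1) r"
      using bessel_J_minus_nat[of "n+2" r] unfolding 3 by (simp add: algebra_simps)
    have b: "bessel_J (l + 1) r = (-1) ^ n * bessel_J (int (Suc n) - 1) r"
      using bessel_J_minus_nat[of "n" r] unfolding 3 by (simp add: algebra_simps)
    have c: "bessel_J l = (\<lambda>r. - ((-1) ^ n * bessel_J (int (Suc n)) r))"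
      using bessel_J_minus_nat[of "Suc n"] unfolding 3 by auto
    show ?thesis unfolding c a b
      by (rule DERIV_cong[OF DERIV_minus[OF DERIV_cmult[OF pos]]]) (simp add: field_simps)
  qed
qed

lemma bessel_J_deriv_chain [derivative_intros]:
  "(g has_field_derivative g') (at x within S) \<Longrightarrow>
   ((\<lambda>x. bessel_J l (g x)) has_field_derivative (bessel_J (l - 1) (g x) - bessel_J (l + 1) (g x)) / 2 * g') (at x within S)"
  by (rule DERIV_chain2[OF bessel_J_deriv])

lemma bessel_J_nat_bound:
  assumes "\<bar>x\<bar> \<le> R"
  shows "\<bar>bessel_J (int n) x\<bar> \<le> (R / 2) ^ n / fact n * exp ((R / 2) ^ 2)"
proof -
  have "\<bar>bessel_J (int n) x\<bar> = (\<bar>x\<bar> / 2) ^ n * \<bar>bessel_entire n ((x/2)^2)\<bar>"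
    unfolding bessel_J_nonneg by (simp add: abs_mult power_abs)
  also have "\<dots> \<le> (R / 2) ^ n * (exp ((R/2)^2) / fact n)"
  proof (rule mult_mono)
    show "(\<bar>x\<bar> / 2) ^ n \<le> (R / 2) ^ n" using assms by (intro power_mono) auto
    have "(x/2)^2 \<le> (R/2)^2" using assms by (simp add: power_divide abs_le_square_iff[symmetric])
    hence "exp \<bar>(x/2)^2\<bar> / fact n \<le> exp ((R/2)^2) / fact n" by (simp add: divide_right_mono)
    with bessel_entire_bound[of n "(x/2)^2"] show "\<bar>bessel_entire n ((x/2)^2)\<bar> \<le> exp ((R/2)^2) / fact n" by linarith
    show "0 \<le> (R / 2) ^ n" using assms by simp
  qed simp
  finally show ?thesis by (simp add: field_simps)
qed

lemma bessel_J_0_0: "bessel_J 0 0 = 1"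
proof -
  have "bessel_entire 0 0 = (\<Sum>m\<in>{0}. bessel_coeff 0 m * 0 ^ m)" unfolding bessel_entire_def by (rule suminf_finite) auto
  thus ?thesis using bessel_J_nonneg[of 0 0] by (simp add: bessel_coeff_def)
qed

lemma bessel_J_at_0: "bessel_J (int (Suc n)) 0 = 0"
  using bessel_J_nonneg[of "Suc n" 0] by simp

text \<open>The derivative of \<open>S\<^sub>L = J\<^sub>0\<^sup>2 + 2 (J\<^sub>1\<^sup>2 + \<dots> + J\<^sub>L\<^sup>2)\<close> telescopes to \<open>- 2 J\<^sub>L J\<^bsub>L+1\<^esub>\<close>, which tends
  to \<open>0\<close> locally uniformly as \<open>L\<close> grows, and \<open>S\<^sub>L(0) = 1\<close>. So the full sum of squares is \<open>1\<close>.\<close>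

lemma bessel_J_le_1: "\<bar>bessel_J l r\<bar> \<le> 1"
proof -
  have main: "\<bar>bessel_J (int n) r\<bar> \<le> 1" for n
  proof -
    define S where "S = (\<lambda>L r. (bessel_J 0 r)^2 + 2 * (\<Sum>i<L. (bessel_J (int (Suc i)) r)^2))"
    define R where "R = \<bar>r\<bar>"
    define e where "e = (\<lambda>L. (R / 2) ^ L / fact L * exp ((R / 2) ^ 2))"
    have dS: "(S L has_field_derivative - 2 * bessel_J (int L) x * bessel_J (int (Suc L)) x) (at x)" for L x
    proof (induction L)
      case 0
      have "bessel_J (-1) x = - bessel_J 1 x" using bessel_J_minus[of 1 x] by simp
      thus ?case unfolding S_def by (auto intro!: derivative_eq_intros)
    next
      case (Suc L)
      have eq: "S (Suc L) = (\<lambda>r. S L r + 2 * (bessel_J (int (Suc L)) r)^2)"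
        unfolding S_def by (auto simp: algebra_simps)
      have i: "int (Suc L) - 1 = int L" "int (Suc L) + 1 = int (Suc (Suc L))" by auto
      show ?case unfolding eq
        apply (rule DERIV_cong, rule DERIV_add, rule Suc.IH)
         apply (rule derivative_intros refl)+
        unfolding i by (simp add: field_simps)
    qed
    have S0: "S L 0 = 1" for L
      unfolding S_def using bessel_J_0_0 bessel_J_at_0 by simp
    have bound: "\<bar>S L r - 1\<bar> \<le> 2 * e L * e (Suc L) * R" for L
    proof -
      have "norm (S L r - S L 0) \<le> 2 * e L * e (Suc L) * norm (r - 0)"
      proof (rule field_differentiable_bound[of "{-R..R}" "S L"])
        show "convex {-R..R}" by (rule convex_real_interval)
        show "(S L has_field_derivative - 2 * bessel_J (int L) x * bessel_J (int (Suc L)) x) (at x within {-R..R})" for x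
          by (rule has_field_derivative_at_within[OF dS])
        show "norm (- 2 * bessel_J (int L) x * bessel_J (int (Suc L)) x) \<le> 2 * e L * e (Suc L)" if "x \<in> {-R..R}" for x
        proof -
          have "\<bar>x\<bar> \<le> R" using that by auto
          hence "\<bar>bessel_J (int L) x\<bar> * \<bar>bessel_J (int (Suc L)) x\<bar> \<le> e L * e (Suc L)"
            unfolding e_def by (intro mult_mono bessel_J_nat_bound) (auto simp: R_def)
          thus ?thesis by (simp add: abs_mult)
        qed
      qed (auto simp: R_def)
      thus ?thesis by (simp add: S0 R_def)
    qed
    have e0: "e \<longlonglongrightarrow> 0"
    proof -
      have "(\<lambda>L. inverse (fact L) * (R/2) ^ L) \<longlonglongrightarrow> 0"
        by (rule summable_LIMSEQ_zero[OF summable_exp])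
      moreover have "e = (\<lambda>L. exp ((R/2)^2) * (inverse (fact L) * (R/2) ^ L))"
        unfolding e_def by (simp add: fun_eq_iff field_simps)
      ultimately show ?thesis by (simp only: tendsto_mult_right_zero)
    qed
    have "(\<lambda>L. 1 + 2 * e L * e (Suc L) * R) \<longlonglongrightarrow> 1 + 2 * 0 * 0 * R"
      by (intro tendsto_intros e0 LIMSEQ_Suc)
    moreover have "(bessel_J (int n) r)^2 \<le> 1 + 2 * e L * e (Suc L) * R" if "L \<ge> n" for L
    proof -
      have "(bessel_J (int n) r)^2 \<le> S L r"
      proof (cases n)
        case 0 thus ?thesis unfolding S_def by (simp add: sum_nonneg)
      next
        case (Suc m)
        have "(bessel_J (int (Suc m)) r)^2 \<le> (\<Sum>i<L. (bessel_J (int (Suc i)) r)^2)"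
          by (rule member_le_sum) (use Suc that in auto)
        moreover have "0 \<le> (bessel_J 0 r)^2" "0 \<le> (bessel_J (int (Suc m)) r)^2" by auto
        ultimately show ?thesis unfolding S_def Suc by linarith
      qed
      with bound[of L] show ?thesis by linarith
    qed
    ultimately have "(bessel_J (int n) r)^2 \<le> 1"
      by (intro LIMSEQ_le_const[of "\<lambda>L. 1 + 2 * e L * e (Suc L) * R"]) auto
    thus ?thesis using abs_square_le_1 by blast
  qed
  show ?thesis
  proof (cases l)
    case (nonneg n) thus ?thesis using main by simp
  next
    case (neg n)
    have "\<bar>bessel_J (- int (Suc n)) r\<bar> = \<bar>bessel_J (int (Suc n)) r\<bar>"
      unfolding bessel_J_minus_nat by (simp add: abs_mult)
    thus ?thesis using neg main[of "Suc n"] by simp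
  qed
qed

lemma bessel_J_ode:
  "r^2 * ((bessel_J (l-2) r - 2 * bessel_J l r + bessel_J (l+2) r) / 4)
   + r * ((bessel_J (l-1) r - bessel_J (l+1) r) / 2) + (r^2 - of_int l ^ 2) * bessel_J l r = 0"
proof -
  have a: "r * bessel_J (l-2) r = 2 * of_int (l-1) * bessel_J (l-1) r - r * bessel_J l r"
    using bessel_J_rec[of r "l-1"] by (simp add: algebra_simps)
  have b: "r * bessel_J (l+2) r = 2 * of_int (l+1) * bessel_J (l+1) r - r * bessel_J l r"
    using bessel_J_rec[of r "l+1"] by (simp add: algebra_simps)
  have c: "r * bessel_J (l-1) r = 2 * of_int l * bessel_J l r - r * bessel_J (l+1) r"
    using bessel_J_rec[of r "l"] by (simp add: algebra_simps)
  have "r^2 * (bessel_J (l-2) r - 2 * bessel_J l r + bessel_J (l+2) r) =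
     r * (r * bessel_J (l-2) r) - 2 * r^2 * bessel_J l r + r * (r * bessel_J (l+2) r)"
    by (simp add: algebra_simps power2_eq_square)
  also have "\<dots> = 2 * of_int (l-1) * (r * bessel_J (l-1) r) + 2 * of_int (l+1) * (r * bessel_J (l+1) r) - 4 * r^2 * bessel_J l r"
    unfolding a b by (simp add: algebra_simps power2_eq_square)
  also have "\<dots> = 2 * of_int l * (r * (bessel_J (l-1) r + bessel_J (l+1) r)) - 2 * r * (bessel_J (l-1) r - bessel_J (l+1) r) - 4 * r^2 * bessel_J l r"
    by (simp add: algebra_simps)
  finally have "r^2 * (bessel_J (l-2) r - 2 * bessel_J l r + bessel_J (l+2) r) =
    4 * of_int l ^ 2 * bessel_J l r - 2 * r * (bessel_J (l-1) r - bessel_J (l+1) r) - 4 * r^2 * bessel_J l r"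
    unfolding bessel_J_rec by (simp add: power2_eq_square)
  thus ?thesis by (simp add: field_simps)
qed

section \<open>Bessel functions for large argument\<close>

text \<open>The functions \<open>\<bar>z\<bar>\<^sup>2 exp (\<plusminus> 2 K / r)\<close> are monotone. This gives a bound from above, used for the
  size of Bessel functions, and one from below, used to see that the amplitude at infinity does not vanish.\<close>

lemma perturbed_growth:
  fixes z z' :: "real \<Rightarrow> complex"
  assumes a: "0 < a" and K: "0 \<le> K"
    and d: "\<And>r. a \<le> r \<Longrightarrow> (z has_vector_derivative z' r) (at r)"
    and b: "\<And>r. a \<le> r \<Longrightarrow> norm (z' r) \<le> K / r^2 * norm (z r)"
    and r: "a \<le> r"
  shows "norm (z r) \<le> exp (K / a) * norm (z a)" "norm (z a) \<le> exp (K / a) * norm (z r)"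
proof -
  have key: "\<bar>z x \<bullet> z' x\<bar> \<le> K / x^2 * (z x \<bullet> z x)" if "a \<le> x" for x
  proof -
    have "\<bar>z x \<bullet> z' x\<bar> \<le> norm (z x) * norm (z' x)" by (rule Cauchy_Schwarz_ineq2)
    also have "\<dots> \<le> norm (z x) * (K / x^2 * norm (z x))" by (intro mult_left_mono b that) auto
    finally show ?thesis by (simp add: dot_square_norm power2_eq_square mult_ac)
  qed
  have dz: "((\<lambda>x. z x \<bullet> z x) has_field_derivative 2 * (z x \<bullet> z' x)) (at x)" if "a \<le> x" for x
    using has_derivative_inner[OF d[OF that, unfolded has_vector_derivative_def] d[OF that, unfolded has_vector_derivative_def]]
    unfolding has_field_derivative_def by (rule has_derivative_eq_rhs) (auto simp: inner_commute algebra_simps)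
  have dphi: "((\<lambda>x. (z x \<bullet> z x) * exp (c / x)) has_field_derivative
      (2 * (z x \<bullet> z' x) - c / x^2 * (z x \<bullet> z x)) * exp (c / x)) (at x)" if "a \<le> x" for x c
    using that a by (auto intro!: derivative_eq_intros dz simp: field_simps power2_eq_square)
  have sq: "(exp (K/a) * x)^2 = x^2 * exp (2 * K / a)" for x :: real
    by (simp add: power_mult_distrib exp_double[symmetric])
  have "(z r \<bullet> z r) * exp (2 * K / r) \<le> (z a \<bullet> z a) * exp (2 * K / a)"
  proof (rule DERIV_nonpos_imp_nonincreasing[OF r])
    fix x assume x: "a \<le> x" "x \<le> r"
    show "\<exists>y. ((\<lambda>x. (z x \<bullet> z x) * exp (2 * K / x)) has_field_derivative y) (at x) \<and> y \<le> 0"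
      using dphi[of x "2*K"] key[OF x(1)] x
      by (intro exI[of _ "(2 * (z x \<bullet> z' x) - 2 * K / x^2 * (z x \<bullet> z x)) * exp (2 * K / x)"])
        (auto intro!: mult_nonpos_nonneg)
  qed
  moreover have "1 \<le> exp (2 * K / r)" using K a r by simp
  hence "(z r \<bullet> z r) * 1 \<le> (z r \<bullet> z r) * exp (2 * K / r)" by (intro mult_left_mono) auto
  ultimately have "norm (z r) ^ 2 \<le> (exp (K/a) * norm (z a)) ^ 2"
    unfolding sq by (simp add: dot_square_norm)
  thus "norm (z r) \<le> exp (K / a) * norm (z a)" by (rule power2_le_imp_le) auto
  have "(z a \<bullet> z a) * exp (- 2 * K / a) \<le> (z r \<bullet> z r) * exp (- 2 * K / r)"
  proof (rule DERIV_nonneg_imp_nondecreasing[OF r])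
    fix x assume x: "a \<le> x" "x \<le> r"
    show "\<exists>y. ((\<lambda>x. (z x \<bullet> z x) * exp (- 2 * K / x)) has_field_derivative y) (at x) \<and> 0 \<le> y"
      using dphi[of x "-2*K"] key[OF x(1)] x
      by (intro exI[of _ "(2 * (z x \<bullet> z' x) - (-2) * K / x^2 * (z x \<bullet> z x)) * exp (- 2 * K / x)"])
        (auto intro!: mult_nonneg_nonneg)
  qed
  also have "\<dots> \<le> (z r \<bullet> z r) * 1" using K a r by (intro mult_left_mono) auto
  finally have "(z a \<bullet> z a) \<le> (z r \<bullet> z r) * exp (2 * K / a)" by (simp add: exp_minus field_simps)
  hence "norm (z a) ^ 2 \<le> (exp (K/a) * norm (z r)) ^ 2"
    unfolding sq by (simp add: dot_square_norm)
  thus "norm (z a) \<le> exp (K / a) * norm (z r)" by (rule power2_le_imp_le) auto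
qed

text \<open>By \<open>perturbed_growth\<close> the derivative of \<open>z\<close> is \<open>O(1 / r\<^sup>2)\<close>, hence integrable at infinity.\<close>

lemma perturbed_limit:
  fixes z z' :: "real \<Rightarrow> complex"
  assumes a: "0 < a" and K: "0 \<le> K"
    and d: "\<And>r. a \<le> r \<Longrightarrow> (z has_vector_derivative z' r) (at r)"
    and b: "\<And>r. a \<le> r \<Longrightarrow> norm (z' r) \<le> K / r^2 * norm (z r)"
    and nz: "z a \<noteq> 0"
  shows "\<exists>g. g \<noteq> 0 \<and> (z \<longlongrightarrow> g) at_top"
proof -
  note growth = perturbed_growth[OF a K d b]
  define C where "C = K * (exp (K / a) * norm (z a))"
  have C: "C \<ge> 0" unfolding C_def using K by auto
  have b2: "norm (z' r) \<le> C / r^2" if "a \<le> r" for r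
  proof -
    have "K / r^2 * norm (z r) \<le> K / r^2 * (exp (K/a) * norm (z a))"
      using K growth(1)[OF _ _ that] by (intro mult_left_mono) auto
    with b[OF that] show ?thesis by (simp add: C_def)
  qed
  have lip: "norm (z y - z x) \<le> C / x" if "a \<le> x" "x \<le> y" for x y
  proof (cases "x = y")
    case True thus ?thesis using C a that by simp
  next
    case False
    hence xy: "x < y" using that by simp
    have "norm (z y - z x) \<le> (- C / y) - (- C / x)"
    proof (rule differentiable_bound_general[OF xy])
      show "continuous_on {x..y} (\<lambda>t. - C / t)" using that a by (intro continuous_intros) auto
      show "continuous_on {x..y} z"
        using d that by (intro continuous_at_imp_continuous_on ballI)
          (auto intro!: has_vector_derivative_continuous[OF d])
      show "((\<lambda>t. - C / t) has_vector_derivative C / t^2) (at t)" if "x < t" "t < y" for t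
        using that \<open>a \<le> x\<close> a unfolding has_real_derivative_iff_has_vector_derivative[symmetric]
        by (auto intro!: derivative_eq_intros simp: power2_eq_square field_simps)
      show "(z has_vector_derivative z' t) (at t)" if "x < t" "t < y" for t
        using d that \<open>a \<le> x\<close> by auto
      show "norm (z' t) \<le> C / t^2" if "x < t" "t < y" for t using b2 that \<open>a \<le> x\<close> by auto
    qed
    also have "\<dots> \<le> C / x" using C a that by simp
    finally show ?thesis .
  qed
  have inv0: "((\<lambda>x. C / x) \<longlongrightarrow> 0) at_top" by real_asymp
  have inv1: "((\<lambda>n. C / (a + real n)) \<longlonglongrightarrow> 0)" by real_asymp
  have "Cauchy (\<lambda>n. z (a + real n))"
  proof (rule metric_CauchyI)
    fix e :: real assume "0 < e"
    with inv1 obtain N where N: "\<And>n. n \<ge> N \<Longrightarrow> C / (a + real n) < e"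
      by (metis (no_types, lifting) order_tendsto_iff eventually_sequentially)
    have "dist (z (a + real m)) (z (a + real n)) < e" if "m \<ge> N" "n \<ge> N" for m n
    proof (cases "m \<le> n")
      case True thus ?thesis using lip[of "a + real m" "a + real n"] N[OF that(1)] a by (simp add: dist_norm norm_minus_commute)
    next
      case False thus ?thesis using lip[of "a + real n" "a + real m"] N[OF that(2)] a by (simp add: dist_norm)
    qed
    thus "\<exists>M. \<forall>m\<ge>M. \<forall>n\<ge>M. dist (z (a + real m)) (z (a + real n)) < e" by blast
  qed
  then obtain g where g: "(\<lambda>n. z (a + real n)) \<longlonglongrightarrow> g"
    using Cauchy_convergent convergent_def by blast
  have zg: "norm (z r - g) \<le> C / r" if "a \<le> r" for r
  proof (rule LIMSEQ_le_const2[of "\<lambda>n. norm (z r - z (a + real n))"])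
    show "(\<lambda>n. norm (z r - z (a + real n))) \<longlonglongrightarrow> norm (z r - g)" by (intro tendsto_intros g)
    obtain N where "r \<le> real N" using real_arch_simple by blast
    hence "norm (z r - z (a + real n)) \<le> C / r" if "n \<ge> N" for n
      using lip[OF \<open>a \<le> r\<close>, of "a + real n"] that a by (simp add: norm_minus_commute)
    thus "\<exists>N. \<forall>n\<ge>N. norm (z r - z (a + real n)) \<le> C / r" by blast
  qed
  have lim: "(z \<longlongrightarrow> g) at_top"
    by (rule LIM_zero_cancel, rule Lim_null_comparison[OF _ inv0])
      (use zg in \<open>auto simp: eventually_at_top_linorder\<close>)
  have "norm (z a) \<le> exp (K / a) * norm g"
  proof (rule tendsto_lowerbound)
    show "((\<lambda>r. exp (K / a) * norm (z r)) \<longlongrightarrow> exp (K / a) * norm g) at_top" by (intro tendsto_intros lim)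
    show "\<forall>\<^sub>F r in at_top. norm (z a) \<le> exp (K / a) * norm (z r)"
      unfolding eventually_at_top_linorder using growth(2) by blast
  qed simp
  hence "g \<noteq> 0" using nz by auto
  with lim show ?thesis by blast
qed

definition scaled_bessel :: "int \<Rightarrow> real \<Rightarrow> real" where
  "scaled_bessel l r = sqrt r * bessel_J l r"

definition scaled_bessel_deriv :: "int \<Rightarrow> real \<Rightarrow> real" where
  "scaled_bessel_deriv l r = sqrt r * ((bessel_J (l-1) r - bessel_J (l+1) r) / 2) + bessel_J l r / (2 * sqrt r)"

text \<open>With \<open>w = sqrt r * J\<^sub>l\<close>, Bessel's equation reads \<open>w'' + (1 - (l\<^sup>2 - 1/4) / r\<^sup>2) w = 0\<close>, a perturbation
  of the harmonic oscillator. The phasor \<open>exp (\<i> r) (w + \<i> w')\<close> is constant for the unperturbed oscillator,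
  so here its derivative is of relative size \<open>\<bar>l\<^sup>2 - 1/4\<bar> / r\<^sup>2\<close>.\<close>

definition bessel_phasor :: "int \<Rightarrow> real \<Rightarrow> complex" where
  "bessel_phasor l r = cis r * Complex (scaled_bessel l r) (scaled_bessel_deriv l r)"

lemma scaled_bessel_has_deriv:
  "0 < r \<Longrightarrow> (scaled_bessel l has_field_derivative scaled_bessel_deriv l r) (at r)"
  unfolding scaled_bessel_def[abs_def] scaled_bessel_deriv_def
  by (auto intro!: derivative_eq_intros simp: field_simps)

lemma scaled_bessel_deriv_has_deriv:
  assumes "0 < r"
  shows "(scaled_bessel_deriv l has_field_derivative - (1 - (of_int l ^ 2 - 1/4) / r^2) * scaled_bessel l r) (at r)"
proof -
  obtain q where q: "q > 0" "r = q^2" using assms by (metis real_sqrt_gt_zero real_sqrt_pow2 less_imp_le)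
  have sq: "sqrt r = q" using q by simp
  let ?X = "bessel_J (l-2) r - 2 * bessel_J l r + bessel_J (l+2) r"
  let ?Y = "bessel_J (l-1) r - bessel_J (l+1) r"
  have "(scaled_bessel_deriv l has_field_derivative
     ?Y / (4 * sqrt r) + sqrt r * (?X / 4) + ?Y / (4 * sqrt r) - bessel_J l r / (4 * r * sqrt r)) (at r)"
    unfolding scaled_bessel_deriv_def[abs_def]
    apply (rule DERIV_cong)
     apply (rule derivative_intros refl bessel_J_deriv | (use assms in force))+
    unfolding sq using q(1) unfolding q(2)
    by (simp add: field_simps power2_eq_square)
  moreover have "?Y / (4 * q) + q * (?X / 4) + ?Y / (4 * q) - bessel_J l r / (4 * r * q)
     = - (1 - (of_int l ^ 2 - 1/4) / r^2) * (q * bessel_J l r)"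
  proof -
    have X: "?X = 4 * (- r * (?Y / 2) - (r^2 - of_int l ^ 2) * bessel_J l r) / r^2"
      using bessel_J_ode[of r l] assms by (simp add: field_simps)
    have "y / (4 * q) + q * (4 * (- (q^2) * (y / 2) - ((q^2)^2 - b) * c) / (q^2)^2 / 4) + y / (4 * q) - c / (4 * q^2 * q)
       = - (1 - (b - 1/4) / (q^2)^2) * (q * c)" for b c y :: real
      using q(1) by (simp add: field_simps power4_eq_xxxx power2_eq_square flip: power_mult)
    from this[of ?Y "of_int l ^ 2" "bessel_J l r"] show ?thesis unfolding X unfolding q(2) .
  qed
  ultimately show ?thesis unfolding scaled_bessel_def sq by simp
qed

lemma bessel_phasor_deriv:
  assumes "0 < r"
  shows "(bessel_phasor l has_vector_derivative
     cis r * (\<i> * of_real ((of_int l ^ 2 - 1/4) / r^2 * scaled_bessel l r))) (at r)"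
proof -
  define k where "k = (of_int l ^ 2 - 1/4) / r^2"
  have 1: "((\<lambda>r. Complex (scaled_bessel l r) (scaled_bessel_deriv l r)) has_vector_derivative
      Complex (scaled_bessel_deriv l r) (- (1 - k) * scaled_bessel l r)) (at r)"
    using scaled_bessel_has_deriv[OF assms, of l] scaled_bessel_deriv_has_deriv[OF assms, of l]
    unfolding has_vector_derivative_complex_iff k_def[symmetric]
    by simp
  have 2: "(cis has_vector_derivative \<i> * cis r) (at r)"
    unfolding has_vector_derivative_complex_iff
    by (auto intro!: derivative_eq_intros)
  show ?thesis unfolding bessel_phasor_def[abs_def] k_def[symmetric]
    by (rule has_vector_derivative_eq_rhs[OF has_vector_derivative_mult[OF 2 1]])
      (simp add: complex_eq_iff algebra_simps)
qed

lemma bessel_phasor_perturbed: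
  assumes "0 < r"
  shows "norm (cis r * (\<i> * of_real ((of_int l ^ 2 - 1/4) / r^2 * scaled_bessel l r)))
    \<le> \<bar>of_int l ^ 2 - 1/4\<bar> / r^2 * norm (bessel_phasor l r)"
proof -
  have "\<bar>scaled_bessel l r\<bar> \<le> norm (bessel_phasor l r)"
    using abs_Re_le_cmod[of "Complex (scaled_bessel l r) (scaled_bessel_deriv l r)"] unfolding bessel_phasor_def by (simp add: norm_mult)
  hence "\<bar>of_int l ^ 2 - 1/4\<bar> / r^2 * \<bar>scaled_bessel l r\<bar> \<le> \<bar>of_int l ^ 2 - 1/4\<bar> / r^2 * norm (bessel_phasor l r)"
    by (intro mult_left_mono) auto
  moreover have "norm (cis r * (\<i> * of_real x)) = \<bar>x\<bar>" for x by (simp add: norm_mult)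
  ultimately show ?thesis by (simp only: abs_mult abs_divide) simp
qed

text \<open>Up to \<open>r = l\<^sup>2\<close> the bound \<open>\<bar>J\<^sub>l\<bar> \<le> 1\<close> suffices. Beyond it, the perturbation of the oscillator
  has total size at most \<open>1\<close>, and so the phasor grows at most by the factor \<open>exp 1\<close>.\<close>

lemma scaled_bessel_bound:
  assumes "1 \<le> r"
  shows "\<bar>scaled_bessel l r\<bar> \<le> 9 * (1 + \<bar>of_int l\<bar>)"
proof -
  define m where "m = max 1 \<bar>real_of_int l\<bar>"
  have m: "m \<ge> 1" "m \<le> 1 + \<bar>real_of_int l\<bar>" by (auto simp: m_def)
  have m2: "real_of_int l ^ 2 \<le> m^2" "1 \<le> m^2"
    using power_mono[of "\<bar>real_of_int l\<bar>" m 2] m(1) by (auto simp: m_def one_le_power)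
  have A: "\<bar>scaled_bessel l x\<bar> \<le> sqrt x" if "x \<ge> 0" for x
    using bessel_J_le_1[of l x] that mult_left_mono[of _ 1 "sqrt x"] unfolding scaled_bessel_def by (simp add: abs_mult)
  show ?thesis
  proof (cases "r \<le> m^2")
    case True
    have "\<bar>scaled_bessel l r\<bar> \<le> sqrt r" using A assms by simp
    also have "\<dots> \<le> sqrt (m^2)" using True by (rule real_sqrt_le_mono)
    also have "\<dots> = m" using m by simp
    finally have "\<bar>scaled_bessel l r\<bar> \<le> m" .
    also have "m \<le> 9 * m" using m by simp
    also have "\<dots> \<le> 9 * (1 + \<bar>of_int l\<bar>)" using m by simp
    finally show ?thesis .
  next
    case False
    \<comment> \<open>Here \<open>m = max 1 \<bar>l\<bar>\<close>; the first factor \<open>3\<close> bounds \<open>exp 1\<close>, the second one the phasor at \<open>r = m\<^sup>2\<close> in units of \<open>m\<close>.\<close>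
    have m2pos: "0 < m^2" using m by simp
    have "norm (bessel_phasor l r) \<le> exp (\<bar>of_int l ^ 2 - 1/4\<bar> / m^2) * norm (bessel_phasor l (m^2))"
    proof (rule perturbed_growth(1)[OF m2pos _ bessel_phasor_deriv bessel_phasor_perturbed])
      show "0 < x" if "m^2 \<le> x" for x using m2pos that by linarith
      show "0 < x" if "m^2 \<le> x" for x using m2pos that by linarith
      show "m^2 \<le> r" using False by simp
    qed simp
    also have "\<dots> \<le> 3 * (3 * m)"
    proof (rule mult_mono)
      have "\<bar>of_int l ^ 2 - 1/4\<bar> / m^2 \<le> 1"
      proof -
        have "\<bar>real_of_int l ^ 2 - 1/4\<bar> \<le> m^2"
          using m2 zero_le_power2[of "real_of_int l"] by linarith
        thus ?thesis using m2pos by simp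
      qed
      hence "exp (\<bar>of_int l ^ 2 - 1/4\<bar> / m^2) \<le> exp (1::real)" by simp
      also have "\<dots> \<le> 3" by (rule exp_le)
      finally show "exp (\<bar>of_int l ^ 2 - 1/4\<bar> / m^2) \<le> (3::real)" .
      have "\<bar>scaled_bessel l (m^2)\<bar> \<le> m" using A[of "m^2"] m by simp
      moreover have "\<bar>scaled_bessel_deriv l (m^2)\<bar> \<le> m * 1 + 1 / (2 * m)"
      proof -
        have J: "\<bar>(bessel_J (l-1) (m^2) - bessel_J (l+1) (m^2)) / 2\<bar> \<le> 1"
          using bessel_J_le_1[of "l-1" "m^2"] bessel_J_le_1[of "l+1" "m^2"] unfolding abs_le_iff by simp
        have "\<bar>m * ((bessel_J (l-1) (m^2) - bessel_J (l+1) (m^2)) / 2)\<bar> \<le> m * 1"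
          unfolding abs_mult using m J by (intro mult_mono) auto
        moreover have "\<bar>bessel_J l (m^2) / (2 * m)\<bar> \<le> 1 / (2 * m)"
          using bessel_J_le_1[of l "m^2"] m by (simp add: divide_right_mono)
        moreover have "scaled_bessel_deriv l (m^2) = m * ((bessel_J (l-1) (m^2) - bessel_J (l+1) (m^2)) / 2) + bessel_J l (m^2) / (2 * m)"
          unfolding scaled_bessel_deriv_def using m by simp
        ultimately show ?thesis
          using abs_triangle_ineq[of "m * ((bessel_J (l-1) (m^2) - bessel_J (l+1) (m^2)) / 2)" "bessel_J l (m^2) / (2 * m)"] by simp
      qed
      moreover have "1 / (2 * m) \<le> m"
      proof -
        have "1 / (2 * m) \<le> 1" using m by simp
        thus ?thesis using m by linarith
      qed
      ultimately show "norm (bessel_phasor l (m^2)) \<le> 3 * m"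
        using cmod_le[of "Complex (scaled_bessel l (m^2)) (scaled_bessel_deriv l (m^2))"] unfolding bessel_phasor_def norm_mult norm_cis by simp
    qed auto
    also have "\<dots> \<le> 9 * (1 + \<bar>of_int l\<bar>)" using m by simp
    finally have "norm (bessel_phasor l r) \<le> 9 * (1 + \<bar>of_int l\<bar>)" .
    moreover have "\<bar>scaled_bessel l r\<bar> \<le> norm (bessel_phasor l r)"
      using abs_Re_le_cmod[of "Complex (scaled_bessel l r) (scaled_bessel_deriv l r)"] unfolding bessel_phasor_def norm_mult norm_cis by simp
    ultimately show ?thesis by (rule order_trans[rotated])
  qed
qed

lemma scaled_bessel_rec: "r \<noteq> 0 \<Longrightarrow> scaled_bessel (l + 1) r = 2 * of_int l / r * scaled_bessel l r - scaled_bessel (l - 1) r"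
proof -
  assume r: "r \<noteq> 0"
  hence "bessel_J (l + 1) r = 2 * of_int l / r * bessel_J l r - bessel_J (l - 1) r"
    using bessel_J_rec[of r l] by (simp add: field_simps)
  thus ?thesis unfolding scaled_bessel_def by (simp only: right_diff_distrib mult_ac)
qed

text \<open>The phasor of order \<open>0\<close> has a limit \<open>g\<close>, which gives the orders \<open>0\<close> and \<open>1\<close> as
  \<open>J\<^sub>1 = - J\<^sub>0'\<close>. The recurrence has the coefficient \<open>2 l / r\<close>, which vanishes at infinity, so that going up
  by two orders changes the sign in the limit; this is the factor \<open>\<i>\<^sup>l\<close>.\<close>

lemma scaled_bessel_asymptotic:
  "\<exists>g. g \<noteq> 0 \<and> (\<forall>l. ((\<lambda>r. scaled_bessel l r - Re (g * \<i> powi l * cis (- r))) \<longlongrightarrow> 0) at_top)"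
proof -
  \<comment> \<open>The limit of the phasor is non-zero if the phasor is non-zero at one point, and \<open>J\<^sub>0\<close> does not vanish near the origin.\<close>
  have "isCont (bessel_J 0) 0" using bessel_J_deriv DERIV_isCont by blast
  hence "\<forall>\<^sub>F x in at 0. bessel_J 0 x > 0"
    using bessel_J_0_0 by (auto simp: isCont_def order_tendsto_iff)
  hence "\<forall>\<^sub>F x in at_right 0. bessel_J 0 x > 0" by (rule filter_leD[rotated]) (simp add: at_le)
  then obtain b where "b > 0" "\<And>x. 0 < x \<Longrightarrow> x < b \<Longrightarrow> bessel_J 0 x > 0"
    unfolding eventually_at_right_field by auto
  hence a: "0 < b/2" "bessel_J 0 (b/2) \<noteq> 0" by (auto simp: less_le)
  have nz: "bessel_phasor 0 (b/2) \<noteq> 0"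
  proof
    assume "bessel_phasor 0 (b/2) = 0"
    hence "Complex (scaled_bessel 0 (b/2)) (scaled_bessel_deriv 0 (b/2)) = 0"
      unfolding bessel_phasor_def by (simp only: mult_eq_0_iff cis_neq_zero simp_thms)
    thus False using a by (simp add: complex_eq_iff scaled_bessel_def)
  qed
  obtain g where g: "g \<noteq> 0" "(bessel_phasor 0 \<longlongrightarrow> g) at_top"
    using perturbed_limit[OF a(1) abs_ge_zero bessel_phasor_deriv bessel_phasor_perturbed nz] a(1) by force
  have lim: "((\<lambda>r. cis (- r) * (bessel_phasor 0 r - g)) \<longlongrightarrow> 0) at_top"
    by (rule tendsto_norm_zero_cancel) (simp add: norm_mult, use g(2) in \<open>simp add: LIM_zero tendsto_norm_zero\<close>)
  have Z: "Complex (scaled_bessel 0 r) (scaled_bessel_deriv 0 r) = cis (- r) * bessel_phasor 0 r" for r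
    unfolding bessel_phasor_def by (simp add: mult.assoc[symmetric] cis_mult)
  have A0: "((\<lambda>r. scaled_bessel 0 r - Re (g * cis (- r))) \<longlongrightarrow> 0) at_top"
  proof -
    have "scaled_bessel 0 r - Re (g * cis (- r)) = Re (cis (- r) * (bessel_phasor 0 r - g))" for r
      using arg_cong[OF Z[of r], of Re] by (simp add: algebra_simps)
    thus ?thesis using tendsto_Re[OF lim] by simp
  qed
  have A1: "((\<lambda>r. scaled_bessel 1 r - Re (g * \<i> * cis (- r))) \<longlongrightarrow> 0) at_top"
  proof -
    have "scaled_bessel 1 r - Re (g * \<i> * cis (- r)) = bessel_J 0 r / (2 * sqrt r) - Im (cis (- r) * (bessel_phasor 0 r - g))" for r
    proof -
      have "bessel_J (-1) r = - bessel_J 1 r" using bessel_J_minus[of 1 r] by simp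
      hence "scaled_bessel_deriv 0 r = - scaled_bessel 1 r + bessel_J 0 r / (2 * sqrt r)"
        unfolding scaled_bessel_deriv_def scaled_bessel_def by (simp add: field_simps)
      moreover have "scaled_bessel_deriv 0 r = Im (cis (- r) * bessel_phasor 0 r)" using arg_cong[OF Z[of r], of Im] by simp
      ultimately show ?thesis by (simp add: algebra_simps)
    qed
    moreover have "((\<lambda>r. bessel_J 0 r / (2 * sqrt r)) \<longlongrightarrow> 0) at_top"
    proof (rule Lim_null_comparison)
      show "((\<lambda>r::real. 1 / (2 * sqrt r)) \<longlongrightarrow> 0) at_top" by real_asymp
      show "\<forall>\<^sub>F r in at_top. norm (bessel_J 0 r / (2 * sqrt r)) \<le> 1 / (2 * sqrt r)"
        by (rule eventually_mono[OF eventually_gt_at_top[of 0]])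
          (use bessel_J_le_1 in \<open>auto simp: abs_mult divide_right_mono\<close>)
    qed
    ultimately show ?thesis using tendsto_diff[OF _ tendsto_Im[OF lim]] by fastforce
  qed
  have nat2: "((\<lambda>r. scaled_bessel (int n) r - Re (g * \<i> ^ n * cis (- r))) \<longlongrightarrow> 0) at_top \<and>
     ((\<lambda>r. scaled_bessel (int (Suc n)) r - Re (g * \<i> ^ Suc n * cis (- r))) \<longlongrightarrow> 0) at_top" for n
  proof (induction n)
    case 0 thus ?case using A0 A1 by simp
  next
    case (Suc n)
    have "((\<lambda>r. 2 * of_int (int (Suc n)) / r * scaled_bessel (int (Suc n)) r) \<longlongrightarrow> 0) at_top"
    proof (rule Lim_null_comparison)
      show "((\<lambda>r::real. 2 * of_int (int (Suc n)) / r * (9 * (1 + \<bar>of_int (int (Suc n))\<bar>))) \<longlongrightarrow> 0) at_top" by real_asymp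
      show "\<forall>\<^sub>F r in at_top. norm (2 * of_int (int (Suc n)) / r * scaled_bessel (int (Suc n)) r) \<le> 2 * of_int (int (Suc n)) / r * (9 * (1 + \<bar>of_int (int (Suc n))\<bar>))"
      proof (rule eventually_mono[OF eventually_ge_at_top[of 1]])
        fix r :: real assume r: "1 \<le> r"
        have "\<bar>2 * of_int (int (Suc n)) / r\<bar> * \<bar>scaled_bessel (int (Suc n)) r\<bar> \<le> \<bar>2 * of_int (int (Suc n)) / r\<bar> * (9 * (1 + \<bar>of_int (int (Suc n))\<bar>))"
          by (intro mult_left_mono scaled_bessel_bound r) auto
        thus "norm (2 * of_int (int (Suc n)) / r * scaled_bessel (int (Suc n)) r) \<le> 2 * of_int (int (Suc n)) / r * (9 * (1 + \<bar>of_int (int (Suc n))\<bar>))"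
          using r by (simp add: abs_mult)
      qed
    qed
    from tendsto_diff[OF this Suc.IH[THEN conjunct1]]
    have "((\<lambda>r. 2 * of_int (int (Suc n)) / r * scaled_bessel (int (Suc n)) r - (scaled_bessel (int n) r - Re (g * \<i> ^ n * cis (- r)))) \<longlongrightarrow> 0) at_top"
      by simp
    moreover have "\<forall>\<^sub>F r in at_top. 2 * of_int (int (Suc n)) / r * scaled_bessel (int (Suc n)) r - (scaled_bessel (int n) r - Re (g * \<i> ^ n * cis (- r)))
       = scaled_bessel (int (Suc (Suc n))) r - Re (g * \<i> ^ Suc (Suc n) * cis (- r))"
    proof (rule eventually_mono[OF eventually_gt_at_top[of 0]])
      fix r :: real assume r: "0 < r"
      have i: "int (Suc n) + 1 = int (Suc (Suc n))" "int (Suc n) - 1 = int n" by auto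
      have "g * \<i> ^ Suc (Suc n) * cis (- r) = - (g * \<i> ^ n * cis (- r))" by (simp add: algebra_simps) 
      thus "2 * of_int (int (Suc n)) / r * scaled_bessel (int (Suc n)) r - (scaled_bessel (int n) r - Re (g * \<i> ^ n * cis (- r)))
       = scaled_bessel (int (Suc (Suc n))) r - Re (g * \<i> ^ Suc (Suc n) * cis (- r))"
        using scaled_bessel_rec[of r "int (Suc n)"] r unfolding i by simp
    qed
    ultimately have "((\<lambda>r. scaled_bessel (int (Suc (Suc n))) r - Re (g * \<i> ^ Suc (Suc n) * cis (- r))) \<longlongrightarrow> 0) at_top"
      using filterlim_cong[OF refl refl] by fast
    thus ?case using Suc.IH by blast
  qed
  have "((\<lambda>r. scaled_bessel l r - Re (g * \<i> powi l * cis (- r))) \<longlongrightarrow> 0) at_top" for l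
  proof (cases l)
    case (nonneg n) thus ?thesis using nat2[of n] by simp
  next
    case (neg n)
    have "scaled_bessel l r - Re (g * \<i> powi l * cis (- r)) = (-1) ^ Suc n * (scaled_bessel (int (Suc n)) r - Re (g * \<i> ^ Suc n * cis (- r)))" for r
    proof -
      have "\<i> powi l = (-1) ^ Suc n * \<i> ^ Suc n"
        unfolding neg power_int_minus power_int_of_nat
        by (simp add: power_mult_distrib[symmetric] flip: power_inverse)
      moreover have "scaled_bessel l r = (-1) ^ Suc n * scaled_bessel (int (Suc n)) r"
        unfolding neg scaled_bessel_def bessel_J_minus_nat by simp
      moreover have "Re (g * ((-1) ^ Suc n * \<i> ^ Suc n) * cis (- r)) = (-1) ^ Suc n * Re (g * \<i> ^ Suc n * cis (- r))"
        by (cases "even n") (simp_all add: algebra_simps)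
      ultimately show ?thesis by (simp only: right_diff_distrib)
    qed
    thus ?thesis using tendsto_mult_right_zero[OF nat2[of n, THEN conjunct2], of "(-1) ^ Suc n"] by (simp only:)
  qed
  with g(1) show ?thesis by blast
qed

text \<open>For \<open>n\<close> large compared with \<open>r\<^sup>2\<close>, the first terms of the power series of \<open>J\<^sub>n\<close> and of \<open>J\<^sub>n'\<close> dominate.\<close>

lemma bessel_J_nonvanishing:
  assumes "r \<noteq> 0"
  shows "\<exists>n\<ge>1. bessel_J (int n) r \<noteq> 0 \<and> bessel_J (int n - 1) r - bessel_J (int n + 1) r \<noteq> 0"
proof -
  define t where "t = (r/2)^2"
  define M where "M = t * exp t"
  have t: "t \<ge> 0" by (simp add: t_def)
  have b0: "bessel_entire n 0 = 1 / fact n" for n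
  proof -
    have "bessel_entire n 0 = (\<Sum>m\<in>{0}. bessel_coeff n m * 0 ^ m)" unfolding bessel_entire_def by (rule suminf_finite) auto
    thus ?thesis by (simp add: bessel_coeff_def)
  qed
  have near: "\<bar>bessel_entire n t - 1 / fact n\<bar> \<le> M / fact (Suc n)" for n
  proof -
    have "norm (bessel_entire n t - bessel_entire n 0) \<le> (exp t / fact (Suc n)) * norm (t - 0)"
    proof (rule field_differentiable_bound[of "{0..t}" "bessel_entire n" "\<lambda>x. - bessel_entire (Suc n) x"])
      show "norm (- bessel_entire (Suc n) x) \<le> exp t / fact (Suc n)" if "x \<in> {0..t}" for x
        using that by (intro order_trans[OF _ order_trans[OF bessel_entire_bound[of "Suc n" x] divide_right_mono]]) auto
    qed (use t in \<open>auto intro!: has_field_derivative_at_within bessel_entire_deriv\<close>)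
    thus ?thesis using t by (simp add: b0 M_def mult.commute)
  qed
  \<comment> \<open>All terms after the first one add up to at most \<open>M / (n + 1)\<close> times the first term of the power series.\<close>
  obtain n where n: "4 * M + 1 \<le> real n" using real_arch_simple by blast
  have M: "0 \<le> M" using t by (simp add: M_def)
  have n1: "n \<ge> 1" "4 * M \<le> real n" using n M by auto
  have "bessel_entire n t > 0"
  proof -
    have "M / fact (Suc n) \<le> (real n / 4) / fact (Suc n)" using n1 by (intro divide_right_mono) auto
    also have "\<dots> = (real n / (4 * (1 + real n))) / fact n" by (simp add: field_simps)
    also have "\<dots> < 1 / fact n" using n1 by (intro divide_strict_right_mono) (auto simp: field_simps)
    finally show ?thesis using near[of n] by linarith
  qed
  moreover have "bessel_entire (n-1) t - t * bessel_entire (n+1) t > 0"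
  proof -
    obtain k where k: "n = Suc k" using n1(1) by (cases n) auto
    have "M / fact (Suc k) = (M / real (Suc k)) / fact k" by (simp add: field_simps)
    also have "\<dots> \<le> (1/4) / fact k" using n1 k by (intro divide_right_mono) (auto simp: field_simps)
    finally have a: "M / fact (Suc k) \<le> (1/4) / fact k" .
    have b: "\<bar>t * bessel_entire (Suc (Suc k)) t\<bar> \<le> (1/4) / fact k"
    proof -
      have "\<bar>t * bessel_entire (Suc (Suc k)) t\<bar> \<le> t * (exp t / fact (Suc (Suc k)))"
        using mult_left_mono[OF bessel_entire_bound[of "Suc (Suc k)" t] t] t by (simp only: abs_mult abs_of_nonneg)
      also have "\<dots> = M / fact (Suc (Suc k))" by (simp add: M_def)
      also have "\<dots> \<le> M / fact (Suc k)"
        using M fact_mono[of "Suc k" "Suc (Suc k)", where 'a=real] by (intro divide_left_mono) auto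
      finally show ?thesis using a by linarith
    qed
    have "(1/4) / fact k < (1/2) / (fact k :: real)" by (intro divide_strict_right_mono) auto
    moreover have "1 / fact k = (1/2) / fact k + (1/2) / (fact k :: real)" by simp
    ultimately show ?thesis using near[of k] a b unfolding k by (simp add: abs_le_iff)
  qed
  moreover have "bessel_J (int n - 1) r - bessel_J (int n + 1) r = (r/2) ^ (n-1) * (bessel_entire (n-1) t - t * bessel_entire (n+1) t)"
  proof -
    have "int n - 1 = int (n - 1)" "int n + 1 = int (n + 1)" using n1(1) by auto
    moreover have "(r/2) ^ (n+1) = (r/2) ^ (n-1) * t"
    proof -
      have "n + 1 = (n - 1) + 2" using n1(1) by simp
      thus ?thesis unfolding t_def by (metis power_add)
    qed
    ultimately show ?thesis by (simp only: bessel_J_nonneg t_def[symmetric] right_diff_distrib mult.assoc)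
  qed
  ultimately show ?thesis using n1(1) assms
    by (intro exI[of _ n]) (auto simp: bessel_J_nonneg t_def[symmetric])
qed

section \<open>Sard's theorem with two parameters\<close>

abbreviation has_partials :: "(real ^ 2 \<Rightarrow> 'b::real_normed_vector) \<Rightarrow> 'b \<Rightarrow> 'b \<Rightarrow> real ^ 2 \<Rightarrow> bool" where
  "has_partials F u v x \<equiv> (F has_derivative (\<lambda>h. h $ 1 *\<^sub>R u + h $ 2 *\<^sub>R v)) (at x)"

text \<open>The determinant of two plane vectors, used for linear independence and for Jacobians. Derivatives
  of plane maps are given throughout by their two partial derivatives.\<close>

definition wedge :: "real ^ 2 \<Rightarrow> real ^ 2 \<Rightarrow> real" where
  "wedge u v = u $ 1 * v $ 2 - u $ 2 * v $ 1"

lemma wedge_self [simp]: "wedge u u = 0"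
  by (simp add: wedge_def)

lemma vec2_eq_iff: "(u :: real ^ 2) = v \<longleftrightarrow> u $ 1 = v $ 1 \<and> u $ 2 = v $ 2"
  by (simp add: vec_eq_iff forall_2)

lemma wedge_eq_0_imp_dependent:
  assumes "wedge u v = 0"
  shows "\<exists>h :: real ^ 2. h \<noteq> 0 \<and> h $ 1 *\<^sub>R u + h $ 2 *\<^sub>R v = 0"
proof (cases "u = 0 \<and> v = 0")
  case True thus ?thesis by (intro exI[of _ "axis 1 1"]) (auto simp: vec2_eq_iff)
next
  case False
  show ?thesis
  proof (cases "u $ 1 = 0 \<and> v $ 1 = 0")
    case True
    with False show ?thesis
      by (intro exI[of _ "vector [v $ 2, - u $ 2]"]) (auto simp: vec2_eq_iff)
  next
    case F: False
    with assms show ?thesis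
      by (intro exI[of _ "vector [v $ 1, - u $ 1]"]) (auto simp: vec2_eq_iff wedge_def)
  qed
qed

lemma wedge_nonzero_independent:
  assumes "wedge u v \<noteq> 0" "a *\<^sub>R u + b *\<^sub>R v = (0 :: real ^ 2)"
  shows "a = 0 \<and> b = 0"
proof -
  have e: "a * u $ 1 + b * v $ 1 = 0" "a * u $ 2 + b * v $ 2 = 0"
    using assms(2) by (auto simp: vec2_eq_iff)
  have "a * wedge u v = (a * u $ 1 + b * v $ 1) * v $ 2 - (a * u $ 2 + b * v $ 2) * v $ 1"
    "b * wedge u v = (a * u $ 2 + b * v $ 2) * u $ 1 - (a * u $ 1 + b * v $ 1) * u $ 2"
    by (simp_all add: wedge_def algebra_simps)
  hence "a * wedge u v = 0" "b * wedge u v = 0" unfolding e by simp_all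
  with assms(1) show ?thesis by simp
qed

lemma cramer_wedge:
  assumes "wedge u v \<noteq> 0"
  shows "(wedge y v / wedge u v) *\<^sub>R u + (wedge u y / wedge u v) *\<^sub>R v = y"
proof -
  have "wedge y v * u $ i + wedge u y * v $ i = wedge u v * y $ i" for i
    by (cases i rule: exhaust_2[THEN disjE]) (auto simp: wedge_def algebra_simps)
  hence "wedge u v * ((wedge y v / wedge u v) * u $ i + (wedge u y / wedge u v) * v $ i) = wedge u v * y $ i" for i
    using assms by (simp add: field_simps)
  thus ?thesis using assms by (simp add: vec_eq_iff)
qed

lemma differentiable_wedge:
  assumes "f differentiable (at x)" "g differentiable (at x)"
  shows "(\<lambda>x. wedge (f x) (g x)) differentiable (at x)"
proof -
  have c: "(\<lambda>x. f x $ i) differentiable (at x)" "(\<lambda>x. g x $ i) differentiable (at x)" for i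
    using assms bounded_linear.has_derivative[OF bounded_linear_vec_nth] unfolding differentiable_def by blast+
  show ?thesis unfolding wedge_def
    by (intro differentiable_diff differentiable_mult c)
qed

lemma continuous_on_wedge [continuous_intros]:
  "continuous_on S f \<Longrightarrow> continuous_on S g \<Longrightarrow> continuous_on S (\<lambda>x. wedge (f x) (g x))"
  unfolding wedge_def by (intro continuous_intros)

text \<open>Where \<open>P\<close> and \<open>Q\<close> are independent, \<open>G + c\<^sub>1 P + c\<^sub>2 Q\<close> vanishes at \<open>x\<close> exactly if \<open>c = F(x)\<close>, with \<open>F\<close>
  given by Cramer's rule. Differentiating \<open>G + F\<^sub>1 P + F\<^sub>2 Q = 0\<close> at such a point shows that a vector in the kernel
  of the derivative of \<open>G + c\<^sub>1 P + c\<^sub>2 Q\<close> is in the kernel of the derivative of \<open>F\<close>. So the parameters with a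
  degenerate zero are critical values of \<open>F\<close>.\<close>

lemma parametric_Sard:
  fixes G P Q :: "real ^ 2 \<Rightarrow> real ^ 2"
  assumes dG: "\<And>x. x \<in> K \<Longrightarrow> has_partials G (G1 x) (G2 x) x"
    and dP: "\<And>x. x \<in> K \<Longrightarrow> has_partials P (P1 x) (P2 x) x"
    and dQ: "\<And>x. x \<in> K \<Longrightarrow> has_partials Q (Q1 x) (Q2 x) x"
    and w: "\<And>x. x \<in> K \<Longrightarrow> wedge (P x) (Q x) \<noteq> 0"
  shows "negligible {c :: real ^ 2. \<exists>x\<in>K. G x + c $ 1 *\<^sub>R P x + c $ 2 *\<^sub>R Q x = 0 \<and>
     wedge (G1 x + c $ 1 *\<^sub>R P1 x + c $ 2 *\<^sub>R Q1 x) (G2 x + c $ 1 *\<^sub>R P2 x + c $ 2 *\<^sub>R Q2 x) = 0}"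
    (is "negligible ?bad")
proof -
  define p where "p = (\<lambda>x. - (wedge (G x) (Q x) / wedge (P x) (Q x)))"
  define q where "q = (\<lambda>x. - (wedge (P x) (G x) / wedge (P x) (Q x)))"
  define F :: "real ^ 2 \<Rightarrow> real ^ 2" where "F = (\<lambda>x. p x *\<^sub>R axis 1 1 + q x *\<^sub>R axis 2 1)"
  have F: "F x $ 1 = p x" "F x $ 2 = q x" for x
    unfolding F_def by (simp_all add: axis_def)
  have solve: "G x + p x *\<^sub>R P x + q x *\<^sub>R Q x = 0" if "wedge (P x) (Q x) \<noteq> 0" for x
    using cramer_wedge[OF that, of "G x"] unfolding p_def q_def
    by (simp only: scaleR_minus_left) (simp add: algebra_simps)
  have diff: "G differentiable (at x)" "P differentiable (at x)" "Q differentiable (at x)" if "x \<in> K" for x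
    using dG[OF that] dP[OF that] dQ[OF that] unfolding differentiable_def by blast+
  have dpq: "p differentiable (at x)" "q differentiable (at x)" if "x \<in> K" for x
    unfolding p_def q_def using diff[OF that] w[OF that]
    by (auto intro!: differentiable_minus differentiable_divide differentiable_wedge)
  have dF: "F differentiable (at x)" if "x \<in> K" for x
    unfolding F_def using dpq[OF that]
    by (intro differentiable_add) (auto intro!: differentiable_scaleR)
  define F' where "F' = (\<lambda>x. frechet_derivative F (at x))"
  have F': "(F has_derivative F' x) (at x)" if "x \<in> K" for x
    unfolding F'_def using dF[OF that] by (simp add: frechet_derivative_works[symmetric])
  define T where "T = {x \<in> K. \<exists>v. v \<noteq> 0 \<and> F' x v = 0}"
  have "negligible (F ` T)"
  proof (rule baby_Sard)
    fix x assume "x \<in> T"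
    then obtain v where x: "x \<in> K" and v: "v \<noteq> 0" "F' x v = 0" unfolding T_def by blast
    show "(F has_derivative F' x) (at x within T)"
      by (rule has_derivative_at_withinI[OF F'[OF x]])
    have lin: "linear (F' x)" using F'[OF x] by (rule has_derivative_linear)
    have "\<not> inj ((*v) (matrix (F' x)))"
    proof
      assume "inj ((*v) (matrix (F' x)))"
      hence "inj (F' x)" unfolding matrix_vector_mul(2)[OF lin] .
      thus False using v linear_0[OF lin] by (metis injD)
    qed
    thus "rank (matrix (F' x)) < CARD(2)" by (subst less_rank_noninjective)
  qed simp
  moreover have "?bad \<subseteq> F ` T"
  proof
    fix c assume "c \<in> ?bad"
    then obtain x where x: "x \<in> K" and z: "G x + c $ 1 *\<^sub>R P x + c $ 2 *\<^sub>R Q x = 0"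
      and wz: "wedge (G1 x + c $ 1 *\<^sub>R P1 x + c $ 2 *\<^sub>R Q1 x) (G2 x + c $ 1 *\<^sub>R P2 x + c $ 2 *\<^sub>R Q2 x) = 0"
      by blast
    have "(c $ 1 - p x) *\<^sub>R P x + (c $ 2 - q x) *\<^sub>R Q x = 0"
    proof -
      have "(c $ 1 - p x) *\<^sub>R P x + (c $ 2 - q x) *\<^sub>R Q x =
        (G x + c $ 1 *\<^sub>R P x + c $ 2 *\<^sub>R Q x) - (G x + p x *\<^sub>R P x + q x *\<^sub>R Q x)"
        by (simp add: algebra_simps)
      thus ?thesis unfolding z solve[OF w[OF x]] by simp
    qed
    from wedge_nonzero_independent[OF w[OF x] this] have c: "c $ 1 = p x" "c $ 2 = q x" by auto
    hence cF: "c = F x" by (simp add: vec2_eq_iff F)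
    obtain v :: "real ^ 2" where v: "v \<noteq> 0"
      "v $ 1 *\<^sub>R (G1 x + p x *\<^sub>R P1 x + q x *\<^sub>R Q1 x) + v $ 2 *\<^sub>R (G2 x + p x *\<^sub>R P2 x + q x *\<^sub>R Q2 x) = 0"
      using wedge_eq_0_imp_dependent[OF wz] c by auto
    obtain p' q' where p': "(p has_derivative p') (at x)" and q': "(q has_derivative q') (at x)"
      using dpq[OF x] unfolding differentiable_def by blast
    have cont: "continuous (at x) (\<lambda>y. wedge (P y) (Q y))"
      using differentiable_wedge[OF diff(2,3)[OF x]] by (rule differentiable_imp_continuous_within)
    \<comment> \<open>Independence is an open condition, so the identity holds near \<open>x\<close> and can be differentiated.\<close>
    have ev: "\<forall>\<^sub>F y in nhds x. G y + p y *\<^sub>R P y + q y *\<^sub>R Q y = 0"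
    proof -
      have "\<forall>\<^sub>F y in nhds x. wedge (P y) (Q y) \<noteq> 0"
        using cont w[OF x] by (simp add: isCont_def tendsto_imp_eventually_ne eventually_nhds_conv_at)
      thus ?thesis by eventually_elim (rule solve)
    qed
    have "((\<lambda>y. G y + p y *\<^sub>R P y + q y *\<^sub>R Q y) has_derivative
       (\<lambda>h. (h $ 1 *\<^sub>R G1 x + h $ 2 *\<^sub>R G2 x) + (p x *\<^sub>R (h $ 1 *\<^sub>R P1 x + h $ 2 *\<^sub>R P2 x) + p' h *\<^sub>R P x)
         + (q x *\<^sub>R (h $ 1 *\<^sub>R Q1 x + h $ 2 *\<^sub>R Q2 x) + q' h *\<^sub>R Q x))) (at x)"
      by (intro has_derivative_add has_derivative_scaleR dG dP dQ p' q' x)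
    hence "((\<lambda>y. 0) has_derivative
       (\<lambda>h. (h $ 1 *\<^sub>R G1 x + h $ 2 *\<^sub>R G2 x) + (p x *\<^sub>R (h $ 1 *\<^sub>R P1 x + h $ 2 *\<^sub>R P2 x) + p' h *\<^sub>R P x)
         + (q x *\<^sub>R (h $ 1 *\<^sub>R Q1 x + h $ 2 *\<^sub>R Q2 x) + q' h *\<^sub>R Q x))) (at x)"
      using ev has_derivative_transform_eventually[of _ _ x UNIV "\<lambda>y. 0"]
      by (smt (verit, ccfv_SIG) UNIV_I eventually_nhds_conv_at eventually_mono)
    hence "(\<lambda>h. (h $ 1 *\<^sub>R G1 x + h $ 2 *\<^sub>R G2 x) + (p x *\<^sub>R (h $ 1 *\<^sub>R P1 x + h $ 2 *\<^sub>R P2 x) + p' h *\<^sub>R P x)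
         + (q x *\<^sub>R (h $ 1 *\<^sub>R Q1 x + h $ 2 *\<^sub>R Q2 x) + q' h *\<^sub>R Q x)) = (\<lambda>h. 0)"
      by (rule has_derivative_unique[OF _ has_derivative_const])
    from fun_cong[OF this, of v] have Dv: "(v $ 1 *\<^sub>R G1 x + v $ 2 *\<^sub>R G2 x) + (p x *\<^sub>R (v $ 1 *\<^sub>R P1 x + v $ 2 *\<^sub>R P2 x) + p' v *\<^sub>R P x)
         + (q x *\<^sub>R (v $ 1 *\<^sub>R Q1 x + v $ 2 *\<^sub>R Q2 x) + q' v *\<^sub>R Q x) = 0" .
    have "p' v *\<^sub>R P x + q' v *\<^sub>R Q x = 0"
    proof -
      have "p' v *\<^sub>R P x + q' v *\<^sub>R Q x =
        ((v $ 1 *\<^sub>R G1 x + v $ 2 *\<^sub>R G2 x) + (p x *\<^sub>R (v $ 1 *\<^sub>R P1 x + v $ 2 *\<^sub>R P2 x) + p' v *\<^sub>R P x)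
         + (q x *\<^sub>R (v $ 1 *\<^sub>R Q1 x + v $ 2 *\<^sub>R Q2 x) + q' v *\<^sub>R Q x))
        - (v $ 1 *\<^sub>R (G1 x + p x *\<^sub>R P1 x + q x *\<^sub>R Q1 x) + v $ 2 *\<^sub>R (G2 x + p x *\<^sub>R P2 x + q x *\<^sub>R Q2 x))"
        by (simp add: algebra_simps)
      thus ?thesis unfolding Dv v(2) by simp
    qed
    from wedge_nonzero_independent[OF w[OF x] this] have "p' v = 0" "q' v = 0" by auto
    moreover have "(F has_derivative (\<lambda>h. p' h *\<^sub>R axis 1 1 + q' h *\<^sub>R axis 2 1)) (at x)"
      unfolding F_def by (intro has_derivative_add has_derivative_scaleR_left p' q')
    hence "F' x = (\<lambda>h. p' h *\<^sub>R axis 1 1 + q' h *\<^sub>R axis 2 1)"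
      using F'[OF x] by (rule has_derivative_unique[rotated])
    ultimately have "F' x v = 0" by simp
    hence "x \<in> T" using x v(1) unfolding T_def by blast
    thus "c \<in> F ` T" using cF by blast
  qed
  ultimately show ?thesis by (rule negligible_subset)
qed

section \<open>Resampling coordinates of a Gaussian sequence\<close>

abbreviation gauss :: "real measure" where
  "gauss \<equiv> density lborel (\<lambda>x. ennreal (std_normal_density x))"

abbreviation gauss_seq :: "(nat \<Rightarrow> real) measure" where
  "gauss_seq \<equiv> PiM UNIV (\<lambda>_. gauss)"

lemma prob_space_gauss: "prob_space gauss"
  by (rule prob_space_normal_density) simp

lemma AE_gauss_of_lborel: "AE t in lborel. Q t \<Longrightarrow> AE t in gauss. Q t"
  by (subst AE_density) auto

lemma AE_gauss_of_negligible:
  assumes "negligible (S :: (real ^ 2) set)"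
  shows "AE t in gauss. AE u in gauss. (vector [t, u] :: real ^ 2) \<notin> S"
proof -
  define f :: "real ^ 2 \<Rightarrow> real \<times> real" where "f = (\<lambda>v. (v $ 1, v $ 2))"
  have "negligible (f ` S)"
  proof (rule negligible_differentiable_image_negligible)
    show "DIM(real ^ 2) \<le> DIM(real \<times> real)" by simp
    show "f differentiable_on S" unfolding f_def
      by (intro bounded_linear_imp_differentiable_on bounded_linear_Pair bounded_linear_vec_nth)
  qed fact
  hence "AE x in lebesgue. x \<notin> f ` S"
    unfolding negligible_iff_null_sets by (rule AE_not_in)
  hence "AE x in lborel \<Otimes>\<^sub>M lborel. x \<notin> f ` S"
    unfolding AE_completion_iff lborel_prod .
  from lborel_pair.AE_pair[OF this]
  have "AE t in lborel. AE u in lborel. (t, u) \<notin> f ` S" .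
  moreover have "(t, u) \<in> f ` S" if "vector [t, u] \<in> S" for t u
    using that unfolding f_def by (intro image_eqI[OF _ that]) auto
  ultimately have "AE t in lborel. AE u in lborel. (vector [t, u] :: real ^ 2) \<notin> S"
    by (elim eventually_mono) (auto elim!: eventually_mono)
  thus ?thesis
    by (intro AE_gauss_of_lborel, elim eventually_mono) (rule AE_gauss_of_lborel)
qed

text \<open>Independence of the coordinates in the form of a Fubini argument: replacing two coordinates by fresh
  copies does not change the law of the sequence. Measurability of the event is essential here, since the
  assumption concerns its two-dimensional sections only.\<close>

lemma AE_resample:
  fixes N :: "real measure" and P :: "(nat \<Rightarrow> real) \<Rightarrow> bool"
  assumes N: "prob_space N" and ij: "i \<noteq> j"
    and meas: "Measurable.pred (PiM UNIV (\<lambda>_. N)) P"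
    and ae: "\<And>b. AE t in N. AE u in N. P (b(i := t, j := u))"
  shows "AE b in PiM UNIV (\<lambda>_. N). P b"
proof -
  interpret N: prob_space N by (rule N)
  define M1 where "M1 = PiM (UNIV - {i}) (\<lambda>_. N)"
  define M2 where "M2 = PiM (UNIV - {i, j}) (\<lambda>_. N)"
  have I1: "insert i (UNIV - {i}) = UNIV" by auto
  have I2: "insert j (UNIV - {i, j}) = UNIV - {i}" using ij by auto
  interpret M1: prob_space M1 unfolding M1_def by (intro prob_space_PiM N)
  interpret M2: prob_space M2 unfolding M2_def by (intro prob_space_PiM N)
  interpret NN: pair_prob_space N N ..
  interpret NM1: pair_prob_space N M1 ..
  interpret NM2: pair_prob_space N M2 ..
  interpret NN2: pair_prob_space "N \<Otimes>\<^sub>M N" M2 ..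
  have m1: "(\<lambda>(x, X). X(i := x)) \<in> measurable (N \<Otimes>\<^sub>M M1) (PiM UNIV (\<lambda>_. N))"
    unfolding M1_def case_prod_beta by (rule measurable_fun_upd[where J="UNIV - {i}"]) (auto simp: I1)
  have m2: "(\<lambda>(x, X). X(j := x)) \<in> measurable (N \<Otimes>\<^sub>M M2) M1"
    unfolding M1_def M2_def case_prod_beta by (rule measurable_fun_upd[where J="UNIV - {i, j}"]) (use ij in auto)
  have e1: "PiM UNIV (\<lambda>_. N) = distr (N \<Otimes>\<^sub>M M1) (PiM UNIV (\<lambda>_. N)) (\<lambda>(x, X). X(i := x))"
    using distr_pair_PiM_eq_PiM[of "UNIV - {i}" "\<lambda>_. N" i] N unfolding I1 M1_def by simp
  have e2: "M1 = distr (N \<Otimes>\<^sub>M M2) M1 (\<lambda>(x, X). X(j := x))"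
    using distr_pair_PiM_eq_PiM[of "UNIV - {i, j}" "\<lambda>_. N" j] N unfolding I2 M1_def M2_def by simp
  have m3: "(\<lambda>(z, Y). Y(j := snd z, i := fst z)) \<in> measurable ((N \<Otimes>\<^sub>M N) \<Otimes>\<^sub>M M2) (PiM UNIV (\<lambda>_. N))"
  proof -
    have "(\<lambda>w. (fst (fst w), (snd (fst w), snd w))) \<in> measurable ((N \<Otimes>\<^sub>M N) \<Otimes>\<^sub>M M2) (N \<Otimes>\<^sub>M (N \<Otimes>\<^sub>M M2))"
      by measurable
    moreover have "(\<lambda>w. (fst w, (\<lambda>(x, X). X(j := x)) (snd w))) \<in> measurable (N \<Otimes>\<^sub>M (N \<Otimes>\<^sub>M M2)) (N \<Otimes>\<^sub>M M1)"
      using m2 by measurable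
    ultimately have "(\<lambda>(x, X). X(i := x)) \<circ> ((\<lambda>w. (fst w, (\<lambda>(x, X). X(j := x)) (snd w))) \<circ> (\<lambda>w. (fst (fst w), (snd (fst w), snd w))))
      \<in> measurable ((N \<Otimes>\<^sub>M N) \<Otimes>\<^sub>M M2) (PiM UNIV (\<lambda>_. N))"
      using m1 by (intro measurable_comp)
    thus ?thesis by (simp add: comp_def case_prod_beta)
  qed
  have pm1: "Measurable.pred (N \<Otimes>\<^sub>M M1) (\<lambda>w. P ((snd w)(i := fst w)))"
    using measurable_compose[OF m1 meas] by (simp add: case_prod_beta)
  have pm3: "Measurable.pred ((N \<Otimes>\<^sub>M N) \<Otimes>\<^sub>M M2) (\<lambda>w. P ((snd w)(j := snd (fst w), i := fst (fst w))))"
    using measurable_compose[OF m3 meas] by (simp add: case_prod_beta)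
  \<comment> \<open>The two fresh coordinates are integrated first, for each value \<open>Y\<close> of all the others.\<close>
  have "AE z in N \<Otimes>\<^sub>M N. P (Y(j := snd z, i := fst z))" if "Y \<in> space M2" for Y
  proof (rule NN.AE_pair_measure)
    have "(\<lambda>z. (z, Y)) \<in> measurable (N \<Otimes>\<^sub>M N) ((N \<Otimes>\<^sub>M N) \<Otimes>\<^sub>M M2)"
      using that by measurable
    from measurable_compose[OF this pm3]
    show "{z \<in> space (N \<Otimes>\<^sub>M N). P (Y(j := snd z, i := fst z))} \<in> sets (N \<Otimes>\<^sub>M N)" by (simp add: pred_def)
    show "AE t in N. AE u in N. P (Y(j := snd (t, u), i := fst (t, u)))"
      using ae[of Y] ij by (simp add: fun_upd_twist)
  qed
  hence "AE Y in M2. AE z in N \<Otimes>\<^sub>M N. P (Y(j := snd z, i := fst z))" by (rule AE_I2)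
  moreover have "(AE z in N \<Otimes>\<^sub>M N. AE Y in M2. P (Y(j := snd z, i := fst z))) \<longleftrightarrow>
      (AE Y in M2. AE z in N \<Otimes>\<^sub>M N. P (Y(j := snd z, i := fst z)))"
    by (rule NN2.AE_commute) (use pm3 in \<open>simp add: pred_def\<close>)
  ultimately have "AE z in N \<Otimes>\<^sub>M N. AE Y in M2. P (Y(j := snd z, i := fst z))" by blast
  from NN.AE_pair[OF this]
  have tu: "AE t in N. AE u in N. AE Y in M2. P (Y(j := u, i := t))" by simp
  have "AE t in N. AE X in M1. P (X(i := t))"
    using tu AE_space
  proof eventually_elim
    case (elim t)
    have pt: "Measurable.pred M1 (\<lambda>X. P (X(i := t)))"
    proof -
      have "(\<lambda>X. (t, X)) \<in> measurable M1 (N \<Otimes>\<^sub>M M1)" using elim(2) by measurable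
      from measurable_compose[OF this pm1] show ?thesis by simp
    qed
    have "AE w in N \<Otimes>\<^sub>M M2. P ((snd w)(j := fst w, i := t))"
    proof (rule NM2.AE_pair_measure)
      show "AE u in N. AE Y in M2. P ((snd (u, Y))(j := fst (u, Y), i := t))" using elim(1) by simp
      from measurable_compose[OF m2 pt]
      show "{w \<in> space (N \<Otimes>\<^sub>M M2). P ((snd w)(j := fst w, i := t))} \<in> sets (N \<Otimes>\<^sub>M M2)"
        by (simp add: pred_def case_prod_beta)
    qed
    thus ?case
      by (subst e2, subst AE_distr_iff[OF m2]) (use pt in \<open>auto simp: pred_def case_prod_beta\<close>)
  qed
  hence "AE w in N \<Otimes>\<^sub>M M1. P ((snd w)(i := fst w))"
    by (intro NM1.AE_pair_measure) (use pm1 in \<open>auto simp: pred_def\<close>)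
  thus ?thesis
    by (subst e1, subst AE_distr_iff[OF m1]) (use meas in \<open>auto simp: pred_def case_prod_beta\<close>)
qed

section \<open>Series of vector fields with Gaussian coefficients\<close>

definition wseries :: "(nat \<Rightarrow> 'a \<Rightarrow> 'b::banach) \<Rightarrow> (nat \<Rightarrow> real) \<Rightarrow> 'a \<Rightarrow> 'b" where
  "wseries A b x = (\<Sum>k. b k *\<^sub>R A k x)"

lemma wseries_term_bound:
  assumes "norm v \<le> m"
  shows "norm (c *\<^sub>R v) \<le> \<bar>c\<bar> * m"
  using assms by (simp add: mult_left_mono)

lemma wseries_summable:
  fixes A :: "nat \<Rightarrow> 'a \<Rightarrow> 'b::banach"
  assumes "summable (\<lambda>k. \<bar>b k\<bar> * \<kappa> k)" "\<And>k. norm (A k x) \<le> \<kappa> k"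
  shows "summable (\<lambda>k. b k *\<^sub>R A k x)"
  by (rule summable_comparison_test'[where N=0, OF assms(1)]) (rule wseries_term_bound[OF assms(2)])

lemma wseries_sums:
  assumes "summable (\<lambda>k. \<bar>b k\<bar> * \<kappa> k)" "\<And>k. norm (A k x) \<le> \<kappa> k"
  shows "(\<lambda>k. b k *\<^sub>R A k x) sums wseries A b x"
  unfolding wseries_def by (rule summable_sums[OF wseries_summable[where A=A and \<kappa>=\<kappa>, OF assms]])

lemma wseries_bound:
  assumes "summable (\<lambda>k. \<bar>b k\<bar> * \<kappa> k)" "\<And>k. norm (A k x) \<le> \<kappa> k"
  shows "norm (wseries A b x) \<le> (\<Sum>k. \<bar>b k\<bar> * \<kappa> k)"
  unfolding wseries_def by (rule norm_suminf_le[OF wseries_term_bound[OF assms(2)] assms(1)])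

lemma wseries_uniform_limit:
  assumes "summable (\<lambda>k. \<bar>b k\<bar> * \<kappa> k)" "\<And>k x. x \<in> X \<Longrightarrow> norm (A k x) \<le> \<kappa> k"
  shows "uniform_limit X (\<lambda>n x. \<Sum>k<n. b k *\<^sub>R A k x) (wseries A b) sequentially"
  unfolding wseries_def by (rule Weierstrass_m_test[OF wseries_term_bound[OF assms(2)] assms(1)])

lemma wseries_continuous:
  assumes "summable (\<lambda>k. \<bar>b k\<bar> * \<kappa> k)" "\<And>k x. x \<in> X \<Longrightarrow> norm (A k x) \<le> \<kappa> k"
    and "\<And>k. continuous_on X (A k)"
  shows "continuous_on X (wseries A b)"
  by (rule uniform_limit_theorem[OF _ wseries_uniform_limit[where A=A and \<kappa>=\<kappa>, OF assms(1,2)]])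
    (auto intro!: always_eventually continuous_intros assms(3))

lemma wseries_has_derivative:
  fixes A B C :: "nat \<Rightarrow> real ^ 2 \<Rightarrow> 'b::banach"
  assumes s: "summable (\<lambda>k. \<bar>b k\<bar> * \<kappa> k)"
    and A: "\<And>k x. norm (A k x) \<le> \<kappa> k" and B: "\<And>k x. norm (B k x) \<le> \<kappa> k" and C: "\<And>k x. norm (C k x) \<le> \<kappa> k"
    and d: "\<And>k x. has_partials (A k) (B k x) (C k x) x"
  shows "has_partials (wseries A b) (wseries B b x) (wseries C b x) x"
proof -
  have "\<exists>g. \<forall>x\<in>UNIV. (\<lambda>k. b k *\<^sub>R A k x) sums g x \<and>
     (g has_derivative (\<lambda>h. h $ 1 *\<^sub>R wseries B b x + h $ 2 *\<^sub>R wseries C b x)) (at x within UNIV)"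
  proof (rule has_derivative_series[where x=0 and l="wseries A b 0"])
    show "((\<lambda>x. b k *\<^sub>R A k x) has_derivative (\<lambda>h. b k *\<^sub>R (h $ 1 *\<^sub>R B k x + h $ 2 *\<^sub>R C k x))) (at x within UNIV)" for k x
      by (intro has_derivative_scaleR_right d)
    show "(\<lambda>k. b k *\<^sub>R A k 0) sums wseries A b 0" by (rule wseries_sums[where A=A and x=0 and \<kappa>=\<kappa>, OF s A])
    fix e :: real assume e: "e > 0"
    have "\<forall>\<^sub>F n in sequentially. \<forall>x\<in>UNIV. dist (\<Sum>k<n. b k *\<^sub>R B k x) (wseries B b x) < e / 2"
      "\<forall>\<^sub>F n in sequentially. \<forall>x\<in>UNIV. dist (\<Sum>k<n. b k *\<^sub>R C k x) (wseries C b x) < e / 2"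
      using wseries_uniform_limit[where A=B and \<kappa>=\<kappa> and X=UNIV, OF s B] wseries_uniform_limit[where A=C and \<kappa>=\<kappa> and X=UNIV, OF s C] half_gt_zero[OF e] unfolding uniform_limit_iff by blast+
    thus "\<forall>\<^sub>F n in sequentially. \<forall>x\<in>UNIV. \<forall>h :: real ^ 2. norm ((\<Sum>k<n. b k *\<^sub>R (h $ 1 *\<^sub>R B k x + h $ 2 *\<^sub>R C k x)) -
        (h $ 1 *\<^sub>R wseries B b x + h $ 2 *\<^sub>R wseries C b x)) \<le> e * norm h"
    proof eventually_elim
      case (elim n)
      show ?case
      proof (intro ballI allI)
        fix x h :: "real ^ 2"
        have "(\<Sum>k<n. b k *\<^sub>R (h $ 1 *\<^sub>R B k x + h $ 2 *\<^sub>R C k x)) - (h $ 1 *\<^sub>R wseries B b x + h $ 2 *\<^sub>R wseries C b x)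
          = h $ 1 *\<^sub>R ((\<Sum>k<n. b k *\<^sub>R B k x) - wseries B b x) + h $ 2 *\<^sub>R ((\<Sum>k<n. b k *\<^sub>R C k x) - wseries C b x)"
          by (simp add: scaleR_add_right scaleR_sum_right sum.distrib scaleR_diff_right mult.commute)
        also have "norm \<dots> \<le> norm (h $ 1 *\<^sub>R ((\<Sum>k<n. b k *\<^sub>R B k x) - wseries B b x)) + norm (h $ 2 *\<^sub>R ((\<Sum>k<n. b k *\<^sub>R C k x) - wseries C b x))"
          by (rule norm_triangle_ineq)
        also have "\<dots> \<le> norm h * (e/2) + norm h * (e/2)"
          unfolding norm_scaleR using elim e component_le_norm_cart[of h]
          by (intro add_mono mult_mono) (auto simp: dist_norm less_imp_le)
        finally show "norm ((\<Sum>k<n. b k *\<^sub>R (h $ 1 *\<^sub>R B k x + h $ 2 *\<^sub>R C k x)) -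
          (h $ 1 *\<^sub>R wseries B b x + h $ 2 *\<^sub>R wseries C b x)) \<le> e * norm h" by (simp add: mult.commute)
      qed
    qed
  qed auto
  then obtain g where g: "\<And>x. (\<lambda>k. b k *\<^sub>R A k x) sums g x"
    "\<And>x. has_partials g (wseries B b x) (wseries C b x) x" by auto
  have "g = wseries A b" using sums_unique2[OF g(1) wseries_sums[where A=A and \<kappa>=\<kappa>, OF s A]] by auto
  with g(2) show ?thesis by simp
qed

text \<open>Isolates the two coefficients to which Sard's theorem is applied.\<close>

lemma wseries_update2:
  assumes s: "summable (\<lambda>k. \<bar>b k\<bar> * \<kappa> k)" and A: "\<And>k. norm (A k x) \<le> \<kappa> k" and ij: "i \<noteq> j"
  shows "wseries A (b(i := t, j := u)) x = wseries A (b(i := 0, j := 0)) x + t *\<^sub>R A i x + u *\<^sub>R A j x"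
proof -
  have "summable (\<lambda>k. \<bar>(b(i := 0, j := 0)) k\<bar> * \<kappa> k)"
  proof (rule summable_comparison_test'[OF s, of 0])
    fix n
    have "0 \<le> \<kappa> n" using A[of n] norm_ge_zero order_trans by blast
    thus "norm (\<bar>(b(i := 0, j := 0)) n\<bar> * \<kappa> n) \<le> \<bar>b n\<bar> * \<kappa> n" by (auto simp: abs_mult)
  qed
  from sums_add[OF sums_add[OF wseries_sums[where A=A and \<kappa>=\<kappa> and x=x, OF this A] sums_single[of i "\<lambda>k. t *\<^sub>R A k x"]] sums_single[of j "\<lambda>k. u *\<^sub>R A k x"]]
  have "(\<lambda>k. (b(i := t, j := u)) k *\<^sub>R A k x) sums (wseries A (b(i := 0, j := 0)) x + t *\<^sub>R A i x + u *\<^sub>R A j x)"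
    by (rule sums_cong[THEN iffD1, rotated]) (use ij in auto)
  thus ?thesis unfolding wseries_def by (simp add: sums_iff)
qed

lemma summable_update:
  fixes b :: "nat \<Rightarrow> real"
  shows "summable (\<lambda>k. \<bar>(b(i := t)) k\<bar> * \<kappa> k) \<longleftrightarrow> summable (\<lambda>k. \<bar>b k\<bar> * \<kappa> k)"
  by (rule summable_cong) (rule eventually_sequentiallyI[of "Suc i"], auto)

lemma summable_iff_ennreal_suminf:
  assumes "\<And>k. 0 \<le> \<kappa> k"
  shows "summable (\<lambda>k. \<bar>b k\<bar> * \<kappa> k) \<longleftrightarrow> (\<Sum>k. ennreal (\<bar>b k\<bar> * \<kappa> k)) \<noteq> top"
proof -
  have nn: "0 \<le> \<bar>b k\<bar> * \<kappa> k" for k using assms by simp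
  show ?thesis
    using summable_suminf_not_top[of "\<lambda>k. \<bar>b k\<bar> * \<kappa> k", OF nn] ennreal_suminf_neq_top[of "\<lambda>k. \<bar>b k\<bar> * \<kappa> k", OF _ nn] by blast
qed

lemma measurable_component_gauss [measurable]: "(\<lambda>b. b k) \<in> borel_measurable gauss_seq"
proof -
  have "(\<lambda>b. b k) \<in> measurable gauss_seq gauss" by (rule measurable_component_singleton) simp
  thus ?thesis by simp
qed

lemma AE_gauss_seq_summable:
  assumes s: "summable \<kappa>" and nn: "\<And>k. 0 \<le> \<kappa> k"
  shows "AE b in gauss_seq. summable (\<lambda>k. \<bar>b k\<bar> * \<kappa> k)"
proof -
  define c where "c = sqrt (2 / pi)"
  have c0: "c \<ge> 0" by (simp add: c_def)
  have hb: "has_bochner_integral lborel (\<lambda>x. std_normal_density x * \<bar>x\<bar>) c"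
    using std_normal_moment_abs_odd[of 0] by (simp add: c_def)
  have ex: "(\<integral>\<^sup>+x. ennreal \<bar>x\<bar> \<partial>gauss) = ennreal c"
  proof -
    have "(\<integral>\<^sup>+x. ennreal \<bar>x\<bar> \<partial>gauss) = (\<integral>\<^sup>+x. ennreal (std_normal_density x * \<bar>x\<bar>) \<partial>lborel)"
      by (subst nn_integral_density) (auto simp: ennreal_mult)
    also have "\<dots> = ennreal c"
      using hb by (subst nn_integral_eq_integral) (auto simp: has_bochner_integral_iff)
    finally show ?thesis .
  qed
  have comp: "(\<integral>\<^sup>+b. ennreal \<bar>b k\<bar> \<partial>gauss_seq) = ennreal c" for k :: nat
  proof -
    have "(\<integral>\<^sup>+x. ennreal \<bar>x\<bar> \<partial>gauss) = (\<integral>\<^sup>+x. ennreal \<bar>x\<bar> \<partial>distr gauss_seq gauss (\<lambda>b. b k))"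
      using distr_PiM_component[of UNIV "\<lambda>_. gauss" k] prob_space_gauss by simp
    also have "\<dots> = (\<integral>\<^sup>+b. ennreal \<bar>b k\<bar> \<partial>gauss_seq)"
      by (rule nn_integral_distr) auto
    finally show ?thesis using ex by simp
  qed
  have "(\<integral>\<^sup>+b. (\<Sum>k. ennreal (\<bar>b k\<bar> * \<kappa> k)) \<partial>gauss_seq) = (\<Sum>k. \<integral>\<^sup>+b. ennreal (\<bar>b k\<bar> * \<kappa> k) \<partial>gauss_seq)"
    by (rule nn_integral_suminf) measurable
  also have "\<dots> = (\<Sum>k. ennreal (c * \<kappa> k))"
  proof (rule suminf_cong)
    fix k
    have "(\<integral>\<^sup>+b. ennreal (\<bar>b k\<bar> * \<kappa> k) \<partial>gauss_seq) = (\<integral>\<^sup>+b. ennreal \<bar>b k\<bar> * ennreal (\<kappa> k) \<partial>gauss_seq)"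
      using nn by (simp add: ennreal_mult)
    also have "\<dots> = ennreal c * ennreal (\<kappa> k)" by (subst nn_integral_multc) (auto simp: comp)
    finally show "(\<integral>\<^sup>+b. ennreal (\<bar>b k\<bar> * \<kappa> k) \<partial>gauss_seq) = ennreal (c * \<kappa> k)"
      using nn c0 by (simp add: ennreal_mult)
  qed
  also have "\<dots> \<noteq> \<infinity>"
  proof -
    have "0 \<le> c * \<kappa> k" for k using nn c0 by simp
    from ennreal_suminf_neq_top[OF summable_mult[OF s] this] show ?thesis by (simp only: infinity_ennreal_def not_False_eq_True)
  qed
  finally have "AE b in gauss_seq. (\<Sum>k. ennreal (\<bar>b k\<bar> * \<kappa> k)) \<noteq> \<infinity>"
    by (intro nn_integral_PInf_AE) auto
  thus ?thesis unfolding summable_iff_ennreal_suminf[OF nn] by simp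
qed

text \<open>The right-hand side has only countable quantifiers, which makes the existence of a zero a
  measurable event.\<close>

lemma ex_zero_on_compact_iff:
  fixes H :: "'a::{metric_space, second_countable_topology} \<Rightarrow> real"
  assumes K: "compact K" and D: "D \<subseteq> K" "K \<subseteq> closure D" and c: "continuous_on K H" and nn: "\<And>x. x \<in> K \<Longrightarrow> 0 \<le> H x"
  shows "(\<exists>x\<in>K. H x = 0) \<longleftrightarrow> (\<forall>n::nat. \<exists>x\<in>D. H x < 1 / real (Suc n))"
proof
  assume "\<exists>x\<in>K. H x = 0"
  then obtain x where x: "x \<in> K" "H x = 0" by blast
  show "\<forall>n::nat. \<exists>x\<in>D. H x < 1 / real (Suc n)"
  proof
    fix n
    obtain d where d: "d > 0" "\<And>y. y \<in> K \<Longrightarrow> dist y x < d \<Longrightarrow> dist (H y) (H x) < 1 / real (Suc n)"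
      using c x(1) unfolding continuous_on_iff by (metis zero_less_divide_1_iff of_nat_0_less_iff zero_less_Suc)
    obtain y where "y \<in> D" "dist y x < d"
      using x(1) D(2) d(1) closure_approachable by blast
    with d(2)[of y] D(1) x(2) show "\<exists>x\<in>D. H x < 1 / real (Suc n)"
      by (intro bexI[of _ y]) (auto simp: dist_real_def abs_less_iff)
  qed
next
  assume R: "\<forall>n::nat. \<exists>x\<in>D. H x < 1 / real (Suc n)"
  hence "K \<noteq> {}" using D(1) by blast
  then obtain x where x: "x \<in> K" "\<And>y. y \<in> K \<Longrightarrow> H x \<le> H y"
    using continuous_attains_inf[OF K _ c] by blast
  have "H x < 1 / real (Suc n)" for n
    using R x(2) D(1) by (meson order_le_less_trans subsetD)
  hence "H x \<le> 0" using nat_approx_posE[of "H x"] by (metis not_le less_asym)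
  with nn[OF x(1)] x(1) show "\<exists>x\<in>K. H x = 0" by (intro bexI[of _ x]) auto
qed

text \<open>On a compact set where the fields \<open>A\<^sub>i\<close> and \<open>A\<^sub>j\<close> are independent, the bad event is
  measurable, and for fixed other coefficients it is negligible in the pair \<open>(b\<^sub>i, b\<^sub>j)\<close> by
  \<open>parametric_Sard\<close>. The set where some pair is independent is a countable union of such compact sets.\<close>

theorem AE_nondegenerate_zeros:
  fixes A B C :: "nat \<Rightarrow> real ^ 2 \<Rightarrow> real ^ 2"
  assumes k0: "summable \<kappa>"
    and A: "\<And>k x. norm (A k x) \<le> \<kappa> k" and B: "\<And>k x. norm (B k x) \<le> \<kappa> k" and C: "\<And>k x. norm (C k x) \<le> \<kappa> k"
    and d: "\<And>k x. has_partials (A k) (B k x) (C k x) x"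
    and cB: "\<And>k. continuous_on UNIV (B k)" and cC: "\<And>k. continuous_on UNIV (C k)"
  shows "AE b in gauss_seq. \<forall>x. (\<exists>i j. wedge (A i x) (A j x) \<noteq> 0) \<longrightarrow> wseries A b x = 0 \<longrightarrow> wedge (wseries B b x) (wseries C b x) \<noteq> 0"
proof -
  have nn: "0 \<le> \<kappa> k" for k using A[of k 0] norm_ge_zero order_trans by blast
  have cA: "continuous_on UNIV (A k)" for k
    using d by (meson has_derivative_continuous continuous_at_imp_continuous_on)
  let ?sum = "\<lambda>b. summable (\<lambda>k. \<bar>b k\<bar> * \<kappa> k)"
  have compact_case: "AE b in gauss_seq. \<not> (?sum b \<and> (\<exists>x\<in>K. wseries A b x = 0 \<and> wedge (wseries B b x) (wseries C b x) = 0))"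
    if K: "compact K" and w: "\<And>x. x \<in> K \<Longrightarrow> wedge (A i x) (A j x) \<noteq> 0" for i j K
  proof (cases "K = {}")
    case False
    then obtain x0 where "x0 \<in> K" by blast
    hence ij: "i \<noteq> j" using w[of x0] by auto
    define H where "H = (\<lambda>b x. norm (wseries A b x) + \<bar>wedge (wseries B b x) (wseries C b x)\<bar>)"
    have H0: "H b x = 0 \<longleftrightarrow> wseries A b x = 0 \<and> wedge (wseries B b x) (wseries C b x) = 0" for b x
      unfolding H_def by (metis abs_eq_0 abs_ge_zero add_nonneg_eq_0_iff norm_eq_zero norm_ge_zero)
    obtain D where D: "countable D" "D \<subseteq> K" "K \<subseteq> closure D" using separable[of K] by blast
    have eq: "?sum b \<and> (\<exists>x\<in>K. wseries A b x = 0 \<and> wedge (wseries B b x) (wseries C b x) = 0) \<longleftrightarrow>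
       (\<Sum>k. ennreal (\<bar>b k\<bar> * \<kappa> k)) \<noteq> top \<and> (\<forall>n. \<exists>x\<in>D. H b x < 1 / real (Suc n))" for b
    proof (cases "?sum b")
      case True
      have "continuous_on K (H b)" unfolding H_def
        by (intro continuous_intros continuous_on_subset[OF wseries_continuous[where \<kappa>=\<kappa> and X=UNIV, OF True]] A B C cA cB cC subset_UNIV)
      from ex_zero_on_compact_iff[OF K D(2,3) this] show ?thesis
        using True unfolding summable_iff_ennreal_suminf[OF nn, symmetric] H0 by (auto simp: H_def)
    next
      case False
      thus ?thesis unfolding summable_iff_ennreal_suminf[OF nn, symmetric] by simp
    qed
    have meas: "Measurable.pred gauss_seq (\<lambda>b. \<not> (?sum b \<and> (\<exists>x\<in>K. wseries A b x = 0 \<and> wedge (wseries B b x) (wseries C b x) = 0)))"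
    proof -
      have series_meas: "(\<lambda>b. wseries F b x) \<in> borel_measurable gauss_seq" for F :: "nat \<Rightarrow> real ^ 2 \<Rightarrow> real ^ 2" and x
        unfolding wseries_def by measurable
      have wm: "(\<lambda>v :: real ^ 2. v $ i) \<in> borel_measurable borel" for i
        by (intro borel_measurable_continuous_onI continuous_intros)
      have "(\<lambda>b. H b x) \<in> borel_measurable gauss_seq" for x
        unfolding H_def wedge_def
        by (intro borel_measurable_add borel_measurable_norm borel_measurable_abs borel_measurable_diff borel_measurable_times
          measurable_compose[OF series_meas wm] measurable_compose[OF series_meas borel_measurable_norm] series_meas)
      hence [measurable]: "Measurable.pred gauss_seq (\<lambda>b. H b x < 1 / real (Suc n))" for x n by measurable
      show ?thesis unfolding eq using D(1) by measurable
    qed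
    have "AE t in gauss. AE u in gauss. \<not> (?sum (b(i := t, j := u)) \<and>
        (\<exists>x\<in>K. wseries A (b(i := t, j := u)) x = 0 \<and> wedge (wseries B (b(i := t, j := u)) x) (wseries C (b(i := t, j := u)) x) = 0))" for b
    proof (cases "?sum b")
      case False thus ?thesis by (simp add: summable_update del: fun_upd_apply)
    next
      case True
      define b0 where "b0 = b(i := 0, j := 0)"
      have s0: "?sum b0" using True by (simp add: b0_def summable_update del: fun_upd_apply)
      let ?S = "{c :: real ^ 2. \<exists>x\<in>K. wseries A b0 x + c $ 1 *\<^sub>R A i x + c $ 2 *\<^sub>R A j x = 0 \<and>
         wedge (wseries B b0 x + c $ 1 *\<^sub>R B i x + c $ 2 *\<^sub>R B j x) (wseries C b0 x + c $ 1 *\<^sub>R C i x + c $ 2 *\<^sub>R C j x) = 0}"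
      have "negligible ?S"
        by (rule parametric_Sard[OF wseries_has_derivative[where A=A and B=B and C=C and \<kappa>=\<kappa>, OF s0 A B C d] d d w])
      from AE_gauss_of_negligible[OF this] show ?thesis
        unfolding wseries_update2[where A=A and \<kappa>=\<kappa>, OF True A ij] wseries_update2[where A=B and \<kappa>=\<kappa>, OF True B ij] wseries_update2[where A=C and \<kappa>=\<kappa>, OF True C ij] b0_def[symmetric]
        by (elim eventually_mono) auto
    qed
    thus ?thesis by (rule AE_resample[OF prob_space_gauss ij meas])
  qed simp
  have "AE b in gauss_seq. \<forall>x. wedge (A i x) (A j x) \<noteq> 0 \<longrightarrow> ?sum b \<longrightarrow> wseries A b x = 0 \<longrightarrow> wedge (wseries B b x) (wseries C b x) \<noteq> 0" for i j
  proof -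
    have "open {x. wedge (A i x) (A j x) \<noteq> 0}"
      by (intro open_Collect_neq continuous_intros cA)
    then obtain K :: "nat \<Rightarrow> (real ^ 2) set" where K: "\<And>n. compact (K n)" "\<And>n. K n \<subseteq> {x. wedge (A i x) (A j x) \<noteq> 0}"
      "(\<Union>(range K)) = {x. wedge (A i x) (A j x) \<noteq> 0}"
      by (rule open_Union_compact_subsets) blast
    have "AE b in gauss_seq. \<forall>n::nat. \<not> (?sum b \<and> (\<exists>x\<in>K n. wseries A b x = 0 \<and> wedge (wseries B b x) (wseries C b x) = 0))"
      unfolding AE_all_countable by (intro allI compact_case[of _ i j]) (use K in auto)
    thus ?thesis
    proof eventually_elim
      case (elim b)
      show ?case
      proof (intro allI impI)
        fix x assume "wedge (A i x) (A j x) \<noteq> 0" and h: "?sum b" "wseries A b x = 0"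
        then obtain n where "x \<in> K n" using K(3) by blast
        with elim h show "wedge (wseries B b x) (wseries C b x) \<noteq> 0" by blast
      qed
    qed
  qed
  hence "AE b in gauss_seq. \<forall>i j. \<forall>x. wedge (A i x) (A j x) \<noteq> 0 \<longrightarrow> ?sum b \<longrightarrow> wseries A b x = 0 \<longrightarrow> wedge (wseries B b x) (wseries C b x) \<noteq> 0"
    unfolding AE_all_countable by blast
  with AE_gauss_seq_summable[OF k0 nn] show ?thesis
    by eventually_elim blast
qed

section \<open>Counting zeros of perturbed vector fields\<close>

lemma wedge_abs_le: "\<bar>wedge u v\<bar> \<le> 2 * (norm u * norm v)"
proof -
  have "\<bar>u $ 1 * v $ 2\<bar> \<le> norm u * norm v" "\<bar>u $ 2 * v $ 1\<bar> \<le> norm u * norm v"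
    unfolding abs_mult by (intro mult_mono component_le_norm_cart; simp)+
  thus ?thesis unfolding wedge_def by linarith
qed

text \<open>A quantitative inverse function theorem as a property of the two columns \<open>g1\<close>, \<open>g2\<close> of an invertible
  matrix. Its constants depend on the matrix only, so that they serve all perturbations of a map at once.\<close>

definition robust_zero :: "real ^ 2 \<Rightarrow> real ^ 2 \<Rightarrow> real \<Rightarrow> real \<Rightarrow> bool" where
  "robust_zero g1 g2 \<delta> c \<longleftrightarrow> (\<forall>(K :: real ^ 2 \<Rightarrow> real ^ 2) K1 K2 z \<rho>. \<rho> > 0 \<longrightarrow>
     (\<forall>x\<in>cball z \<rho>. has_partials K (K1 x) (K2 x) x \<and>
        norm (K1 x - g1) \<le> \<delta> \<and> norm (K2 x - g2) \<le> \<delta>) \<longrightarrow> c * norm (K z) \<le> \<rho> \<longrightarrow>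
     (\<exists>!x. x \<in> cball z \<rho> \<and> K x = 0))"

lemma robust_zeroD:
  fixes K :: "real ^ 2 \<Rightarrow> real ^ 2"
  assumes "robust_zero g1 g2 \<delta> c" "\<rho> > 0"
    and "\<And>x. x \<in> cball z \<rho> \<Longrightarrow> has_partials K (K1 x) (K2 x) x"
    and "\<And>x. x \<in> cball z \<rho> \<Longrightarrow> norm (K1 x - g1) \<le> \<delta>"
    and "\<And>x. x \<in> cball z \<rho> \<Longrightarrow> norm (K2 x - g2) \<le> \<delta>"
    and "c * norm (K z) \<le> \<rho>"
  shows "\<exists>!x. x \<in> cball z \<rho> \<and> K x = 0"
proof -
  have "\<forall>x\<in>cball z \<rho>. has_partials K (K1 x) (K2 x) x \<and>
        norm (K1 x - g1) \<le> \<delta> \<and> norm (K2 x - g2) \<le> \<delta>"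
    using assms(3-5) by (intro ballI conjI)
  from assms(1)[unfolded robust_zero_def, THEN spec[of _ K], THEN spec[of _ K1], THEN spec[of _ K2], THEN spec[of _ z],
      THEN spec[of _ \<rho>], THEN mp, OF assms(2), THEN mp, OF this, THEN mp, OF assms(6)]
  show ?thesis .
qed

lemma eventually_nhds_close:
  fixes f :: "'a::t2_space \<Rightarrow> 'b::real_normed_vector"
  assumes "isCont f z" "\<delta> > 0"
  shows "\<forall>\<^sub>F x in nhds z. norm (f x - f z) \<le> \<delta>"
proof -
  have "\<forall>\<^sub>F x in nhds z. dist (f x) (f z) < \<delta>"
    using assms(1)[unfolded isCont_def, THEN tendsto_at_iff_tendsto_nhds[THEN iffD1], THEN tendstoD, OF assms(2)] .
  thus ?thesis by eventually_elim (simp add: dist_norm)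
qed

text \<open>The Newton map \<open>x \<mapsto> x - T (K x)\<close>, where \<open>T\<close> inverts the fixed matrix with the columns \<open>g1\<close>, \<open>g2\<close>, is a
  contraction with factor \<open>1/2\<close> of the ball into itself.\<close>

lemma unique_zero_near:
  assumes w: "wedge g1 g2 \<noteq> 0"
  shows "\<exists>\<delta>>0. \<exists>c>0. robust_zero g1 g2 \<delta> c"
proof -
  define T :: "real ^ 2 \<Rightarrow> real ^ 2" where
    "T = (\<lambda>y. (wedge y g2 / wedge g1 g2) *\<^sub>R axis 1 1 + (wedge g1 y / wedge g1 g2) *\<^sub>R axis 2 1)"
  have T: "T y $ 1 *\<^sub>R g1 + T y $ 2 *\<^sub>R g2 = y" for y
    using cramer_wedge[OF w, of y] by (simp add: T_def axis_def)
  have linT: "linear T"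
    unfolding T_def by (rule linearI) (auto simp: vec2_eq_iff wedge_def axis_def field_simps add_divide_distrib diff_divide_distrib)
  have Tinv: "T (h $ 1 *\<^sub>R g1 + h $ 2 *\<^sub>R g2) = h" for h
  proof -
    have "wedge (h $ 1 *\<^sub>R g1 + h $ 2 *\<^sub>R g2) g2 = h $ 1 * wedge g1 g2" "wedge g1 (h $ 1 *\<^sub>R g1 + h $ 2 *\<^sub>R g2) = h $ 2 * wedge g1 g2"
      by (simp_all add: wedge_def algebra_simps)
    thus ?thesis using w by (simp add: T_def vec2_eq_iff axis_def)
  qed
  define c where "c = 2 * (norm g1 + norm g2) / \<bar>wedge g1 g2\<bar>"
  have "g1 \<noteq> 0" using w by (auto simp: wedge_def)
  hence c: "c > 0" unfolding c_def using w by (simp add: add_pos_nonneg)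
  have Tb: "norm (T y) \<le> c * norm y" for y
  proof -
    have "norm (T y) \<le> \<bar>wedge y g2 / wedge g1 g2\<bar> + \<bar>wedge g1 y / wedge g1 g2\<bar>"
      unfolding T_def by (rule order_trans[OF norm_triangle_ineq]) simp
    also have "\<dots> = (\<bar>wedge y g2\<bar> + \<bar>wedge g1 y\<bar>) / \<bar>wedge g1 g2\<bar>" by (simp add: add_divide_distrib)
    also have "\<dots> \<le> (2 * (norm y * norm g2) + 2 * (norm g1 * norm y)) / \<bar>wedge g1 g2\<bar>"
      by (intro divide_right_mono add_mono wedge_abs_le) auto
    also have "\<dots> = c * norm y" unfolding c_def by (simp add: algebra_simps)
    finally show ?thesis .
  qed
  define \<delta> where "\<delta> = 1 / (4 * c)"
  have \<delta>: "\<delta> > 0" using c by (simp add: \<delta>_def)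
  have "\<exists>!x. x \<in> cball z \<rho> \<and> K x = 0"
    if \<rho>: "\<rho> > 0" and K: "\<And>x. x \<in> cball z \<rho> \<Longrightarrow> has_partials K (K1 x) (K2 x) x"
      and K1: "\<And>x. x \<in> cball z \<rho> \<Longrightarrow> norm (K1 x - g1) \<le> \<delta>"
      and K2: "\<And>x. x \<in> cball z \<rho> \<Longrightarrow> norm (K2 x - g2) \<le> \<delta>"
      and Kz: "2 * c * norm (K z) \<le> \<rho>" for K K1 K2 :: "real ^ 2 \<Rightarrow> real ^ 2" and z \<rho>
  proof -
    define F where "F = (\<lambda>x. x - T (K x))"
    have fix_iff: "F x = x \<longleftrightarrow> K x = 0" for x
    proof
      assume "F x = x"
      hence "T (K x) = 0" by (simp add: F_def)
      with T[of "K x"] show "K x = 0" by simp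
    next
      assume "K x = 0" thus "F x = x" using linear_0[OF linT] by (simp add: F_def)
    qed
    have lip: "norm (F x - F y) \<le> 1 / 2 * norm (x - y)" if "x \<in> cball z \<rho>" "y \<in> cball z \<rho>" for x y
    proof (rule differentiable_bound[OF convex_cball _ _ that(1) that(2)])
      fix x assume x: "x \<in> cball z \<rho>"
      show "(F has_derivative (\<lambda>h. h - T (h $ 1 *\<^sub>R K1 x + h $ 2 *\<^sub>R K2 x))) (at x within cball z \<rho>)"
        unfolding F_def
        by (intro has_derivative_diff has_derivative_ident has_derivative_at_withinI[OF K[OF x]]
           bounded_linear.has_derivative[OF linear_conv_bounded_linear[THEN iffD1, OF linT]])
      have "norm (h - T (h $ 1 *\<^sub>R K1 x + h $ 2 *\<^sub>R K2 x)) \<le> 1/2 * norm h" for h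
      proof -
        have "h - T (h $ 1 *\<^sub>R K1 x + h $ 2 *\<^sub>R K2 x) = T (h $ 1 *\<^sub>R (g1 - K1 x) + h $ 2 *\<^sub>R (g2 - K2 x))"
        proof -
          have "T (h $ 1 *\<^sub>R (g1 - K1 x) + h $ 2 *\<^sub>R (g2 - K2 x)) =
             T ((h $ 1 *\<^sub>R g1 + h $ 2 *\<^sub>R g2) - (h $ 1 *\<^sub>R K1 x + h $ 2 *\<^sub>R K2 x))" by (simp add: algebra_simps)
          thus ?thesis using linear_diff[OF linT] Tinv[of h] by simp
        qed
        also have "norm \<dots> \<le> c * norm (h $ 1 *\<^sub>R (g1 - K1 x) + h $ 2 *\<^sub>R (g2 - K2 x))" by (rule Tb)
        also have "\<dots> \<le> c * (norm h * \<delta> + norm h * \<delta>)"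
        proof (rule mult_left_mono)
          have "norm (h $ 1 *\<^sub>R (g1 - K1 x)) \<le> norm h * \<delta>" "norm (h $ 2 *\<^sub>R (g2 - K2 x)) \<le> norm h * \<delta>"
            unfolding norm_scaleR using K1[OF x] K2[OF x] component_le_norm_cart[of h]
            by (intro mult_mono; simp add: norm_minus_commute)+
          thus "norm (h $ 1 *\<^sub>R (g1 - K1 x) + h $ 2 *\<^sub>R (g2 - K2 x)) \<le> norm h * \<delta> + norm h * \<delta>"
            by (rule order_trans[OF norm_triangle_ineq add_mono])
        qed (use c in simp)
        also have "\<dots> = 1/2 * norm h" using c by (simp add: \<delta>_def field_simps)
        finally show ?thesis .
      qed
      thus "onorm (\<lambda>h. h - T (h $ 1 *\<^sub>R K1 x + h $ 2 *\<^sub>R K2 x)) \<le> 1/2" by (rule onorm_le)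
    qed
    have self: "F ` cball z \<rho> \<subseteq> cball z \<rho>"
    proof
      fix y assume "y \<in> F ` cball z \<rho>"
      then obtain x where x: "x \<in> cball z \<rho>" "y = F x" by blast
      have "norm (F x - F z) \<le> 1/2 * norm (x - z)" using lip x(1) \<rho> by simp
      moreover have "norm (F z - z) \<le> \<rho> / 2"
        using Tb[of "K z"] Kz by (simp add: F_def)
      moreover have "norm (x - z) \<le> \<rho>" using x(1) by (simp add: dist_norm norm_minus_commute)
      ultimately have "norm (F x - z) \<le> \<rho>"
        using norm_triangle_ineq[of "F x - F z" "F z - z"] by simp
      thus "y \<in> cball z \<rho>" using x(2) by (simp add: dist_norm norm_minus_commute)
    qed
    have "\<exists>!x\<in>cball z \<rho>. F x = x"
      by (rule Banach_fix[of "cball z \<rho>" "1/2"]) (use \<rho> self lip in \<open>auto simp: dist_norm complete_eq_closed\<close>)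
    thus ?thesis unfolding fix_iff by blast
  qed
  note main = this
  show ?thesis
  proof (rule exI[of _ \<delta>], rule conjI[OF \<delta>], rule exI[of _ "2 * c"], intro conjI)
    show "2 * c > 0" using c by simp
    show "robust_zero g1 g2 \<delta> (2 * c)" unfolding robust_zero_def
    proof (intro allI impI)
    fix K K1 K2 :: "real ^ 2 \<Rightarrow> real ^ 2" and z \<rho>
    assume a: "\<rho> > 0" "\<forall>x\<in>cball z \<rho>. has_partials K (K1 x) (K2 x) x \<and>
        norm (K1 x - g1) \<le> \<delta> \<and> norm (K2 x - g2) \<le> \<delta>" "2 * c * norm (K z) \<le> \<rho>"
    show "\<exists>!x. x \<in> cball z \<rho> \<and> K x = 0" by (rule main[of \<rho> z K K1 K2]) (use a in auto)
    qed
  qed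
qed

lemma eventually_cball_at_right:
  fixes z :: "'a::metric_space"
  assumes "\<forall>\<^sub>F x in nhds z. P x"
  shows "\<forall>\<^sub>F \<rho> in at_right 0. \<forall>x\<in>cball z \<rho>. P x"
proof -
  obtain d where d: "d > 0" "\<And>x. dist x z < d \<Longrightarrow> P x" using assms unfolding eventually_nhds_metric by blast
  have "\<forall>\<^sub>F \<rho> in at_right 0. \<rho> < d" using d(1) by (intro order_tendstoD(2)[OF tendsto_ident_at])
  thus ?thesis by eventually_elim (use d(2) in \<open>auto simp: dist_commute\<close>)
qed

lemma at_right_ex_pos:
  assumes "\<forall>\<^sub>F \<rho> in at_right (0::real). P \<rho>"
  shows "\<exists>\<rho>>0. P \<rho>"
  using eventually_happens'[OF trivial_limit_at_right_real eventually_conj[OF eventually_at_right_less assms]] by auto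

lemma nondegenerate_zero_isolated:
  fixes H :: "real ^ 2 \<Rightarrow> real ^ 2"
  assumes H: "\<And>x. has_partials H (H1 x) (H2 x) x"
    and c: "continuous_on UNIV H1" "continuous_on UNIV H2"
    and z: "H z = 0" "wedge (H1 z) (H2 z) \<noteq> 0"
  shows "\<forall>\<^sub>F \<rho> in at_right 0. \<forall>x\<in>cball z \<rho>. H x = 0 \<longrightarrow> x = z"
proof -
  obtain \<delta> C where \<delta>: "\<delta> > 0" "C > 0" and u: "robust_zero (H1 z) (H2 z) \<delta> C"
    using unique_zero_near[OF z(2)] by blast
  have "isCont H1 z" "isCont H2 z" using c by (auto simp: continuous_on_eq_continuous_at)
  from eventually_conj[OF this[THEN eventually_nhds_close, OF \<delta>(1)]]
  have "\<forall>\<^sub>F x in nhds z. norm (H1 x - H1 z) \<le> \<delta> \<and> norm (H2 x - H2 z) \<le> \<delta>" .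
  from eventually_cball_at_right[OF this] eventually_at_right_less[of "0::real"] show ?thesis
  proof eventually_elim
    case (elim \<rho>)
    have "\<exists>!x. x \<in> cball z \<rho> \<and> H x = 0"
      by (rule robust_zeroD[OF u elim(2) H]) (use elim z in auto)
    then obtain w where w: "\<And>y. y \<in> cball z \<rho> \<and> H y = 0 \<Longrightarrow> y = w" by (elim ex1E) blast
    have "z \<in> cball z \<rho>" using elim(2) by simp
    hence "z = w" using w[of z] z(1) by simp
    thus ?case using w by simp
  qed
qed

lemma finite_nondegenerate_zeros:
  fixes H :: "real ^ 2 \<Rightarrow> real ^ 2"
  assumes H: "\<And>x. has_partials H (H1 x) (H2 x) x"
    and c: "continuous_on UNIV H1" "continuous_on UNIV H2"
    and Q: "compact Q"
    and nd: "\<And>z. z \<in> Q \<Longrightarrow> H z = 0 \<Longrightarrow> wedge (H1 z) (H2 z) \<noteq> 0"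
  shows "finite {z \<in> Q. H z = 0}"
proof (rule ccontr)
  assume "infinite {z \<in> Q. H z = 0}"
  then obtain z where z: "z \<in> Q" "z islimpt {z \<in> Q. H z = 0}"
    using Q unfolding compact_eq_Bolzano_Weierstrass by (metis (no_types, lifting) mem_Collect_eq subsetI)
  have cH: "continuous_on UNIV H" using H by (meson has_derivative_continuous continuous_at_imp_continuous_on)
  have "closed {z. H z = 0}" by (intro closed_Collect_eq cH continuous_on_const)
  moreover have "z islimpt {z. H z = 0}" by (rule islimpt_subset[OF z(2)]) auto
  ultimately have "H z = 0" unfolding closed_limpt by blast
  from nondegenerate_zero_isolated[OF H c this nd[OF z(1) this]]
  obtain \<rho> where \<rho>: "\<rho> > 0" "\<And>x. x \<in> cball z \<rho> \<Longrightarrow> H x = 0 \<Longrightarrow> x = z"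
    using at_right_ex_pos by blast
  from z(2) \<rho>(1) obtain x where "x \<in> {z \<in> Q. H z = 0}" "x \<noteq> z" "dist x z < \<rho>"
    unfolding islimpt_approachable by blast
  with \<rho>(2)[of x] show False by (simp add: dist_commute)
qed

text \<open>Small disjoint balls around the zeros of \<open>H\<close> contain exactly one zero of \<open>K\<close> each, by
  \<open>robust_zeroD\<close>, and on the compact rest of \<open>Q\<close> the norm of \<open>H\<close> is bounded below.\<close>

theorem zero_count_stable:
  fixes H :: "real ^ 2 \<Rightarrow> real ^ 2"
  assumes H: "\<And>x. has_partials H (H1 x) (H2 x) x"
    and c: "continuous_on UNIV H1" "continuous_on UNIV H2"
    and Q: "compact Q"
    and nd: "\<And>z. z \<in> Q \<Longrightarrow> H z = 0 \<Longrightarrow> wedge (H1 z) (H2 z) \<noteq> 0"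
    and int: "\<And>z. z \<in> Q \<Longrightarrow> H z = 0 \<Longrightarrow> z \<in> interior Q"
  shows "\<exists>\<epsilon>>0. \<forall>K K1 K2.
     (\<forall>x\<in>Q. has_partials K (K1 x) (K2 x) x \<and>
        norm (K x - H x) \<le> \<epsilon> \<and> norm (K1 x - H1 x) \<le> \<epsilon> \<and> norm (K2 x - H2 x) \<le> \<epsilon>) \<longrightarrow>
     card {x \<in> Q. K x = 0} = card {x \<in> Q. H x = 0} \<and> {x \<in> Q. K x = 0} \<subseteq> interior Q"
proof -
  define Z where "Z = {z \<in> Q. H z = 0}"
  have finZ: "finite Z" unfolding Z_def by (rule finite_nondegenerate_zeros[OF H c Q nd])
  have cH: "continuous_on UNIV H" using H by (meson has_derivative_continuous continuous_at_imp_continuous_on)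
  have "\<forall>z\<in>Z. \<exists>\<delta>>0. \<exists>c>0. robust_zero (H1 z) (H2 z) \<delta> c"
    unfolding Z_def by (intro ballI unique_zero_near nd) auto
  then obtain \<delta> C where \<delta>: "\<And>z. z \<in> Z \<Longrightarrow> \<delta> z > 0" and C: "\<And>z. z \<in> Z \<Longrightarrow> C z > 0"
    and u: "\<And>z. z \<in> Z \<Longrightarrow> robust_zero (H1 z) (H2 z) (\<delta> z) (C z)"
    by metis
  have ev1: "\<forall>\<^sub>F \<rho> in at_right 0. \<forall>x\<in>cball z \<rho>. x \<in> interior Q \<and> norm (H1 x - H1 z) \<le> \<delta> z / 2 \<and> norm (H2 x - H2 z) \<le> \<delta> z / 2"
    if "z \<in> Z" for z
  proof (rule eventually_cball_at_right)
    have "isCont H1 z" "isCont H2 z" using c by (auto simp: continuous_on_eq_continuous_at)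
    moreover have "\<delta> z / 2 > 0" using \<delta>[OF that] by simp
    ultimately have "\<forall>\<^sub>F x in nhds z. norm (H1 x - H1 z) \<le> \<delta> z / 2" "\<forall>\<^sub>F x in nhds z. norm (H2 x - H2 z) \<le> \<delta> z / 2"
      by (blast intro: eventually_nhds_close)+
    moreover have "\<forall>\<^sub>F x in nhds z. x \<in> interior Q"
      using that int unfolding Z_def by (intro eventually_nhds_in_open) auto
    ultimately show "\<forall>\<^sub>F x in nhds z. x \<in> interior Q \<and> norm (H1 x - H1 z) \<le> \<delta> z / 2 \<and> norm (H2 x - H2 z) \<le> \<delta> z / 2"
      by eventually_elim auto
  qed
  have "\<forall>\<^sub>F \<rho> in at_right 0. \<forall>z\<in>Z. (\<forall>x\<in>cball z \<rho>. x \<in> interior Q \<and> norm (H1 x - H1 z) \<le> \<delta> z / 2 \<and> norm (H2 x - H2 z) \<le> \<delta> z / 2)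
      \<and> (\<forall>x\<in>cball z \<rho>. H x = 0 \<longrightarrow> x = z)"
    by (intro eventually_ball_finite[OF finZ] ballI eventually_conj ev1 nondegenerate_zero_isolated[OF H c])
      (auto simp: Z_def nd)
  from at_right_ex_pos[OF this]
  obtain \<rho>0 where \<rho>0: "\<rho>0 > 0" and near: "\<And>z x. z \<in> Z \<Longrightarrow> x \<in> cball z \<rho>0 \<Longrightarrow> x \<in> interior Q \<and> norm (H1 x - H1 z) \<le> \<delta> z / 2 \<and> norm (H2 x - H2 z) \<le> \<delta> z / 2"
    and iso: "\<And>z x. z \<in> Z \<Longrightarrow> x \<in> cball z \<rho>0 \<Longrightarrow> H x = 0 \<Longrightarrow> x = z"
    by blast
  \<comment> \<open>Each ball of radius \<open>\<rho>0\<close> contains only one zero of \<open>H\<close>, so that the balls of half this radius are disjoint.\<close>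
  define \<rho> where "\<rho> = \<rho>0 / 2"
  have \<rho>: "\<rho> > 0" "\<rho> \<le> \<rho>0" using \<rho>0 by (auto simp: \<rho>_def)
  have disj: "z = z'" if "z \<in> Z" "z' \<in> Z" "x \<in> cball z \<rho>" "x \<in> cball z' \<rho>" for z z' x
  proof -
    have "dist z z' \<le> \<rho>0" using that(3,4) dist_triangle[of z z' x] by (simp add: \<rho>_def dist_commute)
    thus ?thesis using iso[OF that(1), of z'] that(2) by (simp add: Z_def)
  qed
  define Q' where "Q' = Q - (\<Union>z\<in>Z. ball z \<rho>)"
  have cQ': "compact Q'" unfolding Q'_def by (intro compact_diff Q open_UN ballI open_ball)
  have "\<exists>\<eta>>0. \<forall>x\<in>Q'. \<eta> \<le> norm (H x)"
  proof (cases "Q' = {}")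
    case True thus ?thesis by (intro exI[of _ 1]) auto
  next
    case False
    have "continuous_on Q' (\<lambda>x. norm (H x))" by (intro continuous_intros continuous_on_subset[OF cH]) auto
    from continuous_attains_inf[OF cQ' False this] obtain x where x: "x \<in> Q'" "\<And>y. y \<in> Q' \<Longrightarrow> norm (H x) \<le> norm (H y)" by blast
    moreover have "H x \<noteq> 0"
    proof
      assume "H x = 0"
      hence "x \<in> Z" using x(1) by (auto simp: Q'_def Z_def)
      thus False using x(1) \<rho>(1) by (auto simp: Q'_def)
    qed
    ultimately show ?thesis by (intro exI[of _ "norm (H x)"]) auto
  qed
  then obtain \<eta> where \<eta>: "\<eta> > 0" "\<And>x. x \<in> Q' \<Longrightarrow> \<eta> \<le> norm (H x)" by blast
  have "\<forall>\<^sub>F \<epsilon> in at_right 0. \<epsilon> < \<delta> z / 2 \<and> \<epsilon> < \<rho> / C z" if "z \<in> Z" for z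
    by (intro eventually_conj order_tendstoD(2)[OF tendsto_ident_at]) (use \<delta>[OF that] C[OF that] \<rho> in auto)
  hence "\<forall>\<^sub>F \<epsilon> in at_right 0. \<forall>z\<in>Z. \<epsilon> < \<delta> z / 2 \<and> \<epsilon> < \<rho> / C z"
    by (intro eventually_ball_finite[OF finZ]) auto
  moreover have "\<forall>\<^sub>F \<epsilon> in at_right 0. \<epsilon> < \<eta>" using \<eta>(1) by (intro order_tendstoD(2)[OF tendsto_ident_at])
  ultimately have "\<forall>\<^sub>F \<epsilon> in at_right 0. \<epsilon> < \<eta> \<and> (\<forall>z\<in>Z. \<epsilon> < \<delta> z / 2 \<and> \<epsilon> < \<rho> / C z)"
    by eventually_elim auto
  from at_right_ex_pos[OF this] obtain \<epsilon> where \<epsilon>: "\<epsilon> > 0" "\<epsilon> < \<eta>" and \<epsilon>z: "\<And>z. z \<in> Z \<Longrightarrow> \<epsilon> < \<delta> z / 2" "\<And>z. z \<in> Z \<Longrightarrow> \<epsilon> < \<rho> / C z"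
    by blast
  have "card {x \<in> Q. K x = 0} = card Z \<and> {x \<in> Q. K x = 0} \<subseteq> interior Q"
    if K: "\<And>x. x \<in> Q \<Longrightarrow> has_partials K (K1 x) (K2 x) x"
      and K0: "\<And>x. x \<in> Q \<Longrightarrow> norm (K x - H x) \<le> \<epsilon>" and K1: "\<And>x. x \<in> Q \<Longrightarrow> norm (K1 x - H1 x) \<le> \<epsilon>"
      and K2: "\<And>x. x \<in> Q \<Longrightarrow> norm (K2 x - H2 x) \<le> \<epsilon>" for K K1 K2 :: "real ^ 2 \<Rightarrow> real ^ 2"
  proof -
    have inQ: "x \<in> interior Q" "x \<in> Q" if "z \<in> Z" "x \<in> cball z \<rho>" for z x
    proof -
      show "x \<in> interior Q" using near[OF that(1), of x] that(2) \<rho>(2) by auto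
      thus "x \<in> Q" using interior_subset by blast
    qed
    have ex1: "\<exists>!x. x \<in> cball z \<rho> \<and> K x = 0" if z: "z \<in> Z" for z
    proof (rule robust_zeroD[OF u[OF z] \<rho>(1)])
      fix x assume x: "x \<in> cball z \<rho>"
      note xQ = inQ(2)[OF z x]
      show "has_partials K (K1 x) (K2 x) x" by (rule K[OF xQ])
      have n: "norm (H1 x - H1 z) \<le> \<delta> z / 2" "norm (H2 x - H2 z) \<le> \<delta> z / 2" using near[OF z, of x] x \<rho>(2) by auto
      show "norm (K1 x - H1 z) \<le> \<delta> z"
        using norm_triangle_ineq[of "K1 x - H1 x" "H1 x - H1 z"] K1[OF xQ] n(1) \<epsilon>z(1)[OF z] by simp
      show "norm (K2 x - H2 z) \<le> \<delta> z"
        using norm_triangle_ineq[of "K2 x - H2 x" "H2 x - H2 z"] K2[OF xQ] n(2) \<epsilon>z(1)[OF z] by simp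
    next
      have zQ: "z \<in> Q" "H z = 0" using z by (auto simp: Z_def)
      have "C z * norm (K z) \<le> C z * \<epsilon>" using K0[OF zQ(1)] zQ(2) C[OF z] by (intro mult_left_mono) auto
      also have "\<dots> \<le> \<rho>" using \<epsilon>z(2)[OF z] C[OF z] by (simp add: field_simps)
      finally show "C z * norm (K z) \<le> \<rho>" .
    qed
    define g where "g = (\<lambda>z. THE x. x \<in> cball z \<rho> \<and> K x = 0)"
    have g: "g z \<in> cball z \<rho>" "K (g z) = 0" if "z \<in> Z" for z
      using theI'[OF ex1[OF that]] unfolding g_def by auto
    have cover: "\<exists>z\<in>Z. x = g z" if x: "x \<in> Q" "K x = 0" for x
    proof -
      have "x \<notin> Q'"
      proof
        assume "x \<in> Q'"
        hence "\<eta> \<le> norm (K x - H x)" using \<eta>(2) x(2) by simp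
        with K0[OF x(1)] \<epsilon> show False by simp
      qed
      then obtain z where z: "z \<in> Z" "x \<in> ball z \<rho>" using x(1) by (auto simp: Q'_def)
      hence "x = g z" using ex1[OF z(1)] g[OF z(1)] x(2) by (metis ball_subset_cball subsetD)
      thus ?thesis using z(1) by blast
    qed
    have "bij_betw g Z {x \<in> Q. K x = 0}"
      unfolding bij_betw_def
    proof
      show "inj_on g Z" using g(1) disj by (metis inj_onI)
      show "g ` Z = {x \<in> Q. K x = 0}" using g cover inQ(2) by blast
    qed
    moreover have "{x \<in> Q. K x = 0} \<subseteq> interior Q" using cover g(1) inQ(1) by blast
    ultimately show ?thesis by (simp add: bij_betw_same_card)
  qed
  thus ?thesis unfolding Z_def using \<epsilon>(1) by (intro exI[of _ \<epsilon>]) blast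
qed

text \<open>The counting function is a staircase with equal steps, up to a bounded error.\<close>

lemma counting_limit:
  fixes f :: "'a \<Rightarrow> real" and P r0 :: real
  assumes P: "P > 0" and fin: "\<And>R. finite {s \<in> S. f s < R}"
    and per: "\<And>m::nat. m \<ge> m0 \<Longrightarrow> card {s \<in> S. r0 + P * real m \<le> f s \<and> f s < r0 + P * real (Suc m)} = Z"
  shows "((\<lambda>R. real (card {s \<in> S. f s < R}) / R) \<longlongrightarrow> real Z / P) at_top"
proof -
  define N where "N = (\<lambda>R. real (card {s \<in> S. f s < R}))"
  have mono: "N x \<le> N y" if "x \<le> y" for x y
    unfolding N_def using that by (intro of_nat_mono card_mono fin) auto
  have step: "N (r0 + P * real (m0 + k)) = N (r0 + P * real m0) + real k * real Z" for k
  proof (induction k)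
    case 0 thus ?case by simp
  next
    case (Suc k)
    let ?a = "r0 + P * real (m0 + k)" and ?b = "r0 + P * real (Suc (m0 + k))"
    have ab: "?a \<le> ?b" using P by simp
    have "{s \<in> S. f s < ?b} = {s \<in> S. f s < ?a} \<union> {s \<in> S. ?a \<le> f s \<and> f s < ?b}" using ab by auto
    moreover have "card ({s \<in> S. f s < ?a} \<union> {s \<in> S. ?a \<le> f s \<and> f s < ?b}) = card {s \<in> S. f s < ?a} + card {s \<in> S. ?a \<le> f s \<and> f s < ?b}"
      by (intro card_Un_disjoint fin finite_subset[OF _ fin[of ?b]]) auto
    ultimately have "N ?b = N ?a + real Z" unfolding N_def using per[of "m0 + k"] by simp
    thus ?case using Suc.IH by (simp add: algebra_simps)
  qed
  define C where "C = N (r0 + P * real m0) - real Z / P * (r0 + P * real m0)"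
  have bounds: "real Z / P * R + C - real Z \<le> N R \<and> N R \<le> real Z / P * R + C + real Z"
    if R: "R \<ge> r0 + P * real m0" for R
  proof -
    define k where "k = nat \<lfloor>(R - (r0 + P * real m0)) / P\<rfloor>"
    have "0 \<le> (R - (r0 + P * real m0)) / P" using R P by simp
    hence k: "real k \<le> (R - (r0 + P * real m0)) / P" "(R - (r0 + P * real m0)) / P < real k + 1"
      unfolding k_def by linarith+
    hence k1: "r0 + P * real (m0 + k) \<le> R" "R \<le> r0 + P * real (m0 + Suc k)"
      using P by (auto simp: field_simps)
    have n1: "N (r0 + P * real m0) + real k * real Z \<le> N R" using mono[OF k1(1)] step[of k] by simp
    have n2: "N R \<le> N (r0 + P * real m0) + real k * real Z + real Z" using mono[OF k1(2)] step[of "Suc k"] by (simp add: algebra_simps)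
    have e: "real Z / P * R + C - N (r0 + P * real m0) = real Z * ((R - (r0 + P * real m0)) / P)"
      unfolding C_def using P by (simp add: field_simps)
    have "real Z * real k \<le> real Z * ((R - (r0 + P * real m0)) / P)" using k by (intro mult_left_mono) auto
    moreover have "real Z * ((R - (r0 + P * real m0)) / P) \<le> real Z * (real k + 1)" using k by (intro mult_left_mono) auto
    ultimately show ?thesis using n1 n2 e by (simp add: algebra_simps)
  qed
  have "((\<lambda>R. N R / R) \<longlongrightarrow> real Z / P) at_top"
  proof (rule tendsto_sandwich)
    show "((\<lambda>R. (real Z / P * R + C - real Z) / R) \<longlongrightarrow> real Z / P) at_top" using P by real_asymp
    show "((\<lambda>R. (real Z / P * R + C + real Z) / R) \<longlongrightarrow> real Z / P) at_top" using P by real_asymp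
    have "\<forall>\<^sub>F R in at_top. R \<ge> r0 + P * real m0 \<and> R > 0"
      by (intro eventually_conj eventually_ge_at_top eventually_gt_at_top)
    thus "\<forall>\<^sub>F R in at_top. (real Z / P * R + C - real Z) / R \<le> N R / R"
      "\<forall>\<^sub>F R in at_top. N R / R \<le> (real Z / P * R + C + real Z) / R"
      by (eventually_elim; use bounds in \<open>auto intro!: divide_right_mono\<close>)+
  qed
  thus ?thesis unfolding N_def .
qed

section \<open>Fourier modes with cylinder functions as radial profile\<close>

text \<open>For a family with \<open>F\<^sub>l' = (F\<^bsub>l-1\<^esub> - F\<^bsub>l+1\<^esub>) / 2\<close> this is the \<open>j\<close>-th derivative of \<open>F\<^sub>l\<close>. As a
  difference operator it applies also to the error of an approximation, whose derivatives need no
  separate estimate.\<close>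

primrec cdiff :: "nat \<Rightarrow> (int \<Rightarrow> real \<Rightarrow> real) \<Rightarrow> int \<Rightarrow> real \<Rightarrow> real" where
  "cdiff 0 F l r = F l r"
| "cdiff (Suc j) F l r = (cdiff j F (l - 1) r - cdiff j F (l + 1) r) / 2"

text \<open>The two properties of Bessel functions that are needed for term-by-term differentiation. The limiting
  profiles \<open>Re (g \<i>\<^sup>l exp (- \<i> r))\<close> have them too, and so \<open>u\<close> and its limit \<open>L\<close> are treated together.\<close>

definition cylinder :: "(int \<Rightarrow> real \<Rightarrow> real) \<Rightarrow> real \<Rightarrow> bool" where
  "cylinder F M \<longleftrightarrow> (\<forall>l r. (F l has_field_derivative cdiff 1 F l r) (at r)) \<and> (\<forall>l r. \<bar>F l r\<bar> \<le> M)"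

lemma cdiff_bound:
  assumes "cylinder F M" shows "\<bar>cdiff j F l r\<bar> \<le> M"
proof (induction j arbitrary: l)
  case 0 thus ?case using assms by (simp add: cylinder_def)
next
  case (Suc j)
  have "\<bar>cdiff j F (l - 1) r - cdiff j F (l + 1) r\<bar> \<le> M + M"
    using Suc[of "l-1"] Suc[of "l+1"] by (intro order_trans[OF abs_triangle_ineq4] add_mono)
  thus ?case by simp
qed

lemma cdiff_deriv:
  assumes "cylinder F M" shows "(cdiff j F l has_field_derivative cdiff (Suc j) F l r) (at r)"
proof (induction j arbitrary: l)
  case 0 
  have "cdiff 0 F l = F l" by (rule ext) simp
  thus ?case using assms by (simp add: cylinder_def)
next
  case (Suc j)
  have e: "cdiff (Suc j) F l = (\<lambda>r. (cdiff j F (l - 1) r - cdiff j F (l + 1) r) / 2)" by (rule ext) simp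
  have "(cdiff (Suc j) F l has_field_derivative (cdiff (Suc j) F (l - 1) r - cdiff (Suc j) F (l + 1) r) / 2) (at r)"
    unfolding e by (intro DERIV_cdivide DERIV_diff Suc)
  thus ?case unfolding cdiff.simps(2)[of "Suc j" F l r] .
qed

lemma cylinder_bessel_J: "cylinder bessel_J 1"
  unfolding cylinder_def using bessel_J_deriv bessel_J_le_1 by simp

definition wave_limit :: "complex \<Rightarrow> int \<Rightarrow> real \<Rightarrow> real" where
  "wave_limit g l r = Re (g * \<i> powi l * cis (- r))"

lemma i_powi_shift: "\<i> powi (l - 1) = - \<i> * \<i> powi l" "\<i> powi (l + 1) = \<i> * \<i> powi l"
  by (simp_all add: power_int_diff power_int_add field_simps)

lemma cdiff_wave_limit: "cdiff j (wave_limit g) l r = Re ((- \<i>) ^ j * (g * \<i> powi l * cis (- r)))"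
proof (induction j arbitrary: l)
  case 0 thus ?case by (simp add: wave_limit_def)
next
  case (Suc j)
  show ?case unfolding cdiff.simps Suc i_powi_shift by (simp add: field_simps)
qed

lemma cylinder_wave_limit: "cylinder (wave_limit g) (norm g)"
  unfolding cylinder_def
proof (intro conjI allI)
  fix l r
  have 1: "((\<lambda>r. cis (- r)) has_vector_derivative - \<i> * cis (- r)) (at r)"
    unfolding has_vector_derivative_complex_iff by (auto intro!: derivative_eq_intros)
  have "((\<lambda>r. g * \<i> powi l * cis (- r)) has_vector_derivative g * \<i> powi l * (- \<i> * cis (- r))) (at r)"
    by (rule has_vector_derivative_mult_right[OF 1])
  hence "((\<lambda>r. Re (g * \<i> powi l * cis (- r))) has_field_derivative Re (g * \<i> powi l * (- \<i> * cis (- r)))) (at r)"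
    unfolding has_vector_derivative_complex_iff by blast
  moreover have "Re (g * \<i> powi l * (- \<i> * cis (- r))) = cdiff 1 (wave_limit g) l r"
    unfolding cdiff_wave_limit by (simp only: power_one_right mult_ac)
  ultimately show "(wave_limit g l has_field_derivative cdiff 1 (wave_limit g) l r) (at r)"
    unfolding wave_limit_def[abs_def] by (simp only:)
next
  fix l r
  have "norm (\<i> powi l) = 1" by (simp add: norm_power_int)
  hence "norm (g * \<i> powi l * cis (- r)) = norm g" by (simp add: norm_mult)
  thus "\<bar>wave_limit g l r\<bar> \<le> norm g" unfolding wave_limit_def by (metis abs_Re_le_cmod)
qed

lemma cdiff_wave_limit_periodic: "cdiff j (wave_limit g) l (r + 2 * pi * real m) = cdiff j (wave_limit g) l r"
proof -
  have "cis (- (r + 2 * pi * real m)) = cis (- r)"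
  proof -
    have "cis (- (2 * pi * real m)) = 1" using cis_multiple_2pi[of "- real m"] by simp
    thus ?thesis using cis_mult[of "- r" "- (2 * pi * real m)"] by simp
  qed
  thus ?thesis unfolding cdiff_wave_limit by simp
qed

definition mode :: "nat \<Rightarrow> nat" where "mode k = Suc (k div 2)"

text \<open>The \<open>j\<close>-th derivative of the \<open>k\<close>-th angular mode: each derivative multiplies by the frequency and advances
  the phase by a quarter turn. Even and odd \<open>k\<close> belong to the real and the imaginary part of a coefficient;
  multiplication by \<open>\<i>\<close> is a quarter turn as well.\<close>

definition angular :: "real \<Rightarrow> nat \<Rightarrow> nat \<Rightarrow> real \<Rightarrow> real" where
  "angular s j k t = 2 * real (mode k) powr (real j - s) * cos (real (mode k) * t + (real (k mod 2) + real j) * (pi / 2))"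

lemma mode_pos: "real (mode k) \<ge> 1" by (simp add: mode_def)

lemma angular_deriv: "(angular s j k has_field_derivative angular s (Suc j) k t) (at t)"
proof -
  define n where "n = real (mode k)"
  have n: "n > 0" using mode_pos[of k] by (simp add: n_def)
  have p: "n powr (real (Suc j) - s) = n powr (real j - s) * n"
    using n powr_add[of n "real j - s" 1] by (simp add: algebra_simps)
  have c: "cos (n * t + (real (k mod 2) + real (Suc j)) * (pi / 2)) = - sin (n * t + (real (k mod 2) + real j) * (pi / 2))"
  proof -
    have "n * t + (real (k mod 2) + real (Suc j)) * (pi / 2) = (n * t + (real (k mod 2) + real j) * (pi / 2)) + pi / 2"
      by (simp add: algebra_simps)
    moreover have "cos (y + pi / 2) = - sin y" for y :: real by (simp add: cos_add)
    ultimately show ?thesis by (simp only:)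
  qed
  show ?thesis
    unfolding angular_def[abs_def] n_def[symmetric] p c
    by (auto intro!: derivative_eq_intros)
qed

lemma angular_continuous: "continuous_on UNIV (angular s j k)"
  by (meson DERIV_isCont angular_deriv continuous_at_imp_continuous_on)

lemma angular_bound: "\<bar>angular s j k t\<bar> \<le> 2 * real (mode k) powr (real j - s)"
  unfolding angular_def abs_mult using abs_cos_le_one[of "real (mode k) * t + (real (k mod 2) + real j) * (pi / 2)"]
  by (simp add: mult_left_le)

lemma angular_bound_le: "real j \<le> p \<Longrightarrow> \<bar>angular s j k t\<bar> \<le> 2 * real (mode k) powr (p - s)"
  using angular_bound[of s j k t] powr_mono[of "real j - s" "p - s" "real (mode k)"] mode_pos[of k] by simp

lemma angular_periodic: "angular s j k (t + 2 * pi * real_of_int m) = angular s j k t"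
proof -
  have "real (mode k) * (t + 2 * pi * real_of_int m) + (real (k mod 2) + real j) * (pi / 2)
     = (real (mode k) * t + (real (k mod 2) + real j) * (pi / 2)) + 2 * pi * real_of_int (int (mode k) * m)"
    by (simp add: algebra_simps)
  moreover have "cos (x + 2 * pi * real_of_int i) = cos x" for x i
    by (simp add: cos_add)
  ultimately show ?thesis unfolding angular_def by (simp only:)
qed

lemma vector2_eq: "(vector [a, b] :: real ^ 2) = a *\<^sub>R axis 1 1 + b *\<^sub>R axis 2 1"
  by (simp add: vec2_eq_iff axis_def)

lemma vector2_has_derivative:
  assumes "(f has_derivative f') (at x)" "(g has_derivative g') (at x)"
  shows "((\<lambda>x. vector [f x, g x] :: real ^ 2) has_derivative (\<lambda>h. vector [f' h, g' h])) (at x)"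
  unfolding vector2_eq by (intro has_derivative_add has_derivative_scaleR_left assms)

lemma continuous_on_vector2 [continuous_intros]:
  "continuous_on S f \<Longrightarrow> continuous_on S g \<Longrightarrow> continuous_on S (\<lambda>x. vector [f x, g x] :: real ^ 2)"
  unfolding vector2_eq by (intro continuous_intros)

lemma norm_vector2_le: "norm (vector [a, b] :: real ^ 2) \<le> \<bar>a\<bar> + \<bar>b\<bar>"
  unfolding vector2_eq by (rule order_trans[OF norm_triangle_ineq]) simp

text \<open>The derivative of order \<open>i\<close> in \<open>r = x $ 1\<close> and of order \<open>j\<close> in \<open>\<theta> = x $ 2\<close> of a single mode.\<close>

definition mode_fun :: "real \<Rightarrow> (int \<Rightarrow> real \<Rightarrow> real) \<Rightarrow> nat \<Rightarrow> nat \<Rightarrow> nat \<Rightarrow> real ^ 2 \<Rightarrow> real" where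
  "mode_fun s F i j k x = angular s j k (x $ 2) * cdiff i F (int (mode k)) (x $ 1)"

text \<open>The gradient of \<open>mode_fun s F i j k\<close> with respect to \<open>(r, \<theta>)\<close>.\<close>

definition mode_grad :: "real \<Rightarrow> (int \<Rightarrow> real \<Rightarrow> real) \<Rightarrow> nat \<Rightarrow> nat \<Rightarrow> nat \<Rightarrow> real ^ 2 \<Rightarrow> real ^ 2" where
  "mode_grad s F i j k x = vector [mode_fun s F (Suc i) j k x, mode_fun s F i (Suc j) k x]"

text \<open>The exponent \<open>4 - s\<close> is the largest one, among integers minus \<open>s\<close>, for which the weights are summable
  whenever \<open>s > 5\<close>. Two powers of the frequency pay for angular derivatives and one for the
  linear growth in \<open>scaled_bessel_bound\<close>.\<close>

definition mode_weight :: "real \<Rightarrow> nat \<Rightarrow> real" where "mode_weight s k = real (mode k) powr (4 - s)"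

lemma mode_weight_nonneg: "0 \<le> mode_weight s k" by (simp add: mode_weight_def)

lemma summable_mode_weight:
  assumes "s > 5" shows "summable (mode_weight s)"
proof -
  have "summable (\<lambda>n. real n powr (4 - s))" using assms by (simp add: summable_real_powr_iff)
  hence "summable (\<lambda>n. real (Suc n) powr (4 - s))" by (subst summable_Suc_iff)
  hence S: "summable (\<lambda>k. 2 powr (s - 4) * real (Suc k) powr (4 - s))" by (rule summable_mult)
  show ?thesis
  proof (rule summable_comparison_test'[OF S, of 0])
    fix k :: nat
    have "real (Suc k) / 2 \<le> real (mode k)" 
    proof -
      have "Suc k \<le> 2 * mode k" unfolding mode_def by simp
      hence "real (Suc k) \<le> real (2 * mode k)" by (simp only: of_nat_le_iff)
      thus ?thesis by simp
    qed
    hence "real (mode k) powr (4 - s) \<le> (real (Suc k) / 2) powr (4 - s)"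
      using assms by (intro powr_mono2') auto
    also have "\<dots> = 2 powr (s - 4) * real (Suc k) powr (4 - s)"
      by (subst powr_divide) (auto simp: powr_diff field_simps)
    finally show "norm (mode_weight s k) \<le> 2 powr (s - 4) * real (Suc k) powr (4 - s)" by (simp add: mode_weight_def)
  qed
qed

lemma mode_fun_bound:
  assumes "cylinder F M" "real j \<le> 4"
  shows "\<bar>mode_fun s F i j k x\<bar> \<le> 2 * M * mode_weight s k"
proof -
  have "\<bar>mode_fun s F i j k x\<bar> \<le> (2 * real (mode k) powr (4 - s)) * M"
    unfolding mode_fun_def abs_mult using assms
    by (intro mult_mono angular_bound_le cdiff_bound) auto
  thus ?thesis by (simp add: mode_weight_def mult_ac)
qed

lemma mode_grad_bound:
  assumes "cylinder F M" "real j \<le> 3"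
  shows "norm (mode_grad s F i j k x) \<le> 4 * M * mode_weight s k"
  unfolding mode_grad_def
  by (rule order_trans[OF norm_vector2_le]) (use mode_fun_bound[OF assms(1), of j s "Suc i" k x] mode_fun_bound[OF assms(1), of "Suc j" s i k x] assms(2) in simp)

lemma mode_fun_has_derivative:
  assumes "cylinder F M"
  shows "has_partials (mode_fun s F i j k) (mode_fun s F (Suc i) j k x) (mode_fun s F i (Suc j) k x) x"
proof -
  have 1: "((\<lambda>x :: real ^ 2. cdiff i F (int (mode k)) (x $ 1)) has_derivative (\<lambda>h. h $ 1 * cdiff (Suc i) F (int (mode k)) (x $ 1))) (at x)"
    using has_derivative_compose[OF bounded_linear_imp_has_derivative[OF bounded_linear_vec_nth[of 1]] cdiff_deriv[OF assms, unfolded has_field_derivative_def]]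
    by (rule has_derivative_eq_rhs) (simp add: mult_ac)
  have 2: "((\<lambda>x :: real ^ 2. angular s j k (x $ 2)) has_derivative (\<lambda>h. h $ 2 * angular s (Suc j) k (x $ 2))) (at x)"
    using has_derivative_compose[OF bounded_linear_imp_has_derivative[OF bounded_linear_vec_nth[of 2]] angular_deriv[unfolded has_field_derivative_def]]
    by (rule has_derivative_eq_rhs) (simp add: mult_ac)
  show ?thesis unfolding mode_fun_def[abs_def]
    by (rule has_derivative_eq_rhs[OF has_derivative_mult[OF 2 1]]) (auto simp: algebra_simps)
qed

lemma mode_grad_has_derivative:
  assumes "cylinder F M"
  shows "has_partials (mode_grad s F i j k) (mode_grad s F (Suc i) j k x) (mode_grad s F i (Suc j) k x) x"
  unfolding mode_grad_def[abs_def]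
  by (rule has_derivative_eq_rhs[OF vector2_has_derivative[OF mode_fun_has_derivative[OF assms] mode_fun_has_derivative[OF assms]]])
    (simp add: vec2_eq_iff fun_eq_iff)

lemma mode_grad_continuous: "cylinder F M \<Longrightarrow> continuous_on UNIV (mode_grad s F i j k)"
  by (meson mode_grad_has_derivative has_derivative_continuous continuous_at_imp_continuous_on)

definition weighted_summable :: "real \<Rightarrow> (nat \<Rightarrow> real) \<Rightarrow> bool" where
  "weighted_summable s b \<longleftrightarrow> summable (\<lambda>k. \<bar>b k\<bar> * mode_weight s k)"

lemma weighted_summable_mult: "weighted_summable s b \<Longrightarrow> summable (\<lambda>k. \<bar>b k\<bar> * (c * mode_weight s k))"
  using summable_mult[of "\<lambda>k. \<bar>b k\<bar> * mode_weight s k" c] unfolding weighted_summable_def by (simp add: mult_ac)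

text \<open>The mixed partial derivatives, of order \<open>i\<close> in \<open>r\<close> and \<open>j\<close> in \<open>\<theta>\<close>, of the polar gradient of the series
  \<open>\<Sum> b\<^sub>k e\<^sub>k(\<theta>) F\<^sub>n(r)\<close>; those of the series itself are \<open>ufield\<close>.\<close>

definition gfield :: "real \<Rightarrow> (int \<Rightarrow> real \<Rightarrow> real) \<Rightarrow> (nat \<Rightarrow> real) \<Rightarrow> nat \<Rightarrow> nat \<Rightarrow> real ^ 2 \<Rightarrow> real ^ 2" where
  "gfield s F b i j = wseries (mode_grad s F i j) b"

definition ufield :: "real \<Rightarrow> (int \<Rightarrow> real \<Rightarrow> real) \<Rightarrow> (nat \<Rightarrow> real) \<Rightarrow> nat \<Rightarrow> nat \<Rightarrow> real ^ 2 \<Rightarrow> real" where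
  "ufield s F b i j = wseries (mode_fun s F i j) b"

lemma gfield_sums:
  assumes "cylinder F M" "weighted_summable s b" "j \<le> 3"
  shows "(\<lambda>k. b k *\<^sub>R mode_grad s F i j k x) sums gfield s F b i j x"
  unfolding gfield_def
  by (rule wseries_sums[where \<kappa> = "\<lambda>k. 4 * M * mode_weight s k" and A = "mode_grad s F i j", OF weighted_summable_mult[OF assms(2)] mode_grad_bound[OF assms(1)]]) (use assms in simp)

lemma ufield_sums:
  assumes "cylinder F M" "weighted_summable s b" "j \<le> 4"
  shows "(\<lambda>k. b k *\<^sub>R mode_fun s F i j k x) sums ufield s F b i j x"
  unfolding ufield_def
  by (rule wseries_sums[where \<kappa> = "\<lambda>k. 2 * M * mode_weight s k" and A = "mode_fun s F i j", OF weighted_summable_mult[OF assms(2)]])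
     (use mode_fun_bound[OF assms(1)] assms in simp)

lemma gfield_eq:
  assumes "cylinder F M" "weighted_summable s b" "j \<le> 3"
  shows "gfield s F b i j x = vector [ufield s F b (Suc i) j x, ufield s F b i (Suc j) x]"
proof -
  have "(\<lambda>k. (b k *\<^sub>R mode_grad s F i j k x) $ a) sums (gfield s F b i j x $ a)" for a
    by (rule bounded_linear.sums[OF bounded_linear_vec_nth gfield_sums[OF assms]])
  from this[of 1] this[of 2] show ?thesis
    using ufield_sums[OF assms(1,2), of j "Suc i" x] ufield_sums[OF assms(1,2), of "Suc j" i x] assms(3)
    by (auto simp: vec2_eq_iff mode_grad_def intro: sums_unique2)
qed

lemma gfield_has_derivative:
  assumes "cylinder F M" "weighted_summable s b" "j \<le> 2"
  shows "has_partials (gfield s F b i j) (gfield s F b (Suc i) j x) (gfield s F b i (Suc j) x) x"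
  unfolding gfield_def
  by (rule wseries_has_derivative[where \<kappa> = "\<lambda>k. 4 * M * mode_weight s k"])
    (use assms weighted_summable_mult mode_grad_bound[OF assms(1)] mode_grad_has_derivative[OF assms(1)] in auto)

lemma gfield_continuous:
  assumes "cylinder F M" "weighted_summable s b" "j \<le> 3"
  shows "continuous_on UNIV (gfield s F b i j)"
  unfolding gfield_def
  by (rule wseries_continuous[where \<kappa> = "\<lambda>k. 4 * M * mode_weight s k"])
    (use assms weighted_summable_mult mode_grad_bound[OF assms(1)] mode_grad_continuous[OF assms(1)] in auto)

lemma ufield_has_derivative:
  assumes "cylinder F M" "weighted_summable s b" "j \<le> 3"
  shows "has_partials (ufield s F b i j) (ufield s F b (Suc i) j x) (ufield s F b i (Suc j) x) x"
  unfolding ufield_def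
  by (rule wseries_has_derivative[where \<kappa> = "\<lambda>k. 2 * M * mode_weight s k"])
    (use assms weighted_summable_mult mode_fun_bound[OF assms(1)] mode_fun_has_derivative[OF assms(1)] in auto)

lemma mode_fun_periodic: "mode_fun s F i j k (vector [r, t + 2 * pi * real_of_int m]) = mode_fun s F i j k (vector [r, t])"
  unfolding mode_fun_def by (simp add: angular_periodic)

lemma ufield_periodic: "ufield s F b i j (vector [r, t + 2 * pi * real_of_int m]) = ufield s F b i j (vector [r, t])"
  unfolding ufield_def wseries_def by (simp add: mode_fun_periodic)

lemma gfield_periodic: "gfield s F b i j (vector [r, t + 2 * pi * real_of_int m]) = gfield s F b i j (vector [r, t])"
  unfolding gfield_def wseries_def mode_grad_def by (simp add: mode_fun_periodic)

lemma gfield_wave_limit_periodic: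
  "gfield s (wave_limit g) b i j (vector [r + 2 * pi * real m, t]) = gfield s (wave_limit g) b i j (vector [r, t])"
  unfolding gfield_def wseries_def mode_grad_def mode_fun_def by (simp del: cdiff.simps add: cdiff_wave_limit_periodic)

lemma cdiff_scale_diff:
  "sqrt r * cdiff i bessel_J l r - cdiff i (wave_limit g) l r = cdiff i (\<lambda>l r. scaled_bessel l r - wave_limit g l r) l r"
  by (induction i arbitrary: l) (simp_all add: scaled_bessel_def field_simps)

lemma cdiff_error_tendsto:
  assumes "\<And>l. ((\<lambda>r. E l r) \<longlongrightarrow> 0) at_top"
  shows "((\<lambda>r. cdiff i E l r) \<longlongrightarrow> 0) at_top"
proof (induction i arbitrary: l)
  case (Suc i)
  from tendsto_divide[OF tendsto_diff[OF Suc[of "l-1"] Suc[of "l+1"]] tendsto_const[of 2]] show ?case by simp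
next
  case 0
  have "cdiff 0 E l = E l" by (rule ext) simp
  thus ?case using assms by simp
qed

lemma cdiff_error_bound:
  assumes "\<And>l. \<bar>E l r\<bar> \<le> a + c * \<bar>real_of_int l\<bar>" "0 \<le> c"
  shows "\<bar>cdiff i E l r\<bar> \<le> a + c * (\<bar>real_of_int l\<bar> + real i)"
proof (induction i arbitrary: l)
  case (Suc i)
  have "\<bar>real_of_int (l - 1)\<bar> \<le> \<bar>real_of_int l\<bar> + 1" "\<bar>real_of_int (l + 1)\<bar> \<le> \<bar>real_of_int l\<bar> + 1" by auto
  hence "c * (\<bar>real_of_int (l - 1)\<bar> + real i) \<le> c * (\<bar>real_of_int l\<bar> + 1 + real i)"
     "c * (\<bar>real_of_int (l + 1)\<bar> + real i) \<le> c * (\<bar>real_of_int l\<bar> + 1 + real i)"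
    using assms(2) by (intro mult_left_mono add_mono order_refl; simp)+
  with Suc[of "l-1"] Suc[of "l+1"]
  have 1: "\<bar>cdiff i E (l-1) r\<bar> \<le> a + c * (\<bar>real_of_int l\<bar> + 1 + real i)" "\<bar>cdiff i E (l+1) r\<bar> \<le> a + c * (\<bar>real_of_int l\<bar> + 1 + real i)"
    by simp_all
  have "\<bar>cdiff i E (l-1) r - cdiff i E (l+1) r\<bar> \<le> (a + c * (\<bar>real_of_int l\<bar> + 1 + real i)) + (a + c * (\<bar>real_of_int l\<bar> + 1 + real i))"
    by (intro order_trans[OF abs_triangle_ineq4] add_mono 1)
  thus ?case by (simp add: algebra_simps)
qed (simp add: assms)

text \<open>Termwise convergence is the asymptotics of Bessel functions; the dominating series comes
  from \<open>scaled_bessel_bound\<close>, so the convergence is uniform in the angle.\<close>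

lemma ufield_asymptotic:
  assumes g: "\<And>l. ((\<lambda>r. scaled_bessel l r - Re (g * \<i> powi l * cis (- r))) \<longlongrightarrow> 0) at_top"
    and b: "weighted_summable s b" and ij: "i \<le> 2" "j \<le> 2" and e: "e > 0"
  shows "\<forall>\<^sub>F r in at_top. \<forall>t. \<bar>sqrt r * ufield s bessel_J b i j (vector [r, t]) - ufield s (wave_limit g) b i j (vector [r, t])\<bar> \<le> e"
proof -
  define E where "E = (\<lambda>l r. scaled_bessel l r - wave_limit g l r)"
  define a where "a = (\<lambda>k r. \<bar>b k\<bar> * (2 * real (mode k) powr (2 - s)) * \<bar>cdiff i E (int (mode k)) r\<bar>)"
  \<comment> \<open>For \<open>i \<le> 2\<close>, the error profile is at most \<open>9 + norm g + 9 (n + i) \<le> C n\<close>.\<close>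
  define C where "C = 9 + norm g + 27"
  define M where "M = (\<lambda>k. 2 * C * (\<bar>b k\<bar> * mode_weight s k))"
  have sM: "summable M" unfolding M_def using b unfolding weighted_summable_def by (rule summable_mult)
  have lim: "((\<lambda>r. a k r) \<longlongrightarrow> 0) at_top" for k
  proof -
    have "((\<lambda>r. E l r) \<longlongrightarrow> 0) at_top" for l using g[of l] unfolding E_def wave_limit_def .
    from tendsto_mult_right_zero[OF tendsto_rabs_zero[OF cdiff_error_tendsto[OF this]]]
    show ?thesis unfolding a_def .
  qed
  have abound: "norm (a k r) \<le> M k" if r: "r \<ge> 1" for k r
  proof -
    define n where "n = real (mode k)"
    have n: "n \<ge> 1" using mode_pos by (simp add: n_def)
    have Eb: "\<bar>E l r\<bar> \<le> (9 + norm g) + 9 * \<bar>real_of_int l\<bar>" for l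
    proof -
      have "\<bar>wave_limit g l r\<bar> \<le> norm g" using cylinder_wave_limit[of g] unfolding cylinder_def by blast
      hence "\<bar>E l r\<bar> \<le> 9 * (1 + \<bar>of_int l\<bar>) + norm g"
        unfolding E_def by (intro order_trans[OF abs_triangle_ineq4] add_mono scaled_bessel_bound r)
      thus ?thesis by simp
    qed
    have "\<bar>cdiff i E (int (mode k)) r\<bar> \<le> (9 + norm g) + 9 * (n + real i)"
      using cdiff_error_bound[where E=E and a="9 + norm g" and c=9 and r=r and i=i and l="int (mode k)", OF Eb] by (simp add: n_def)
    also have "\<dots> \<le> (9 + norm g) * n + 9 * (n + 2 * n)"
    proof (intro add_mono mult_left_mono order_refl)
      show "9 + norm g \<le> (9 + norm g) * n" using n mult_left_mono[of 1 n "9 + norm g"] by simp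
      show "real i \<le> 2 * n" using n ij(1) by linarith
    qed simp
    also have "\<dots> = C * n" by (simp add: C_def algebra_simps)
    finally have 1: "\<bar>cdiff i E (int (mode k)) r\<bar> \<le> C * n" .
    have C0: "C \<ge> 0" by (simp add: C_def)
    have "a k r \<le> \<bar>b k\<bar> * (2 * n powr (2 - s)) * (C * n)"
      unfolding a_def n_def[symmetric] by (intro mult_left_mono 1) auto
    also have "\<dots> = 2 * C * (\<bar>b k\<bar> * n powr (3 - s))"
      using n powr_add[of n "2 - s" 1] by (simp add: algebra_simps)
    also have "\<dots> \<le> 2 * C * (\<bar>b k\<bar> * n powr (4 - s))"
      using n C0 by (intro mult_left_mono powr_mono) auto
    finally show ?thesis unfolding M_def mode_weight_def n_def a_def by simp
  qed
  have "((\<lambda>r. \<Sum>k. a k r) \<longlongrightarrow> (\<Sum>k::nat. 0)) at_top"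
  proof (rule tannerys_theorem[THEN conjunct2, THEN conjunct2, OF lim _ sM])
    have "\<forall>\<^sub>F r in at_top. r \<ge> (1::real)" by (rule eventually_ge_at_top)
    thus "\<forall>\<^sub>F (k, n) in at_top \<times>\<^sub>F at_top. norm (a k n) \<le> M k"
      unfolding eventually_prod_filter
      by (intro exI[of _ "\<lambda>_. True"] exI[of _ "\<lambda>r. r \<ge> 1"]) (auto intro: abound[simplified])
  qed simp
  hence "((\<lambda>r. \<Sum>k. a k r) \<longlongrightarrow> 0) at_top" by simp
  hence "\<forall>\<^sub>F r in at_top. (\<Sum>k. a k r) < e" using e by (rule order_tendstoD(2))
  with eventually_ge_at_top[of 1] show ?thesis
  proof eventually_elim
    case (elim r)
    show ?case
    proof
      fix t
      let ?x = "vector [r, t] :: real ^ 2"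
      have tm: "sqrt r * (b k *\<^sub>R mode_fun s bessel_J i j k ?x) - b k *\<^sub>R mode_fun s (wave_limit g) i j k ?x
          = b k * (angular s j k t * cdiff i E (int (mode k)) r)" for k
        unfolding mode_fun_def E_def cdiff_scale_diff[symmetric] by (simp add: algebra_simps)
      have tb: "norm (b k * (angular s j k t * cdiff i E (int (mode k)) r)) \<le> a k r" for k
      proof -
        have "\<bar>angular s j k t\<bar> \<le> 2 * real (mode k) powr (2 - s)" by (rule angular_bound_le) (use ij in simp)
        hence "\<bar>b k\<bar> * (\<bar>angular s j k t\<bar> * \<bar>cdiff i E (int (mode k)) r\<bar>) \<le> \<bar>b k\<bar> * ((2 * real (mode k) powr (2 - s)) * \<bar>cdiff i E (int (mode k)) r\<bar>)"
          by (intro mult_left_mono mult_right_mono) auto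
        thus ?thesis unfolding a_def by (simp add: abs_mult mult_ac)
      qed
      have sa: "summable (\<lambda>k. a k r)"
        by (rule summable_comparison_test'[OF sM, of 0]) (rule abound[OF elim(1)])
      have "(\<lambda>k. sqrt r * (b k *\<^sub>R mode_fun s bessel_J i j k ?x) - b k *\<^sub>R mode_fun s (wave_limit g) i j k ?x) sums
         (sqrt r * ufield s bessel_J b i j ?x - ufield s (wave_limit g) b i j ?x)"
        using ij by (intro sums_diff sums_mult ufield_sums[OF cylinder_bessel_J b] ufield_sums[OF cylinder_wave_limit b]) auto
      hence "sqrt r * ufield s bessel_J b i j ?x - ufield s (wave_limit g) b i j ?x = (\<Sum>k. b k * (angular s j k t * cdiff i E (int (mode k)) r))"
        unfolding tm by (rule sums_unique)
      also have "norm \<dots> \<le> (\<Sum>k. a k r)" by (rule norm_suminf_le[OF tb sa])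
      finally show "\<bar>sqrt r * ufield s bessel_J b i j ?x - ufield s (wave_limit g) b i j ?x\<bar> \<le> e" using elim(2) by simp
    qed
  qed
qed

section \<open>The limiting wave and almost sure non-degeneracy\<close>

text \<open>The derivatives of \<open>F = 2 \<pi> f\<close>, where \<open>f\<close> is the random density.\<close>

definition amplitude :: "real \<Rightarrow> (nat \<Rightarrow> real) \<Rightarrow> nat \<Rightarrow> real \<Rightarrow> complex" where
  "amplitude s b j = wseries (\<lambda>k t. complex_of_real (angular s j k t) * \<i> ^ mode k) b"

lemma amplitude_sums:
  assumes "weighted_summable s b" "j \<le> 4"
  shows "(\<lambda>k. b k *\<^sub>R (complex_of_real (angular s j k t) * \<i> ^ mode k)) sums amplitude s b j t"
  unfolding amplitude_def
proof (rule wseries_sums[where \<kappa> = "\<lambda>k. 2 * mode_weight s k" and A = "\<lambda>k t. complex_of_real (angular s j k t) * \<i> ^ mode k", OF weighted_summable_mult[OF assms(1)]])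
  show "cmod (complex_of_real (angular s j k t) * \<i> ^ mode k) \<le> 2 * mode_weight s k" for k
    using angular_bound_le[of j 4 s k t] assms(2) by (simp add: norm_mult norm_power mode_weight_def)
qed

text \<open>Summing the limiting profiles gives \<open>L(r,\<theta>) = Re (g exp (- \<i> r) F(\<theta>))\<close> and its derivatives.\<close>

lemma ufield_wave_limit:
  assumes "weighted_summable s b" "j \<le> 4"
  shows "ufield s (wave_limit g) b i j (vector [r, t]) = Re ((- \<i>) ^ i * g * cis (- r) * amplitude s b j t)"
proof -
  have "(\<lambda>k. Re ((- \<i>) ^ i * g * cis (- r) * (b k *\<^sub>R (complex_of_real (angular s j k t) * \<i> ^ mode k)))) sums
     Re ((- \<i>) ^ i * g * cis (- r) * amplitude s b j t)"
    by (intro sums_Re sums_mult amplitude_sums assms)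
  moreover have "Re ((- \<i>) ^ i * g * cis (- r) * (b k *\<^sub>R (complex_of_real (angular s j k t) * \<i> ^ mode k)))
      = b k *\<^sub>R mode_fun s (wave_limit g) i j k (vector [r, t])" for k
  proof -
    have "(- \<i>) ^ i * g * cis (- r) * (b k *\<^sub>R (complex_of_real (angular s j k t) * \<i> ^ mode k))
       = complex_of_real (b k * angular s j k t) * ((- \<i>) ^ i * (g * \<i> powi int (mode k) * cis (- r)))"
      by (simp add: scaleR_conv_of_real mult_ac)
    moreover have "Re (complex_of_real c * z) = c * Re z" for c z by simp
    ultimately show ?thesis unfolding mode_fun_def cdiff_wave_limit by (simp only: vector_2 real_scaleR_def mult.assoc)
  qed
  ultimately have "(\<lambda>k. b k *\<^sub>R mode_fun s (wave_limit g) i j k (vector [r, t])) sums Re ((- \<i>) ^ i * g * cis (- r) * amplitude s b j t)"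
    by (simp only:)
  with ufield_sums[OF cylinder_wave_limit assms(1) assms(2)] show ?thesis by (rule sums_unique2)
qed

lemma amplitude_has_derivative:
  assumes b: "weighted_summable s b" and j: "j \<le> 3"
  shows "(amplitude s b j has_vector_derivative amplitude s b (Suc j) t) (at t)"
proof -
  \<comment> \<open>At \<open>r = 0\<close> the limiting wave with \<open>g = 1\<close> is the real part of \<open>F\<close>, and its radial derivative is the imaginary part.\<close>
  have Re: "Re (amplitude s b j t) = ufield s (wave_limit 1) b 0 j (vector [0, t])" if "j \<le> 4" for j t
    using ufield_wave_limit[OF b that, of 1 0 0 t] by simp
  have Im: "Im (amplitude s b j t) = ufield s (wave_limit 1) b 1 j (vector [0, t])" if "j \<le> 4" for j t
    using ufield_wave_limit[OF b that, of 1 1 0 t] by simp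
  have v: "((\<lambda>t. vector [0, t] :: real ^ 2) has_derivative (\<lambda>h. vector [0, h])) (at t)"
    by (intro vector2_has_derivative has_derivative_const has_derivative_ident)
  have u: "((\<lambda>t. ufield s (wave_limit 1) b i j (vector [0, t])) has_field_derivative ufield s (wave_limit 1) b i (Suc j) (vector [0, t])) (at t)" for i
    unfolding has_field_derivative_def
    using has_derivative_compose[OF v ufield_has_derivative[OF cylinder_wave_limit b j]]
    by (rule has_derivative_eq_rhs) (simp add: fun_eq_iff)
  show ?thesis
    unfolding has_vector_derivative_complex_iff using u[of 0] u[of 1] Re[of j] Re[of "Suc j"] Im[of j] Im[of "Suc j"] j
    by simp
qed

lemma mode_even: "even k \<Longrightarrow> mode (Suc k) = mode k"
  unfolding mode_def by auto

text \<open>The two modes of one frequency are a sine and a cosine, so that their Wronskian is a non-zero constant.\<close>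

lemma angular_wronskian:
  assumes "even k"
  shows "angular s j k t * angular s (Suc j) (Suc k) t - angular s (Suc j) k t * angular s j (Suc k) t \<noteq> 0"
proof -
  define n where "n = real (mode k)"
  define y where "y = n * t + real j * (pi / 2)"
  have n: "n \<ge> 1" using mode_pos by (simp add: n_def)
  have m: "k mod 2 = 0" "Suc k mod 2 = 1" using assms by auto
  have 1: "cos (y + pi / 2) = - sin y" "cos (y + pi) = - cos y" by (simp_all add: cos_add)
  have arg: "n * t + (real 0 + real (Suc j)) * (pi / 2) = y + pi / 2" "n * t + (real 1 + real j) * (pi / 2) = y + pi / 2"
    "n * t + (real 1 + real (Suc j)) * (pi / 2) = y + pi"
    unfolding y_def by (simp_all add: field_simps)
  have e: "angular s j k t = 2 * n powr (real j - s) * cos y"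
    "angular s (Suc j) k t = 2 * n powr (real (Suc j) - s) * - sin y"
    "angular s j (Suc k) t = 2 * n powr (real j - s) * - sin y"
    "angular s (Suc j) (Suc k) t = 2 * n powr (real (Suc j) - s) * - cos y"
    unfolding angular_def mode_even[OF assms] m n_def[symmetric] arg 1 by (simp_all add: y_def)
  have "angular s j k t * angular s (Suc j) (Suc k) t - angular s (Suc j) k t * angular s j (Suc k) t
     = - (4 * n powr (real j - s) * n powr (real (Suc j) - s) * (cos y ^ 2 + sin y ^ 2))"
  proof -
    have "(2 * p * c) * (2 * q * - c) - (2 * q * - d) * (2 * p * - d) = - (4 * p * q * (c ^ 2 + d ^ 2))" for p q c d :: real
      by (simp add: algebra_simps power2_eq_square)
    thus ?thesis unfolding e .
  qed
  also have "\<dots> \<noteq> 0" using n by simp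
  finally show ?thesis .
qed

lemma angular_pair_nonzero:
  assumes "even k" shows "angular s j k t \<noteq> 0 \<or> angular s j (Suc k) t \<noteq> 0"
  using angular_wronskian[OF assms, of s j t] by auto

lemma wedge_mode_grad:
  "wedge (mode_grad s F 0 0 k x) (mode_grad s F 0 0 k' x) =
     mode_fun s F 1 0 k x * mode_fun s F 0 1 k' x - mode_fun s F 0 1 k x * mode_fun s F 1 0 k' x"
  by (simp add: wedge_def mode_grad_def)

lemma AE_nondegenerate_field:
  assumes s: "s > 5" and F: "cylinder F M"
  shows "AE b in gauss_seq. \<forall>x. (\<exists>i j. wedge (mode_grad s F 0 0 i x) (mode_grad s F 0 0 j x) \<noteq> 0) \<longrightarrow> gfield s F b 0 0 x = 0 \<longrightarrow>
     wedge (gfield s F b 1 0 x) (gfield s F b 0 1 x) \<noteq> 0"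
  unfolding gfield_def
proof (rule AE_nondegenerate_zeros[where \<kappa> = "\<lambda>k. 4 * M * mode_weight s k"])
  show "summable (\<lambda>k. 4 * M * mode_weight s k)" by (intro summable_mult summable_mode_weight s)
  show "norm (mode_grad s F 0 0 k x) \<le> 4 * M * mode_weight s k" "norm (mode_grad s F 1 0 k x) \<le> 4 * M * mode_weight s k" "norm (mode_grad s F 0 1 k x) \<le> 4 * M * mode_weight s k" for k x
    by (rule mode_grad_bound[OF F]; simp)+
  show "has_partials (mode_grad s F 0 0 k) (mode_grad s F 1 0 k x) (mode_grad s F 0 1 k x) x" for k x
    using mode_grad_has_derivative[OF F, of s 0 0 k x] by simp
  show "continuous_on UNIV (mode_grad s F 1 0 k)" "continuous_on UNIV (mode_grad s F 0 1 k)" for k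
    by (rule mode_grad_continuous[OF F])+
qed

text \<open>For both modes of one frequency \<open>n\<close>, the determinant of the gradients is the Wronskian of the angular parts times
  \<open>J\<^sub>n J\<^sub>n'\<close>, and some \<open>n\<close> makes this product non-zero.\<close>

lemma bessel_wedge_nonzero:
  assumes "x $ 1 \<noteq> 0"
  shows "\<exists>i j. wedge (mode_grad s bessel_J 0 0 i x) (mode_grad s bessel_J 0 0 j x) \<noteq> 0"
proof -
  obtain n where n: "n \<ge> 1" "bessel_J (int n) (x $ 1) \<noteq> 0" "bessel_J (int n - 1) (x $ 1) - bessel_J (int n + 1) (x $ 1) \<noteq> 0"
    using bessel_J_nonvanishing[OF assms] by blast
  define k where "k = 2 * (n - 1)"
  have ev: "even k" and m: "mode k = n" using n(1) by (auto simp: k_def mode_def)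
  have "wedge (mode_grad s bessel_J 0 0 k x) (mode_grad s bessel_J 0 0 (Suc k) x) =
     cdiff 1 bessel_J (int n) (x $ 1) * bessel_J (int n) (x $ 1) *
     (angular s 0 k (x $ 2) * angular s (Suc 0) (Suc k) (x $ 2) - angular s (Suc 0) k (x $ 2) * angular s 0 (Suc k) (x $ 2))"
    unfolding wedge_mode_grad mode_fun_def mode_even[OF ev] m by (simp add: algebra_simps)
  also have "\<dots> \<noteq> 0" using n angular_wronskian[OF ev, of s 0 "x $ 2"] by simp
  finally show ?thesis by blast
qed

text \<open>The modes of frequency \<open>1\<close> alone do not suffice: their gradients are dependent at the radii where the profile
  or its derivative vanishes. There one mode of frequency \<open>1\<close> and one of frequency \<open>2\<close>, whose profile is a quarter
  turn ahead, have independent gradients.\<close>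

lemma wave_limit_wedge_nonzero:
  assumes g: "g \<noteq> 0"
  shows "\<exists>i j. wedge (mode_grad s (wave_limit g) 0 0 i x) (mode_grad s (wave_limit g) 0 0 j x) \<noteq> 0"
proof -
  define z where "z = g * cis (- (x $ 1))"
  define p where "p = Re z"
  define q where "q = - Im z"
  have "z \<noteq> 0" using g by (simp add: z_def)
  hence pq: "p \<noteq> 0 \<or> q \<noteq> 0" by (auto simp: p_def q_def complex_eq_iff)
  let ?F = "wave_limit g"
  have i2: "\<i> powi 2 = -1" by (simp add: power2_eq_square)
  have F1: "cdiff 0 ?F 1 (x $ 1) = q" "cdiff 1 ?F 1 (x $ 1) = p"
    and F2: "cdiff 0 ?F 2 (x $ 1) = - p" "cdiff 1 ?F 2 (x $ 1) = q"
    unfolding cdiff_wave_limit p_def q_def z_def i2 by simp_all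
  have m: "int (mode 0) = 1" "int (mode 1) = 1" "int (mode 2) = 2" "int (mode 3) = 2" by (simp_all add: mode_def)
  let ?a = "\<lambda>j k. angular s j k (x $ 2)"
  show ?thesis
  proof (cases "p = 0 \<or> q = 0")
    case False
    have "wedge (mode_grad s ?F 0 0 0 x) (mode_grad s ?F 0 0 1 x) = p * q * (?a 0 0 * ?a 1 1 - ?a 1 0 * ?a 0 1)"
      unfolding wedge_mode_grad mode_fun_def m F1 by (simp add: algebra_simps)
    also have "\<dots> \<noteq> 0" using False angular_wronskian[of 0 s 0 "x $ 2"] by simp
    finally show ?thesis by blast
  next
    case True
    have w: "wedge (mode_grad s ?F 0 0 i x) (mode_grad s ?F 0 0 j x) = - (p * ?a 0 i * p * ?a 1 j) - q * ?a 1 i * q * ?a 0 j"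
      if "i = 0 \<or> i = 1" "j = 2 \<or> j = 3" for i j
    proof -
      have "int (mode i) = 1" "int (mode j) = 2" using that m by auto
      thus ?thesis unfolding wedge_mode_grad mode_fun_def by (simp only: F1 F2) (simp add: algebra_simps)
    qed
    show ?thesis
    proof (cases "p = 0")
      case True
      obtain i where i: "i = 0 \<or> i = 1" "?a 1 i \<noteq> 0" using angular_pair_nonzero[of 0 s 1 "x $ 2"] by auto
      obtain j where j: "j = 2 \<or> j = 3" "?a 0 j \<noteq> 0" using angular_pair_nonzero[of 2 s 0 "x $ 2"] by (auto simp: numeral_3_eq_3 numeral_2_eq_2)
      show ?thesis using w[OF i(1) j(1)] i j True pq by (intro exI[of _ i] exI[of _ j]) auto
    next
      case False
      with \<open>p = 0 \<or> q = 0\<close> have "q = 0" by simp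
      obtain i where i: "i = 0 \<or> i = 1" "?a 0 i \<noteq> 0" using angular_pair_nonzero[of 0 s 0 "x $ 2"] by auto
      obtain j where j: "j = 2 \<or> j = 3" "?a 1 j \<noteq> 0" using angular_pair_nonzero[of 2 s 1 "x $ 2"] by (auto simp: numeral_3_eq_3 numeral_2_eq_2)
      show ?thesis using w[OF i(1) j(1)] i j \<open>q = 0\<close> False by (intro exI[of _ i] exI[of _ j]) auto
    qed
  qed
qed

text \<open>The real and imaginary part of \<open>F\<close>, with an additional variable on which nothing depends, form a
  plane vector field with Jacobian \<open>0\<close> everywhere. It has no non-degenerate zero, hence almost surely no zero.\<close>

lemma AE_amplitude_nonzero:
  assumes s: "s > 5"
  shows "AE b in gauss_seq. weighted_summable s b \<longrightarrow> (\<forall>t. amplitude s b 0 t \<noteq> 0)"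
proof -
  define A where "A = (\<lambda>j k (x :: real ^ 2). vector [Re (\<i> ^ mode k) * angular s j k (x $ 2), Im (\<i> ^ mode k) * angular s j k (x $ 2)] :: real ^ 2)"
  have c: "\<bar>Re (\<i> ^ n)\<bar> \<le> 1" "\<bar>Im (\<i> ^ n)\<bar> \<le> 1" for n
    using abs_Re_le_cmod[of "\<i> ^ n"] abs_Im_le_cmod[of "\<i> ^ n"] by (simp_all add: norm_power)
  have Ab: "norm (A j k x) \<le> 4 * mode_weight s k" if "j \<le> 4" for j k x
  proof -
    have a: "\<bar>angular s j k (x $ 2)\<bar> \<le> 2 * mode_weight s k" using angular_bound_le[of j 4 s k] that by (simp add: mode_weight_def)
    have "\<bar>Re (\<i> ^ mode k) * angular s j k (x $ 2)\<bar> \<le> 1 * (2 * mode_weight s k)" "\<bar>Im (\<i> ^ mode k) * angular s j k (x $ 2)\<bar> \<le> 1 * (2 * mode_weight s k)"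
      unfolding abs_mult by (intro mult_mono c a; simp)+
    thus ?thesis unfolding A_def by (intro order_trans[OF norm_vector2_le]) simp
  qed
  have d_angular: "((\<lambda>x :: real ^ 2. angular s j k (x $ 2)) has_derivative (\<lambda>h. h $ 2 * angular s (Suc j) k (x $ 2))) (at x)" for j k and x :: "real ^ 2"
    using has_derivative_compose[OF bounded_linear_imp_has_derivative[OF bounded_linear_vec_nth[of 2]] angular_deriv[unfolded has_field_derivative_def]]
    by (rule has_derivative_eq_rhs) (simp add: mult_ac)
  have dA: "has_partials (A 0 k) 0 (A 1 k x) x" for k x
    unfolding A_def
    by (rule has_derivative_eq_rhs[OF vector2_has_derivative[OF has_derivative_mult_right[OF d_angular] has_derivative_mult_right[OF d_angular]]])
      (simp add: fun_eq_iff vec2_eq_iff)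
  have cA: "continuous_on UNIV (A 1 k)" for k
    unfolding A_def
    by (intro continuous_intros continuous_on_compose2[OF angular_continuous]) auto
  have "AE b in gauss_seq. \<forall>x. (\<exists>i j. wedge (A 0 i x) (A 0 j x) \<noteq> 0) \<longrightarrow> wseries (A 0) b x = 0 \<longrightarrow> wedge (wseries (\<lambda>_ _. 0) b x) (wseries (A 1) b x) \<noteq> 0"
    by (rule AE_nondegenerate_zeros[where \<kappa> = "\<lambda>k. 4 * mode_weight s k"])
      (use Ab dA cA mode_weight_nonneg in \<open>auto intro!: summable_mult summable_mode_weight s\<close>)
  thus ?thesis
  proof eventually_elim
    case (elim b)
    show ?case
    proof (intro impI allI notI)
      fix t assume b: "weighted_summable s b" and z: "amplitude s b 0 t = 0"
      let ?x = "vector [0, t] :: real ^ 2"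
      have "(\<lambda>k. b k *\<^sub>R A 0 k ?x) sums wseries (A 0) b ?x"
        by (rule wseries_sums[where \<kappa> = "\<lambda>k. 4 * mode_weight s k" and A = "A 0", OF weighted_summable_mult[OF b] Ab]) simp
      from bounded_linear.sums[OF bounded_linear_vec_nth this]
      have S: "(\<lambda>k. (b k *\<^sub>R A 0 k ?x) $ a) sums (wseries (A 0) b ?x $ a)" for a .
      have D: "(\<lambda>k. b k *\<^sub>R (complex_of_real (angular s 0 k t) * \<i> ^ mode k)) sums 0"
        using amplitude_sums[OF b, of 0 t] z by simp
      have "wseries (A 0) b ?x $ 1 = 0" "wseries (A 0) b ?x $ 2 = 0"
        using S[of 1] S[of 2] sums_Re[OF D] sums_Im[OF D]
        by (auto simp: A_def mult_ac intro: sums_unique2)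
      hence "wseries (A 0) b ?x = 0" by (simp add: vec2_eq_iff)
      moreover have "wedge (wseries (\<lambda>_ _. 0) b ?x) (wseries (A 1) b ?x) = 0"
        by (simp add: wseries_def wedge_def)
      moreover have "\<exists>i j. wedge (A 0 i ?x) (A 0 j ?x) \<noteq> 0"
      proof -
        have w: "wedge (A 0 i ?x) (A 0 j ?x) = angular s 0 i t * angular s 0 j t" if "i = 0 \<or> i = 1" "j = 2 \<or> j = 3" for i j
        proof -
          have "mode i = 1" "mode j = 2" using that by (auto simp: mode_def)
          thus ?thesis unfolding A_def wedge_def by simp
        qed
        obtain i where i: "i = 0 \<or> i = 1" "angular s 0 i t \<noteq> 0" using angular_pair_nonzero[of 0 s 0 t] by auto
        obtain j where j: "j = 2 \<or> j = 3" "angular s 0 j t \<noteq> 0" using angular_pair_nonzero[of 2 s 0 t] by (auto simp: numeral_3_eq_3 numeral_2_eq_2)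
        show ?thesis using w[OF i(1) j(1)] i j by (intro exI[of _ i] exI[of _ j]) auto
      qed
      ultimately show False using elim by blast
    qed
  qed
qed

lemma AE_gauss_seq_nonzero: "AE b in gauss_seq. b k \<noteq> 0"
proof (rule AE_PiM_component[of UNIV "\<lambda>_. gauss" k "\<lambda>x. x \<noteq> 0"])
  show "AE x in gauss. x \<noteq> 0" by (rule AE_gauss_of_lborel) (rule AE_lborel_singleton)
qed (auto intro: prob_space_gauss)

text \<open>The probability-one properties of the coefficients from which the count follows deterministically. The
  condition on \<open>b 0\<close> takes care of the origin, where all gradients of modes are dependent.\<close>

definition generic :: "real \<Rightarrow> complex \<Rightarrow> (nat \<Rightarrow> real) \<Rightarrow> bool" where
  "generic s g b \<longleftrightarrow> weighted_summable s b \<and> b 0 \<noteq> 0 \<and> (\<forall>t. amplitude s b 0 t \<noteq> 0) \<and>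
    (\<forall>x. x $ 1 \<noteq> 0 \<longrightarrow> gfield s bessel_J b 0 0 x = 0 \<longrightarrow> wedge (gfield s bessel_J b 1 0 x) (gfield s bessel_J b 0 1 x) \<noteq> 0) \<and>
    (\<forall>x. gfield s (wave_limit g) b 0 0 x = 0 \<longrightarrow> wedge (gfield s (wave_limit g) b 1 0 x) (gfield s (wave_limit g) b 0 1 x) \<noteq> 0)"

theorem AE_generic:
  assumes s: "s > 5" and g: "g \<noteq> 0"
  shows "AE b in gauss_seq. generic s g b"
  using AE_gauss_seq_summable[OF summable_mode_weight[OF s] mode_weight_nonneg] AE_gauss_seq_nonzero[of 0] AE_amplitude_nonzero[OF s]
    AE_nondegenerate_field[OF s cylinder_bessel_J] AE_nondegenerate_field[OF s cylinder_wave_limit[of g]]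
proof eventually_elim
  case (elim b)
  thus ?case unfolding generic_def weighted_summable_def
    using bessel_wedge_nonzero wave_limit_wedge_nonzero[OF g] by blast
qed

text \<open>At \<open>r = 0\<close> the polar gradient \<open>(u\<^sub>r, u\<^sub>\<theta>)\<close> has zeros that do not come from critical points of the wave. There only the modes of
  frequency \<open>1\<close> contribute to \<open>u\<^sub>r\<close> and \<open>u\<^bsub>r\<theta>\<^esub>\<close>, the Jacobian is \<open>- u\<^bsub>r\<theta>\<^esub>\<^sup>2\<close>, and a sinusoid and its derivative have
  no common zero. So the zeros of the polar gradient do not accumulate at \<open>r = 0\<close>.\<close>

lemma generic_bessel_nondegenerate:
  assumes gen: "generic s g b" and z: "gfield s bessel_J b 0 0 x = 0"
  shows "wedge (gfield s bessel_J b 1 0 x) (gfield s bessel_J b 0 1 x) \<noteq> 0"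
proof (cases "x $ 1 = 0")
  case False thus ?thesis using gen z unfolding generic_def by blast
next
  case True
  have b: "weighted_summable s b" and b0: "b 0 \<noteq> 0" using gen unfolding generic_def by auto
  let ?u = "\<lambda>i j. ufield s bessel_J b i j x"
  have J0: "bessel_J (int (mode k)) 0 = 0" for k using bessel_J_at_0[of "k div 2"] by (simp add: mode_def)
  have J1: "cdiff 1 bessel_J (int (mode k)) 0 = (if k < 2 then 1 / 2 else 0)" for k
  proof (cases "k < 2")
    case True
    hence "int (mode k) - 1 = 0" "int (mode k) + 1 = int (Suc 1)" by (auto simp: mode_def)
    thus ?thesis using True by (simp only: One_nat_def cdiff.simps bessel_J_0_0 bessel_J_at_0) simp
  next
    case False
    hence "k div 2 \<ge> 1" by simp
    then obtain m where "mode k = Suc (Suc m)" unfolding mode_def by (cases "k div 2") auto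
    hence "int (mode k) - 1 = int (Suc m)" "int (mode k) + 1 = int (Suc (Suc (Suc m)))" by auto
    thus ?thesis using False by (simp only: One_nat_def cdiff.simps bessel_J_at_0) simp
  qed
  have u0: "?u 0 j = 0" if "j \<le> 4" for j
  proof -
    have "(\<lambda>k. b k *\<^sub>R mode_fun s bessel_J 0 j k x) sums ?u 0 j" by (rule ufield_sums[OF cylinder_bessel_J b that])
    moreover have "mode_fun s bessel_J 0 j k x = 0" for k unfolding mode_fun_def True by (simp add: J0)
    ultimately show ?thesis by (simp add: sums_iff)
  qed
  have u1: "?u 1 j = (b 0 * angular s j 0 (x $ 2) + b 1 * angular s j 1 (x $ 2)) / 2" if "j \<le> 4" for j
  proof -
    have "(\<lambda>k. b k *\<^sub>R mode_fun s bessel_J 1 j k x) sums ?u 1 j" by (rule ufield_sums[OF cylinder_bessel_J b that])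
    moreover have "(\<lambda>k. b k *\<^sub>R mode_fun s bessel_J 1 j k x) sums (\<Sum>k\<in>{0, 1}. b k *\<^sub>R mode_fun s bessel_J 1 j k x)"
      by (rule sums_finite) (auto simp: mode_fun_def True J1[simplified])
    ultimately have "?u 1 j = (\<Sum>k\<in>{0, 1}. b k *\<^sub>R mode_fun s bessel_J 1 j k x)" by (rule sums_unique2)
    also have "\<dots> = (b 0 * angular s j 0 (x $ 2) + b 1 * angular s j 1 (x $ 2)) / 2"
      unfolding mode_fun_def True J1 by simp
    finally show ?thesis .
  qed
  have G: "gfield s bessel_J b i j x = vector [?u (Suc i) j, ?u i (Suc j)]" if "j \<le> 3" for i j
    by (rule gfield_eq[OF cylinder_bessel_J b that])
  have "wedge (gfield s bessel_J b 1 0 x) (gfield s bessel_J b 0 1 x) = - (?u 1 1 ^ 2)"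
    using u0[of 2] by (simp add: G wedge_def numeral_2_eq_2 power2_eq_square)
  moreover have "?u 1 1 \<noteq> 0"
  proof
    assume "?u 1 1 = 0"
    hence 1: "b 0 * angular s 1 0 (x $ 2) + b 1 * angular s 1 1 (x $ 2) = 0" using u1[of 1] by simp
    have "?u 1 0 = 0" using z G[of 0 0] by (simp add: vec2_eq_iff)
    hence 0: "b 0 * angular s 0 0 (x $ 2) + b 1 * angular s 0 1 (x $ 2) = 0" using u1[of 0] by simp
    have "b 0 * (angular s 0 0 (x $ 2) * angular s 1 1 (x $ 2) - angular s 1 0 (x $ 2) * angular s 0 1 (x $ 2)) =
      (b 0 * angular s 0 0 (x $ 2) + b 1 * angular s 0 1 (x $ 2)) * angular s 1 1 (x $ 2) - (b 0 * angular s 1 0 (x $ 2) + b 1 * angular s 1 1 (x $ 2)) * angular s 0 1 (x $ 2)"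
      by (simp add: algebra_simps)
    also have "\<dots> = 0" unfolding 0 1 by simp
    finally show False using b0 angular_wronskian[of 0 s 0 "x $ 2"] by simp
  qed
  ultimately show ?thesis by simp
qed

section \<open>The wave and its density as series of modes\<close>

text \<open>The enumeration of the independent real random variables: real and imaginary parts of \<open>a\<^sub>1\<close>, of \<open>a\<^sub>2\<close>, and
  so on.\<close>

definition mode_coeffs :: "(int \<Rightarrow> complex) \<Rightarrow> nat \<Rightarrow> real" where
  "mode_coeffs a k = (if even k then Re (a (int (mode k))) else Im (a (int (mode k))))"

definition hermitian :: "(int \<Rightarrow> complex) \<Rightarrow> bool" where
  "hermitian a \<longleftrightarrow> (\<forall>l. l \<noteq> 0 \<longrightarrow> a l = (-1) powi l * cnj (a (- l)))"

text \<open>The opposite frequencies \<open>l\<close> and \<open>- l\<close> together form the two real modes of the frequency \<open>\<bar>l\<bar>\<close>.\<close>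

lemma infsum_nonzero_int_paired:
  fixes T :: "int \<Rightarrow> complex"
  assumes sp: "summable (\<lambda>n. norm (T (int (Suc n))))" and sm: "summable (\<lambda>n. norm (T (- int (Suc n))))"
    and v: "v sums V" and pair: "\<And>n. v (2 * n) + v (2 * n + 1) = T (int (Suc n)) + T (- int (Suc n))"
  shows "infsum T (- {0}) = V"
proof -
  obtain P where P: "(\<lambda>n. T (int (Suc n))) sums P" using summable_norm_cancel[OF sp] by blast
  obtain N where N: "(\<lambda>n. T (- int (Suc n))) sums N" using summable_norm_cancel[OF sm] by blast
  have hP: "(T has_sum P) (range (\<lambda>n. int (Suc n)))"
    using norm_summable_imp_has_sum[OF sp P] by (subst has_sum_reindex) (auto simp: inj_on_def comp_def)
  have hN: "(T has_sum N) (range (\<lambda>n. - int (Suc n)))"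
    using norm_summable_imp_has_sum[OF sm N] by (subst has_sum_reindex) (auto simp: inj_on_def comp_def)
  have "range (\<lambda>n. int (Suc n)) \<inter> range (\<lambda>n. - int (Suc n)) = {}" by auto
  from has_sum_Un_disjoint[OF hP hN this] have "(T has_sum (P + N)) (range (\<lambda>n. int (Suc n)) \<union> range (\<lambda>n. - int (Suc n)))" .
  also have "range (\<lambda>n. int (Suc n)) \<union> range (\<lambda>n. - int (Suc n)) = - {0}"
  proof
    show "- {0} \<subseteq> range (\<lambda>n. int (Suc n)) \<union> range (\<lambda>n. - int (Suc n))"
    proof
      fix l :: int assume "l \<in> - {0}"
      hence "l = int (Suc (nat l - 1)) \<or> l = - int (Suc (nat (- l) - 1))" by auto
      thus "l \<in> range (\<lambda>n. int (Suc n)) \<union> range (\<lambda>n. - int (Suc n))" by blast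
    qed
  qed auto
  finally have "infsum T (- {0}) = P + N" by (rule infsumI)
  moreover have "(\<lambda>n. v (2 * n) + v (2 * n + 1)) sums V"
  proof -
    have "{n * 2..<n * 2 + 2} = {2 * n, 2 * n + 1}" for n :: nat by auto
    thus ?thesis using sums_group[OF v, of 2] by simp
  qed
  moreover have "(\<lambda>n. v (2 * n) + v (2 * n + 1)) sums (P + N)"
    unfolding pair by (rule sums_add[OF P N])
  ultimately show ?thesis using sums_unique2 by metis
qed

lemma hermitian_neg:
  assumes "hermitian a" shows "a (- int n) = (-1) ^ n * cnj (a (int n)) \<or> n = 0"
proof (cases "n = 0")
  case False
  hence "a (- int n) = (-1) powi (- int n) * cnj (a (int n))" using assms unfolding hermitian_def by (metis add.inverse_inverse neg_equal_0_iff_equal of_nat_0_eq_iff)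
  thus ?thesis by (simp add: power_int_minus flip: power_inverse)
qed simp

lemma mode_double: "mode (2 * n) = Suc n" "mode (2 * n + 1) = Suc n"
  by (simp_all add: mode_def)

lemma summable_coefficients:
  assumes "weighted_summable s (mode_coeffs a)"
  shows "summable (\<lambda>n. norm (a (int (Suc n))) * real (Suc n) powr (- s))"
proof -
  let ?b = "mode_coeffs a"
  define V where "V = (\<lambda>k. \<bar>?b k\<bar> * mode_weight s k)"
  have "summable V" using assms unfolding weighted_summable_def V_def .
  then obtain W where "V sums W" by blast
  from sums_group[OF this, of 2] have "summable (\<lambda>n. sum V {n * 2..<n * 2 + 2})" by (simp add: sums_summable)
  moreover have "{n * 2..<n * 2 + 2} = {2 * n, 2 * n + 1}" for n :: nat by auto
  ultimately have S: "summable (\<lambda>n. V (2 * n) + V (2 * n + 1))" by (simp add: mult.commute)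
  show ?thesis
  proof (rule summable_comparison_test'[OF S, of 0])
    fix n :: nat
    have "norm (a (int (Suc n))) \<le> \<bar>?b (2 * n)\<bar> + \<bar>?b (2 * n + 1)\<bar>"
      using cmod_le[of "a (int (Suc n))"] unfolding mode_coeffs_def mode_double by simp
    hence "norm (a (int (Suc n))) * real (Suc n) powr (- s) \<le> (\<bar>?b (2 * n)\<bar> + \<bar>?b (2 * n + 1)\<bar>) * real (Suc n) powr (4 - s)"
      by (intro mult_mono powr_mono) auto
    thus "norm (norm (a (int (Suc n))) * real (Suc n) powr (- s)) \<le> V (2 * n) + V (2 * n + 1)"
      unfolding V_def mode_weight_def mode_double by (simp add: algebra_simps)
  qed
qed

lemma mode_coeffs_pair:
  "mode_coeffs a (2 * n) * angular s 0 (2 * n) t + mode_coeffs a (2 * n + 1) * angular s 0 (2 * n + 1) t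
   = real (Suc n) powr (- s) * (2 * Re (a (int (Suc n)) * cis (real (Suc n) * t)))"
proof -
  have m: "(2 * n) mod 2 = 0" "(2 * n + 1) mod 2 = (1 :: nat)" by presburger+
  have "cos (y + pi / 2) = - sin y" for y :: real by (simp add: cos_add)
  moreover have "real (Suc n) * t + (real 1 + real 0) * (pi / 2) = real (Suc n) * t + pi / 2"
    "real (Suc n) * t + (real 0 + real 0) * (pi / 2) = real (Suc n) * t" by simp_all
  ultimately have c: "cos (real (Suc n) * t + (real 1 + real 0) * (pi / 2)) = - sin (real (Suc n) * t)"
    "cos (real (Suc n) * t + (real 0 + real 0) * (pi / 2)) = cos (real (Suc n) * t)" by (simp_all only:)
  have e: "even (2 * n)" "\<not> even (2 * n + 1)" by auto
  show ?thesis
    unfolding mode_coeffs_def angular_def mode_double m c if_P[OF e(1)] if_not_P[OF e(2)]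
    by (simp add: algebra_simps del: of_nat_Suc)
qed

lemma add_cnj_eq: "z + cnj z = complex_of_real (2 * Re z)"
  by (simp add: complex_eq_iff)

lemma exp_i_int: "exp (\<i> * of_int (int n) * of_real t) = cis (real n * t)"
  "exp (\<i> * of_int (- int n) * of_real t) = cnj (cis (real n * t))"
  unfolding cis_conv_exp by (simp_all add: exp_cnj mult_ac)

theorem wave_eq_ufield:
  assumes h: "hermitian a" and b: "weighted_summable s (mode_coeffs a)"
  shows "wave s a x = ufield s bessel_J (mode_coeffs a) 0 0 (vector [polar_r x, polar_theta x])"
proof -
  define r where "r = polar_r x"
  define t where "t = polar_theta x"
  define T where "T = (\<lambda>l::int. a l * of_real (\<bar>real_of_int l\<bar> powr (-s)) * exp (\<i> * of_int l * of_real t) * of_real (bessel_J l r))"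
  have Tp: "T (int (Suc n)) = of_real (real (Suc n) powr (-s) * bessel_J (int (Suc n)) r) * (a (int (Suc n)) * cis (real (Suc n) * t))" for n
    unfolding T_def exp_i_int by (simp del: of_nat_Suc add: mult_ac)
  have Tm: "T (- int (Suc n)) = cnj (T (int (Suc n)))" for n
  proof -
    have "a (- int (Suc n)) = (-1) ^ Suc n * cnj (a (int (Suc n)))" using hermitian_neg[OF h, of "Suc n"] by simp
    hence "T (- int (Suc n)) = ((-1) ^ Suc n * (-1) ^ Suc n) * (of_real (real (Suc n) powr (-s) * bessel_J (int (Suc n)) r) * cnj (a (int (Suc n)) * cis (real (Suc n) * t)))"
      unfolding T_def exp_i_int bessel_J_minus_nat by (simp del: of_nat_Suc power_Suc add: mult_ac)
    also have "((-1) ^ Suc n * (-1) ^ Suc n :: complex) = 1" by (simp flip: power_mult_distrib)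
    finally show ?thesis unfolding Tp by simp
  qed
  have nT: "norm (T (int (Suc n))) \<le> norm (a (int (Suc n))) * real (Suc n) powr (- s)" for n
  proof -
    have "norm (T (int (Suc n))) = (norm (a (int (Suc n))) * real (Suc n) powr (- s)) * \<bar>bessel_J (int (Suc n)) r\<bar>"
      unfolding Tp by (simp add: norm_mult abs_mult del: of_nat_Suc)
    also have "\<dots> \<le> (norm (a (int (Suc n))) * real (Suc n) powr (- s)) * 1"
      by (intro mult_left_mono bessel_J_le_1) simp
    finally show ?thesis by simp
  qed
  have sp: "summable (\<lambda>n. norm (T (int (Suc n))))"
    by (rule summable_comparison_test'[OF summable_coefficients[OF b], of 0]) (use nT in \<open>simp del: of_nat_Suc\<close>)
  have sm: "summable (\<lambda>n. norm (T (- int (Suc n))))" unfolding Tm complex_mod_cnj by (rule sp)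
  have v: "(\<lambda>k. complex_of_real (mode_coeffs a k *\<^sub>R mode_fun s bessel_J 0 0 k (vector [r, t]))) sums
      complex_of_real (ufield s bessel_J (mode_coeffs a) 0 0 (vector [r, t]))"
    by (intro sums_of_real ufield_sums[OF cylinder_bessel_J b]) simp
  have "infsum T (- {0}) = complex_of_real (ufield s bessel_J (mode_coeffs a) 0 0 (vector [r, t]))"
  proof (rule infsum_nonzero_int_paired[OF sp sm v])
    fix n
    let ?v = "\<lambda>k. mode_coeffs a k *\<^sub>R mode_fun s bessel_J 0 0 k (vector [r, t])"
    have "?v (2 * n) + ?v (2 * n + 1) = (mode_coeffs a (2 * n) * angular s 0 (2 * n) t + mode_coeffs a (2 * n + 1) * angular s 0 (2 * n + 1) t) * bessel_J (int (Suc n)) r"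
      unfolding mode_fun_def mode_double by (simp add: algebra_simps)
    also have "\<dots> = 2 * Re (T (int (Suc n)))"
      unfolding mode_coeffs_pair Tp by (simp del: of_nat_Suc add: algebra_simps)
    finally show "complex_of_real (?v (2 * n)) + complex_of_real (?v (2 * n + 1)) = T (int (Suc n)) + T (- int (Suc n))"
      unfolding Tm add_cnj_eq by (simp only: of_real_add[symmetric])
  qed
  thus ?thesis unfolding wave_def T_def r_def t_def by simp
qed

theorem wave_density_eq_amplitude:
  assumes h: "hermitian a" and b: "weighted_summable s (mode_coeffs a)"
  shows "wave_density s a t = amplitude s (mode_coeffs a) 0 t / (2 * of_real pi)"
proof -
  define T where "T = (\<lambda>l::int. \<i> powi l * a l * of_real (\<bar>real_of_int l\<bar> powr (-s)) * exp (\<i> * of_int l * of_real t))"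
  have Tp: "T (int (Suc n)) = \<i> ^ Suc n * (of_real (real (Suc n) powr (-s)) * (a (int (Suc n)) * cis (real (Suc n) * t)))" for n
    unfolding T_def exp_i_int power_int_of_nat by (simp del: of_nat_Suc power_Suc add: mult_ac)
  have Tm: "T (- int (Suc n)) = \<i> ^ Suc n * cnj (of_real (real (Suc n) powr (-s)) * (a (int (Suc n)) * cis (real (Suc n) * t)))" for n
  proof -
    have "a (- int (Suc n)) = (-1) ^ Suc n * cnj (a (int (Suc n)))" using hermitian_neg[OF h, of "Suc n"] by simp
    hence "T (- int (Suc n)) = (\<i> powi (- int (Suc n)) * (-1) ^ Suc n) * cnj (of_real (real (Suc n) powr (-s)) * (a (int (Suc n)) * cis (real (Suc n) * t)))"
      unfolding T_def exp_i_int by (simp del: of_nat_Suc power_Suc add: mult_ac)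
    also have "\<i> powi (- int (Suc n)) * (-1) ^ Suc n = \<i> ^ Suc n"
      unfolding power_int_minus power_int_of_nat by (simp add: power_mult_distrib[symmetric] flip: power_inverse)
    finally show ?thesis .
  qed
  have nT: "norm (T (int (Suc n))) \<le> norm (a (int (Suc n))) * real (Suc n) powr (- s)"
    "norm (T (- int (Suc n))) \<le> norm (a (int (Suc n))) * real (Suc n) powr (- s)" for n
    unfolding Tp Tm by (simp_all add: norm_mult norm_power del: of_nat_Suc power_Suc)
  have sp: "summable (\<lambda>n. norm (T (int (Suc n))))"
    by (rule summable_comparison_test'[OF summable_coefficients[OF b], of 0]) (use nT in \<open>simp del: of_nat_Suc\<close>)
  have sm: "summable (\<lambda>n. norm (T (- int (Suc n))))"
    by (rule summable_comparison_test'[OF summable_coefficients[OF b], of 0]) (use nT in \<open>simp del: of_nat_Suc\<close>)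
  have "infsum T (- {0}) = amplitude s (mode_coeffs a) 0 t"
  proof (rule infsum_nonzero_int_paired[OF sp sm amplitude_sums[OF b]])
    fix n
    let ?v = "\<lambda>k. mode_coeffs a k *\<^sub>R (complex_of_real (angular s 0 k t) * \<i> ^ mode k)"
    have "?v (2 * n) + ?v (2 * n + 1) = \<i> ^ Suc n * complex_of_real (mode_coeffs a (2 * n) * angular s 0 (2 * n) t + mode_coeffs a (2 * n + 1) * angular s 0 (2 * n + 1) t)"
      unfolding mode_double by (simp add: scaleR_conv_of_real algebra_simps)
    also have "\<dots> = \<i> ^ Suc n * complex_of_real (2 * Re (of_real (real (Suc n) powr (-s)) * (a (int (Suc n)) * cis (real (Suc n) * t))))"
      unfolding mode_coeffs_pair by (simp del: of_nat_Suc power_Suc add: algebra_simps)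
    finally show "?v (2 * n) + ?v (2 * n + 1) = T (int (Suc n)) + T (- int (Suc n))"
      unfolding Tm Tp distrib_left[symmetric] add_cnj_eq .
  qed simp
  thus ?thesis unfolding wave_density_def T_def by simp
qed

definition polar :: "real ^ 2 \<Rightarrow> real ^ 2" where
  "polar p = vector [p $ 1 * cos (p $ 2), p $ 1 * sin (p $ 2)]"

definition to_complex :: "real ^ 2 \<Rightarrow> complex" where
  "to_complex x = Complex (x $ 1) (x $ 2)"

lemma to_complex_inject: "to_complex x = to_complex y \<longleftrightarrow> x = y"
  by (simp add: to_complex_def vec2_eq_iff)

lemma to_complex_polar: "to_complex (polar p) = rcis (p $ 1) (p $ 2)"
  by (simp add: to_complex_def polar_def complex_eq_iff)

lemma norm_to_complex: "norm (to_complex x) = norm x"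
  unfolding to_complex_def norm_vec_def L2_set_def by (simp add: UNIV_2 complex_norm)

lemma to_complex_polar_coords: "to_complex x = rcis (polar_r x) (polar_theta x)"
  unfolding polar_r_def polar_theta_def norm_to_complex[symmetric] to_complex_def[symmetric]
  by (simp add: rcis_cmod_Arg)

lemma bounded_linear_to_complex: "bounded_linear to_complex"
proof -
  have e: "to_complex = (\<lambda>x. of_real (x $ 1) + \<i> * of_real (x $ 2))"
    by (simp add: fun_eq_iff to_complex_def complex_eq_iff)
  show ?thesis unfolding e
    by (intro bounded_linear_add bounded_linear_const_mult bounded_linear_compose[OF bounded_linear_of_real] bounded_linear_vec_nth)
qed

lemma cis_eqD: "cis a = cis b \<Longrightarrow> \<exists>m::int. a = b + 2 * pi * of_int m"
  using sin_cos_eq_iff[of a b] by (simp add: complex_eq_iff)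

lemma ufield_cis_cong:
  assumes "cis t = cis t'"
  shows "ufield s F b i j (vector [r, t]) = ufield s F b i j (vector [r, t'])"
  using cis_eqD[OF assms] ufield_periodic by metis

lemma rcis_eqD: "rcis r t = rcis r' t' \<Longrightarrow> r > 0 \<Longrightarrow> r' > 0 \<Longrightarrow> r = r' \<and> cis t = cis t'"
proof -
  assume a: "rcis r t = rcis r' t'" "r > 0" "r' > 0"
  have "\<bar>r\<bar> = \<bar>r'\<bar>" using arg_cong[OF a(1), of norm] by simp
  hence "r = r'" using a(2,3) by simp
  thus ?thesis using a by (simp add: rcis_def)
qed

lemma wave_polar:
  assumes h: "hermitian a" and b: "weighted_summable s (mode_coeffs a)" and x: "to_complex x = rcis r t" "r > 0"
  shows "wave s a x = ufield s bessel_J (mode_coeffs a) 0 0 (vector [r, t])"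
proof -
  have e: "rcis (polar_r x) (polar_theta x) = rcis r t" using to_complex_polar_coords[of x] x by simp
  have "norm x = r" using norm_to_complex[of x] x by simp
  hence "polar_r x = r" by (simp add: polar_r_def)
  moreover from this have "cis (polar_theta x) = cis t" using e x(2) by (simp add: rcis_def)
  ultimately show ?thesis unfolding wave_eq_ufield[OF h b] using ufield_cis_cong by metis
qed

lemma has_derivative_nhds_cong:
  assumes "(f has_derivative D) (at x)" "\<forall>\<^sub>F y in nhds x. f y = g y"
  shows "(g has_derivative D) (at x)"
  by (rule has_derivative_transform_eventually[OF assms(1)])
    (use assms(2) eventually_nhds_x_imp_x in \<open>auto simp: eventually_at_filter elim: eventually_mono\<close>)

text \<open>Both directions are the chain rule, for polar coordinates and for a local inverse of them. The inverse at \<open>x\<close>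
  is \<open>y \<mapsto> (\<bar>y\<bar>, t + Im (Ln (y / x)))\<close>, which is smooth near \<open>x\<close> also on the branch cut of \<open>Arg\<close>.\<close>

theorem wave_critical_iff:
  assumes h: "hermitian a" and b: "weighted_summable s (mode_coeffs a)" and x: "to_complex x = rcis r t" "r > 0"
  shows "(GDERIV (wave s a) x :> 0) \<longleftrightarrow> gfield s bessel_J (mode_coeffs a) 0 0 (vector [r, t]) = 0"
proof -
  define U where "U = ufield s bessel_J (mode_coeffs a) 0 0"
  define p where "p = (vector [r, t] :: real ^ 2)"
  define G where "G = gfield s bessel_J (mode_coeffs a) 0 0 p"
  have dU: "(U has_derivative (\<lambda>h. h $ 1 * G $ 1 + h $ 2 * G $ 2)) (at p)"
    using ufield_has_derivative[OF cylinder_bessel_J b, of 0 0 p] unfolding U_def G_def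
    by (simp add: gfield_eq[OF cylinder_bessel_J b])
  have "(wave s a has_derivative (\<lambda>h. 0)) (at x) \<longleftrightarrow> G = 0"
  proof
    assume W: "(wave s a has_derivative (\<lambda>h. 0)) (at x)"
    have px: "polar p = x" using x by (simp add: to_complex_inject[symmetric] to_complex_polar p_def)
    have d: "(\<lambda>q :: real ^ 2. q $ i) differentiable (at p)" for i
      by (intro bounded_linear_imp_differentiable bounded_linear_vec_nth)
    have "(\<lambda>q :: real ^ 2. cos (q $ 2)) differentiable (at p)" "(\<lambda>q :: real ^ 2. sin (q $ 2)) differentiable (at p)"
      using has_derivative_cos[OF bounded_linear_imp_has_derivative[OF bounded_linear_vec_nth]]
        has_derivative_sin[OF bounded_linear_imp_has_derivative[OF bounded_linear_vec_nth]]
      unfolding differentiable_def by blast+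
    with d have "polar differentiable (at p)"
      unfolding polar_def vector2_eq
      by (intro differentiable_add differentiable_scaleR differentiable_mult differentiable_const)
    then obtain D where D: "(polar has_derivative D) (at p)" unfolding differentiable_def by blast
    have "((\<lambda>q. wave s a (polar q)) has_derivative (\<lambda>h. 0)) (at p)"
      using has_derivative_compose[OF D, of "wave s a" "\<lambda>h. 0"] W px by simp
    moreover have "\<forall>\<^sub>F q in nhds p. wave s a (polar q) = U q"
    proof -
      have "open {q :: real ^ 2. q $ 1 > 0}" by (intro open_Collect_less continuous_intros)
      moreover have "p \<in> {q. q $ 1 > 0}" using x by (simp add: p_def)
      ultimately have "\<forall>\<^sub>F q in nhds p. q \<in> {q. q $ 1 > 0}" by (rule eventually_nhds_in_open)
      thus ?thesis
      proof eventually_elim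
        case (elim q)
        have "q = vector [q $ 1, q $ 2]" by (simp add: vec2_eq_iff)
        thus ?case using wave_polar[OF h b to_complex_polar[of q]] elim unfolding U_def by simp
      qed
    qed
    ultimately have "(U has_derivative (\<lambda>h. 0)) (at p)"
      by (rule has_derivative_nhds_cong)
    from has_derivative_unique[OF this dU] have "\<And>h :: real ^ 2. h $ 1 * G $ 1 + h $ 2 * G $ 2 = 0" by metis
    from this[of "vector [1, 0]"] this[of "vector [0, 1]"] show "G = 0" by (simp add: vec2_eq_iff)
  next
    assume G: "G = 0"
    define q where "q = (\<lambda>y. vector [norm y, t + Im (Ln (to_complex y / to_complex x))] :: real ^ 2)"
    have x0: "x \<noteq> 0" "to_complex x \<noteq> 0" using x norm_to_complex[of x] by auto
    have qx: "q x = p" using x norm_to_complex[of x] by (simp add: q_def p_def)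
    have "q differentiable (at x)"
    proof -
      have n: "(\<lambda>y :: real ^ 2. norm y) differentiable (at x)" using x0(1) by (rule differentiable_norm_at)
      have "(Ln has_field_derivative inverse (to_complex x / to_complex x)) (at (to_complex x / to_complex x))"
        by (rule has_field_derivative_Ln) (use x0 in simp)
      hence L: "(Ln has_derivative (\<lambda>z. inverse (to_complex x / to_complex x) * z)) (at (to_complex x / to_complex x))"
        unfolding has_field_derivative_def .
      have "((\<lambda>y. to_complex y / to_complex x) has_derivative (\<lambda>h. to_complex h / to_complex x)) (at x)"
        by (intro bounded_linear_imp_has_derivative bounded_linear_compose[OF bounded_linear_divide bounded_linear_to_complex])
      from bounded_linear.has_derivative[OF bounded_linear_Im has_derivative_compose[OF this L]]
      have i: "(\<lambda>y. Im (Ln (to_complex y / to_complex x))) differentiable (at x)" unfolding differentiable_def by blast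
      show ?thesis unfolding q_def vector2_eq using n i
        by (intro differentiable_add differentiable_scaleR differentiable_const) auto
    qed
    then obtain D where D: "(q has_derivative D) (at x)" unfolding differentiable_def by blast
    have "(U has_derivative (\<lambda>h. 0)) (at (q x))" using dU G qx by simp
    from has_derivative_compose[OF D this]
    have "((\<lambda>y. U (q y)) has_derivative (\<lambda>h. 0)) (at x)" .
    moreover have "\<forall>\<^sub>F y in nhds x. U (q y) = wave s a y"
    proof -
      have "\<forall>\<^sub>F y in nhds x. y \<in> - {0}" using x0 by (intro eventually_nhds_in_open) auto
      thus ?thesis
      proof eventually_elim
        case (elim y)
        have y0: "to_complex y \<noteq> 0" using elim norm_to_complex[of y] by auto
        define z where "z = to_complex y / to_complex x"
        have z0: "z \<noteq> 0" using y0 x0 by (simp add: z_def)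
        have nx: "norm (to_complex x) = r" using x by simp
        have "z = rcis (norm z) (Im (Ln z))" using rcis_cmod_Arg[of z] Arg_eq_Im_Ln[OF z0] by simp
        hence "to_complex y = rcis (norm z) (Im (Ln z)) * rcis r t" using x0 x(1) by (metis nonzero_eq_divide_eq z_def)
        also have "\<dots> = rcis (norm z * r) (t + Im (Ln z))" by (simp add: rcis_mult add.commute)
        also have "norm z * r = norm y" unfolding z_def norm_divide nx norm_to_complex[of y] using x(2) by simp
        finally have "to_complex y = rcis (norm y) (t + Im (Ln z))" .
        from wave_polar[OF h b this] elim show ?case unfolding q_def U_def z_def by simp
      qed
    qed
    ultimately show "(wave s a has_derivative (\<lambda>h. 0)) (at x)"
      by (rule has_derivative_nhds_cong)
  qed
  thus ?thesis unfolding gderiv_def G_def p_def by simp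
qed

section \<open>Zeros of the limiting gradient\<close>

lemma cell_representative: "\<exists>t\<in>{t0..<t0 + 2 * pi}. cis t = cis t'"
proof -
  define m where "m = \<lfloor>(t' - t0) / (2 * pi)\<rfloor>"
  have "of_int m \<le> (t' - t0) / (2 * pi)" "(t' - t0) / (2 * pi) < of_int m + 1" unfolding m_def by linarith+
  hence "2 * pi * of_int m \<le> t' - t0" "t' - t0 < 2 * pi * of_int m + 2 * pi" by (simp_all add: field_simps)
  moreover have "cis (t' - 2 * pi * of_int m) = cis t'"
    using cis_mult[of t' "2 * pi * of_int (- m)"] cis_multiple_2pi[of "of_int (-m)"] by simp
  ultimately show ?thesis by (intro bexI[of _ "t' - 2 * pi * of_int m"]) auto
qed

lemma cell_inj:
  assumes "t \<in> {t0..<t0 + 2 * pi}" "t' \<in> {t0..<t0 + 2 * pi}" "cis t = cis t'"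
  shows "t = t'"
proof -
  obtain m :: int where m: "t = t' + 2 * pi * of_int m" using cis_eqD[OF assms(3)] by blast
  have "2 * pi * of_int m < 2 * pi * 1" "2 * pi * (-1) < 2 * pi * of_int m" using assms(1,2) unfolding m atLeastLessThan_iff by linarith+
  hence "of_int m < (1 :: real)" "-1 < (of_int m :: real)" by (simp_all only: mult_less_cancel_left_pos pi_gt_zero zero_less_mult_iff zero_less_numeral simp_thms)
  hence "m = 0" by linarith
  thus ?thesis using m by simp
qed

text \<open>A half-open interval of length \<open>2 \<pi>\<close> is a fundamental domain of the circle, wherever it starts.\<close>

lemma bij_betw_cell:
  assumes "\<And>t t'. cis t = cis t' \<Longrightarrow> P t = P t'"
  shows "bij_betw (\<lambda>t. SOME t'. t' \<in> {t1..<t1 + 2 * pi} \<and> cis t' = cis t) {t \<in> {t0..<t0 + 2 * pi}. P t} {t \<in> {t1..<t1 + 2 * pi}. P t}"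
    (is "bij_betw ?f _ _")
proof -
  have f: "?f t \<in> {t1..<t1 + 2 * pi} \<and> cis (?f t) = cis t" for t
    by (rule someI_ex) (use cell_representative[of t1 t] in blast)
  show ?thesis unfolding bij_betw_def
  proof
    show "inj_on ?f {t \<in> {t0..<t0 + 2 * pi}. P t}"
    proof (rule inj_onI)
      fix t t' assume "t \<in> {t \<in> {t0..<t0 + 2 * pi}. P t}" "t' \<in> {t \<in> {t0..<t0 + 2 * pi}. P t}" "?f t = ?f t'"
      moreover from this have "cis t = cis t'" using f by metis
      ultimately show "t = t'" using cell_inj[of t t0 t'] by simp
    qed
    show "?f ` {t \<in> {t0..<t0 + 2 * pi}. P t} = {t \<in> {t1..<t1 + 2 * pi}. P t}"
    proof (intro equalityI subsetI)
      fix u assume "u \<in> ?f ` {t \<in> {t0..<t0 + 2 * pi}. P t}"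
      then obtain t where "u = ?f t" "P t" by blast
      thus "u \<in> {t \<in> {t1..<t1 + 2 * pi}. P t}" using f[of t] assms by blast
    next
      fix u assume u: "u \<in> {t \<in> {t1..<t1 + 2 * pi}. P t}"
      obtain t where t: "t \<in> {t0..<t0 + 2 * pi}" "cis t = cis u" using cell_representative by blast
      have "?f t = u" using f[of t] t(2) u by (intro cell_inj[of _ t1]) auto
      moreover have "P t" using assms[OF t(2)] u by simp
      ultimately show "u \<in> ?f ` {t \<in> {t0..<t0 + 2 * pi}. P t}" using t(1) by (intro image_eqI[of u ?f t]) auto
    qed
  qed
qed

lemma amplitude_cis_cong: "cis t = cis t' \<Longrightarrow> amplitude s b j t = amplitude s b j t'"
  using cis_eqD[of t t'] angular_periodic unfolding amplitude_def wseries_def by auto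

definition amplitude_crit :: "real \<Rightarrow> (nat \<Rightarrow> real) \<Rightarrow> real \<Rightarrow> bool" where
  "amplitude_crit s b t \<longleftrightarrow> amplitude s b 0 t \<bullet> amplitude s b 1 t = 0"

lemma amplitude_crit_cong: "cis t = cis t' \<Longrightarrow> amplitude_crit s b t = amplitude_crit s b t'"
  unfolding amplitude_crit_def using amplitude_cis_cong by metis

text \<open>The rotating vector \<open>w exp (- \<i> r)\<close> meets the real axis twice per turn.\<close>

lemma card_two_angles:
  assumes "w \<noteq> 0"
  shows "card {r \<in> {r0..<r0 + 2 * pi}. Im (w * cis (- r)) = 0} = 2"
proof -
  define \<alpha> where "\<alpha> = Arg w"
  have w: "w = rcis (cmod w) \<alpha>" by (simp add: \<alpha>_def rcis_cmod_Arg)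
  have Im: "Im (w * cis (- r)) = cmod w * sin (\<alpha> - r)" for r
  proof -
    have "w * cis (- r) = rcis (cmod w) \<alpha> * cis (- r)" using w by simp
    also have "\<dots> = rcis (cmod w) (\<alpha> - r)" by (simp add: rcis_def cis_mult mult.assoc)
    finally show ?thesis by simp
  qed
  define k where "k = \<lceil>(r0 - \<alpha>) / pi\<rceil>"
  have "(r0 - \<alpha>) / pi \<le> of_int k" "of_int k < (r0 - \<alpha>) / pi + 1" unfolding k_def by linarith+
  hence k: "r0 \<le> \<alpha> + of_int k * pi" "\<alpha> + of_int k * pi < r0 + pi" by (simp_all add: field_simps)
  have "{r \<in> {r0..<r0 + 2 * pi}. Im (w * cis (- r)) = 0} = {\<alpha> + of_int k * pi, \<alpha> + of_int k * pi + pi}"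
  proof (intro equalityI subsetI)
    fix r assume r: "r \<in> {r \<in> {r0..<r0 + 2 * pi}. Im (w * cis (- r)) = 0}"
    hence "sin (r - \<alpha>) = 0" using Im[of r] assms sin_minus[of "\<alpha> - r"] by simp
    then obtain i :: int where i: "r = \<alpha> + of_int i * pi" unfolding sin_zero_iff_int2 by (auto simp: algebra_simps)
    have "of_int (k - 1) * pi < of_int i * pi" "of_int i * pi < of_int (k + 2) * pi" using r k i by (auto simp: algebra_simps)
    hence "real_of_int (k - 1) < of_int i" "real_of_int i < of_int (k + 2)" using pi_gt_zero by (simp_all only: mult_less_cancel_right_pos)
    hence "i = k \<or> i = k + 1" by linarith
    thus "r \<in> {\<alpha> + of_int k * pi, \<alpha> + of_int k * pi + pi}" using i by (auto simp: algebra_simps)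
  next
    fix r assume "r \<in> {\<alpha> + of_int k * pi, \<alpha> + of_int k * pi + pi}"
    then obtain i :: int where i: "r = \<alpha> + of_int i * pi" "i = k \<or> i = k + 1" by (auto simp: algebra_simps intro: that[of k] that[of "k+1"])
    have "sin (\<alpha> - r) = 0" unfolding i(1) sin_zero_iff_int2 by (intro exI[of _ "- i"]) simp
    moreover have "r0 \<le> r" "r < r0 + 2 * pi" using i k pi_gt_zero by (auto simp: algebra_simps)
    ultimately show "r \<in> {r \<in> {r0..<r0 + 2 * pi}. Im (w * cis (- r)) = 0}" unfolding Im by simp
  qed
  thus ?thesis by simp
qed

text \<open>If \<open>g exp (- \<i> r) F\<close> is a real number \<open>q \<noteq> 0\<close>, then the angular derivative
  \<open>Re (g exp (- \<i> r) F')\<close> equals \<open>q Re (F' / F) = q (F \<bullet> F') / \<bar>F\<bar>\<^sup>2\<close>.\<close>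

lemma limit_zero_iff:
  assumes b: "weighted_summable s b" and g: "g \<noteq> 0" and nz: "amplitude s b 0 t \<noteq> 0"
  shows "gfield s (wave_limit g) b 0 0 (vector [r, t]) = 0 \<longleftrightarrow> amplitude_crit s b t \<and> Im (g * amplitude s b 0 t * cis (- r)) = 0"
proof -
  define w where "w = g * cis (- r)"
  let ?F = "amplitude s b 0 t" and ?F' = "amplitude s b 1 t"
  have G: "gfield s (wave_limit g) b 0 0 (vector [r, t]) = vector [Im (w * ?F), Re (w * ?F')]"
    unfolding gfield_eq[OF cylinder_wave_limit b le0] w_def
    using ufield_wave_limit[OF b, of 0 g "Suc 0" r t] ufield_wave_limit[OF b, of "Suc 0" g 0 r t]
    by (simp add: vec2_eq_iff algebra_simps)
  have "Re (w * ?F') = 0 \<longleftrightarrow> ?F \<bullet> ?F' = 0" if im: "Im (w * ?F) = 0"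
  proof -
    define q where "q = Re (w * ?F)"
    have q: "w * ?F = of_real q" using im by (simp add: q_def complex_eq_iff)
    have "w * ?F \<noteq> 0" using g nz by (simp add: w_def)
    hence q0: "q \<noteq> 0" using q by auto
    have "of_real ((cmod ?F)^2) * (w * ?F') = (w * ?F) * (?F' * cnj ?F)"
      unfolding complex_norm_square by (simp add: mult_ac)
    also have "\<dots> = of_real q * (?F' * cnj ?F)" unfolding q ..
    finally have "Re (of_real ((cmod ?F)^2) * (w * ?F')) = Re (of_real q * (?F' * cnj ?F))" by (rule arg_cong)
    hence "(cmod ?F)^2 * Re (w * ?F') = q * Re (?F' * cnj ?F)" by (simp only: Re_complex_of_real times_complex.sel Im_complex_of_real mult_zero_left diff_zero)
    moreover have "Re (?F' * cnj ?F) = ?F \<bullet> ?F'" by (simp add: inner_complex_def mult_ac)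
    ultimately have "(cmod ?F)^2 * Re (w * ?F') = q * (?F \<bullet> ?F')" by simp
    thus ?thesis using q0 nz by (metis mult_eq_0_iff norm_eq_zero power_eq_0_iff)
  qed
  moreover have e: "g * ?F * cis (- r) = w * ?F" by (simp add: w_def mult_ac)
  moreover have "gfield s (wave_limit g) b 0 0 (vector [r, t]) = 0 \<longleftrightarrow> Im (w * ?F) = 0 \<and> Re (w * ?F') = 0"
    unfolding G by (simp only: vec2_eq_iff vector_2 zero_index)
  ultimately show ?thesis unfolding amplitude_crit_def e by blast
qed

lemma vector2_cases: "(x :: real ^ 2) = vector [x $ 1, x $ 2]"
  by (simp add: vec2_eq_iff)

lemma card_limit_zeros_cell:
  assumes gen: "generic s g b" and g: "g \<noteq> 0" and fin: "finite {t \<in> {t0..<t0 + 2 * pi}. amplitude_crit s b t}"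
  shows "card {x :: real ^ 2. x $ 1 \<in> {r0..<r0 + 2 * pi} \<and> x $ 2 \<in> {t0..<t0 + 2 * pi} \<and> gfield s (wave_limit g) b 0 0 x = 0}
    = 2 * card {t \<in> {t0..<t0 + 2 * pi}. amplitude_crit s b t}"
proof -
  have b: "weighted_summable s b" and nz: "\<And>t. amplitude s b 0 t \<noteq> 0" using gen unfolding generic_def by auto
  define C where "C = {t \<in> {t0..<t0 + 2 * pi}. amplitude_crit s b t}"
  define A where "A = (\<lambda>t. {r \<in> {r0..<r0 + 2 * pi}. Im (g * amplitude s b 0 t * cis (- r)) = 0})"
  have cA: "card (A t) = 2" for t unfolding A_def by (rule card_two_angles) (use g nz in simp)
  have "bij_betw (\<lambda>(t, r). vector [r, t] :: real ^ 2) (Sigma C A)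
    {x :: real ^ 2. x $ 1 \<in> {r0..<r0 + 2 * pi} \<and> x $ 2 \<in> {t0..<t0 + 2 * pi} \<and> gfield s (wave_limit g) b 0 0 x = 0}"
    unfolding bij_betw_def
  proof
    show "inj_on (\<lambda>(t, r). vector [r, t] :: real ^ 2) (Sigma C A)"
      by (auto simp: inj_on_def vec2_eq_iff)
    show "(\<lambda>(t, r). vector [r, t] :: real ^ 2) ` Sigma C A =
      {x :: real ^ 2. x $ 1 \<in> {r0..<r0 + 2 * pi} \<and> x $ 2 \<in> {t0..<t0 + 2 * pi} \<and> gfield s (wave_limit g) b 0 0 x = 0}"
    proof (intro equalityI subsetI)
      fix x assume "x \<in> (\<lambda>(t, r). vector [r, t] :: real ^ 2) ` Sigma C A"
      then obtain t r where "x = vector [r, t]" "t \<in> C" "r \<in> A t" by auto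
      thus "x \<in> {x :: real ^ 2. x $ 1 \<in> {r0..<r0 + 2 * pi} \<and> x $ 2 \<in> {t0..<t0 + 2 * pi} \<and> gfield s (wave_limit g) b 0 0 x = 0}"
        unfolding C_def A_def using limit_zero_iff[OF b g nz, of r t] by simp
    next
      fix x :: "real ^ 2" assume "x \<in> {x :: real ^ 2. x $ 1 \<in> {r0..<r0 + 2 * pi} \<and> x $ 2 \<in> {t0..<t0 + 2 * pi} \<and> gfield s (wave_limit g) b 0 0 x = 0}"
      hence "x $ 2 \<in> C" "x $ 1 \<in> A (x $ 2)"
        unfolding C_def A_def using limit_zero_iff[OF b g nz, of "x $ 1" "x $ 2"] vector2_cases[of x] by auto
      thus "x \<in> (\<lambda>(t, r). vector [r, t] :: real ^ 2) ` Sigma C A"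
        using vector2_cases[of x] by (intro image_eqI[of _ _ "(x $ 2, x $ 1)"]) auto
    qed
  qed
  from bij_betw_same_card[OF this] have "card {x :: real ^ 2. x $ 1 \<in> {r0..<r0 + 2 * pi} \<and> x $ 2 \<in> {t0..<t0 + 2 * pi} \<and> gfield s (wave_limit g) b 0 0 x = 0}
     = card (Sigma C A)" by simp
  also have "\<dots> = (\<Sum>t\<in>C. card (A t))"
    by (rule card_SigmaI) (use fin cA in \<open>auto simp: C_def intro: card_ge_0_finite\<close>)
  also have "\<dots> = 2 * card C" by (simp add: cA)
  finally show ?thesis unfolding C_def .
qed

lemma gfield_asymptotic:
  assumes gl: "\<And>l. ((\<lambda>r. scaled_bessel l r - Re (g * \<i> powi l * cis (- r))) \<longlongrightarrow> 0) at_top"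
    and b: "weighted_summable s b" and ij: "i \<le> 1" "j \<le> 1" and e: "e > 0"
  shows "\<forall>\<^sub>F r in at_top. \<forall>t. norm (sqrt r *\<^sub>R gfield s bessel_J b i j (vector [r, t]) - gfield s (wave_limit g) b i j (vector [r, t])) \<le> e"
proof -
  have j3: "j \<le> 3" using ij by simp
  have "\<forall>\<^sub>F r in at_top. \<forall>t. \<bar>sqrt r * ufield s bessel_J b (Suc i) j (vector [r, t]) - ufield s (wave_limit g) b (Suc i) j (vector [r, t])\<bar> \<le> e / 2"
    by (rule ufield_asymptotic[OF gl b]) (use ij e in auto)
  moreover have "\<forall>\<^sub>F r in at_top. \<forall>t. \<bar>sqrt r * ufield s bessel_J b i (Suc j) (vector [r, t]) - ufield s (wave_limit g) b i (Suc j) (vector [r, t])\<bar> \<le> e / 2"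
    by (rule ufield_asymptotic[OF gl b]) (use ij e in auto)
  ultimately show ?thesis
  proof eventually_elim
    case (elim r)
    show ?case
    proof
      fix t
      let ?x = "vector [r, t] :: real ^ 2"
      have eq: "sqrt r *\<^sub>R gfield s bessel_J b i j ?x - gfield s (wave_limit g) b i j ?x =
        vector [sqrt r * ufield s bessel_J b (Suc i) j ?x - ufield s (wave_limit g) b (Suc i) j ?x,
                sqrt r * ufield s bessel_J b i (Suc j) ?x - ufield s (wave_limit g) b i (Suc j) ?x]"
        unfolding gfield_eq[OF cylinder_bessel_J b j3] gfield_eq[OF cylinder_wave_limit b j3] by (simp add: vec2_eq_iff)
      show "norm (sqrt r *\<^sub>R gfield s bessel_J b i j ?x - gfield s (wave_limit g) b i j ?x) \<le> e"
        using order_trans[OF norm_vector2_le add_mono[OF elim(1)[THEN spec, of t] elim(2)[THEN spec, of t]]]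
        unfolding eq by (simp only: field_sum_of_halves)
    qed
  qed
qed

text \<open>Rescaling by \<open>sqrt r\<close> does not move zeros, but it changes the radial derivative; the additional term is
  \<open>1 / (2 r)\<close> times a bounded quantity.\<close>

lemma rescaled_gradient_close:
  assumes gl: "\<And>l. ((\<lambda>r. scaled_bessel l r - Re (g * \<i> powi l * cis (- r))) \<longlongrightarrow> 0) at_top"
    and b: "weighted_summable s b" and e: "e > 0"
  shows "\<exists>R0>0. \<forall>r\<ge>R0. \<forall>t.
     norm (sqrt r *\<^sub>R gfield s bessel_J b 0 0 (vector [r, t]) - gfield s (wave_limit g) b 0 0 (vector [r, t])) \<le> e \<and>
     norm ((1 / (2 * sqrt r)) *\<^sub>R gfield s bessel_J b 0 0 (vector [r, t]) + sqrt r *\<^sub>R gfield s bessel_J b 1 0 (vector [r, t]) - gfield s (wave_limit g) b 1 0 (vector [r, t])) \<le> e \<and>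
     norm (sqrt r *\<^sub>R gfield s bessel_J b 0 1 (vector [r, t]) - gfield s (wave_limit g) b 0 1 (vector [r, t])) \<le> e"
proof -
  define M where "M = (\<Sum>k. \<bar>b k\<bar> * (4 * norm g * mode_weight s k))"
  have GL: "norm (gfield s (wave_limit g) b 0 0 x) \<le> M" for x
    unfolding M_def gfield_def
    by (rule wseries_bound[where \<kappa> = "\<lambda>k. 4 * norm g * mode_weight s k" and A = "mode_grad s (wave_limit g) 0 0", OF weighted_summable_mult[OF b] mode_grad_bound[OF cylinder_wave_limit]]) simp
  have M0: "0 \<le> M" using GL[of 0] norm_ge_zero order_trans by blast
  have "\<forall>\<^sub>F r in at_top. (M + 1) / (2 * r) < e / 2"
    using e by real_asymp
  moreover have "\<forall>\<^sub>F r in at_top. \<forall>t. norm (sqrt r *\<^sub>R gfield s bessel_J b 0 0 (vector [r, t]) - gfield s (wave_limit g) b 0 0 (vector [r, t])) \<le> min e 1"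
    by (rule gfield_asymptotic[OF gl b]) (use e in auto)
  moreover have "\<forall>\<^sub>F r in at_top. \<forall>t. norm (sqrt r *\<^sub>R gfield s bessel_J b 1 0 (vector [r, t]) - gfield s (wave_limit g) b 1 0 (vector [r, t])) \<le> e / 2"
    by (rule gfield_asymptotic[OF gl b]) (use e in auto)
  moreover have "\<forall>\<^sub>F r in at_top. \<forall>t. norm (sqrt r *\<^sub>R gfield s bessel_J b 0 1 (vector [r, t]) - gfield s (wave_limit g) b 0 1 (vector [r, t])) \<le> e"
    by (rule gfield_asymptotic[OF gl b]) (use e in auto)
  ultimately have "\<forall>\<^sub>F r in at_top. \<forall>t.
     norm (sqrt r *\<^sub>R gfield s bessel_J b 0 0 (vector [r, t]) - gfield s (wave_limit g) b 0 0 (vector [r, t])) \<le> e \<and>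
     norm ((1 / (2 * sqrt r)) *\<^sub>R gfield s bessel_J b 0 0 (vector [r, t]) + sqrt r *\<^sub>R gfield s bessel_J b 1 0 (vector [r, t]) - gfield s (wave_limit g) b 1 0 (vector [r, t])) \<le> e \<and>
     norm (sqrt r *\<^sub>R gfield s bessel_J b 0 1 (vector [r, t]) - gfield s (wave_limit g) b 0 1 (vector [r, t])) \<le> e"
    using eventually_gt_at_top[of 0]
  proof eventually_elim
    case (elim r)
    show ?case
    proof (intro allI conjI)
      fix t
      let ?x = "vector [r, t] :: real ^ 2"
      show "norm (sqrt r *\<^sub>R gfield s bessel_J b 0 0 ?x - gfield s (wave_limit g) b 0 0 ?x) \<le> e"
        "norm (sqrt r *\<^sub>R gfield s bessel_J b 0 1 ?x - gfield s (wave_limit g) b 0 1 ?x) \<le> e"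
        using elim by auto
      have "norm (sqrt r *\<^sub>R gfield s bessel_J b 0 0 ?x) \<le> M + 1"
      proof -
        have "norm (sqrt r *\<^sub>R gfield s bessel_J b 0 0 ?x - gfield s (wave_limit g) b 0 0 ?x) \<le> 1" using elim(2) by simp
        from order_trans[OF norm_triangle_ineq[of "sqrt r *\<^sub>R gfield s bessel_J b 0 0 ?x - gfield s (wave_limit g) b 0 0 ?x" "gfield s (wave_limit g) b 0 0 ?x"] add_mono[OF this GL]]
        show ?thesis by simp
      qed
      hence le: "(1 / (2 * r)) * norm (sqrt r *\<^sub>R gfield s bessel_J b 0 0 ?x) \<le> (1 / (2 * r)) * (M + 1)"
        using elim(5) by (intro mult_left_mono) auto
      have q: "1 / (2 * sqrt r) = (1 / (2 * r)) * sqrt r"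
      proof -
        have "sqrt r * sqrt r = r" "sqrt r > 0" using elim(5) by simp_all
        thus ?thesis by (simp add: field_simps)
      qed
      have "norm ((1 / (2 * sqrt r)) *\<^sub>R gfield s bessel_J b 0 0 ?x) = (1 / (2 * r)) * norm (sqrt r *\<^sub>R gfield s bessel_J b 0 0 ?x)"
        unfolding q norm_scaleR abs_mult using elim(5) by simp
      also note le
      also have "(1 / (2 * r)) * (M + 1) = (M + 1) / (2 * r)" by simp
      also have "\<dots> < e / 2" by (rule elim(1))
      finally have 1: "norm ((1 / (2 * sqrt r)) *\<^sub>R gfield s bessel_J b 0 0 ?x) \<le> e / 2" by simp
      have 2: "norm (sqrt r *\<^sub>R gfield s bessel_J b 1 0 ?x - gfield s (wave_limit g) b 1 0 ?x) \<le> e / 2" using elim(3) by simp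
      from order_trans[OF norm_triangle_ineq add_mono[OF 1 2]]
      show "norm ((1 / (2 * sqrt r)) *\<^sub>R gfield s bessel_J b 0 0 ?x + sqrt r *\<^sub>R gfield s bessel_J b 1 0 ?x - gfield s (wave_limit g) b 1 0 ?x) \<le> e"
        by (simp add: add_diff_eq)
    qed
  qed
  then obtain N where N: "\<And>r. r \<ge> N \<Longrightarrow> \<forall>t.
     norm (sqrt r *\<^sub>R gfield s bessel_J b 0 0 (vector [r, t]) - gfield s (wave_limit g) b 0 0 (vector [r, t])) \<le> e \<and>
     norm ((1 / (2 * sqrt r)) *\<^sub>R gfield s bessel_J b 0 0 (vector [r, t]) + sqrt r *\<^sub>R gfield s bessel_J b 1 0 (vector [r, t]) - gfield s (wave_limit g) b 1 0 (vector [r, t])) \<le> e \<and>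
     norm (sqrt r *\<^sub>R gfield s bessel_J b 0 1 (vector [r, t]) - gfield s (wave_limit g) b 0 1 (vector [r, t])) \<le> e"
    unfolding eventually_at_top_linorder by blast
  show ?thesis by (rule exI[of _ "max N 1"]) (use N in auto)
qed

section \<open>Zeros of the gradient in polar coordinates\<close>

lemma vector2_add: "x + vector [c, d] = (vector [x $ 1 + c, x $ 2 + d] :: real ^ 2)"
  by (simp add: vec2_eq_iff)

lemma rescaled_has_derivative:
  assumes b: "weighted_summable s b" and r: "x $ 1 + c > 0"
  shows "((\<lambda>x. sqrt (x $ 1 + c) *\<^sub>R gfield s bessel_J b 0 0 (x + vector [c, 0])) has_derivative
    (\<lambda>h. h $ 1 *\<^sub>R ((1 / (2 * sqrt (x $ 1 + c))) *\<^sub>R gfield s bessel_J b 0 0 (x + vector [c, 0]) + sqrt (x $ 1 + c) *\<^sub>R gfield s bessel_J b 1 0 (x + vector [c, 0]))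
       + h $ 2 *\<^sub>R (sqrt (x $ 1 + c) *\<^sub>R gfield s bessel_J b 0 1 (x + vector [c, 0])))) (at x)"
proof -
  have "((\<lambda>x :: real ^ 2. x $ 1 + c) has_derivative (\<lambda>h. h $ 1)) (at x)"
    using has_derivative_add[OF bounded_linear_imp_has_derivative[OF bounded_linear_vec_nth] has_derivative_const] by simp
  moreover have "(sqrt has_derivative (\<lambda>h. (inverse (sqrt (x $ 1 + c)) / 2) * h)) (at (x $ 1 + c))"
    using DERIV_real_sqrt[OF r] unfolding has_field_derivative_def .
  ultimately have 1: "((\<lambda>x. sqrt (x $ 1 + c)) has_derivative (\<lambda>h. (inverse (sqrt (x $ 1 + c)) / 2) * h $ 1)) (at x)"
    by (rule has_derivative_compose)
  have "((\<lambda>x :: real ^ 2. x + vector [c, 0]) has_derivative (\<lambda>h. h)) (at x)"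
    using has_derivative_add[OF has_derivative_ident has_derivative_const] by simp
  from has_derivative_compose[OF this gfield_has_derivative[OF cylinder_bessel_J b, of 0 0 "x + vector [c, 0]"]]
  have 2: "((\<lambda>x. gfield s bessel_J b 0 0 (x + vector [c, 0])) has_derivative
    (\<lambda>h. h $ 1 *\<^sub>R gfield s bessel_J b 1 0 (x + vector [c, 0]) + h $ 2 *\<^sub>R gfield s bessel_J b 0 1 (x + vector [c, 0]))) (at x)"
    by simp
  show ?thesis
    by (rule has_derivative_eq_rhs[OF has_derivative_scaleR[OF 1 2]]) (simp add: fun_eq_iff scaleR_add_right inverse_eq_divide mult.commute)
qed

lemma gfield_limit_shift:
  "gfield s (wave_limit g) b i j (x + vector [2 * pi * real m, 0]) = gfield s (wave_limit g) b i j x"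
  using gfield_wave_limit_periodic[of s g b i j "x $ 1" m "x $ 2"] vector2_cases[of x] by (simp add: vector2_add)

lemma finite_bessel_zeros:
  assumes gen: "generic s g b"
  shows "finite {x. 0 < x $ 1 \<and> x $ 1 < R \<and> x $ 2 \<in> {t0..<t0 + 2 * pi} \<and> gfield s bessel_J b 0 0 x = 0}"
proof (rule finite_subset)
  have b: "weighted_summable s b" using gen by (simp add: generic_def)
  show "finite {x \<in> cbox (vector [0, t0]) (vector [R, t0 + 2 * pi]). gfield s bessel_J b 0 0 x = 0}"
  proof (rule finite_nondegenerate_zeros)
    show "has_partials (gfield s bessel_J b 0 0) (gfield s bessel_J b 1 0 x) (gfield s bessel_J b 0 1 x) x" for x
      using gfield_has_derivative[OF cylinder_bessel_J b, of 0 0 x] by simp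
    show "continuous_on UNIV (gfield s bessel_J b 1 0)" "continuous_on UNIV (gfield s bessel_J b 0 1)"
      by (rule gfield_continuous[OF cylinder_bessel_J b]; simp)+
    show "wedge (gfield s bessel_J b 1 0 z) (gfield s bessel_J b 0 1 z) \<noteq> 0" if "gfield s bessel_J b 0 0 z = 0" for z
      by (rule generic_bessel_nondegenerate[OF gen that])
  qed (rule compact_cbox)
  show "{x. 0 < x $ 1 \<and> x $ 1 < R \<and> x $ 2 \<in> {t0..<t0 + 2 * pi} \<and> gfield s bessel_J b 0 0 x = 0}
    \<subseteq> {x \<in> cbox (vector [0, t0]) (vector [R, t0 + 2 * pi]). gfield s bessel_J b 0 0 x = 0}"
    by (auto simp: mem_box_cart forall_2)
qed

text \<open>The corner \<open>(r0, t0)\<close> of the period cell is chosen such that no zero of the limiting gradient lies on the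
  boundary of the cell; almost every corner will do as there are finitely many zeros. Then \<open>zero_count_stable\<close> applies to the gradient on
  the cell shifted outwards by \<open>2 \<pi> m\<close>, for all large \<open>m\<close>.\<close>

theorem bessel_zero_count:
  assumes gen: "generic s g b" and g: "g \<noteq> 0"
    and gl: "\<And>l. ((\<lambda>r. scaled_bessel l r - Re (g * \<i> powi l * cis (- r))) \<longlongrightarrow> 0) at_top"
  shows "finite {t \<in> {0..<2 * pi}. amplitude_crit s b t} \<and>
    (\<exists>t0. ((\<lambda>R. real (card {x. 0 < x $ 1 \<and> x $ 1 < R \<and> x $ 2 \<in> {t0..<t0 + 2 * pi} \<and> gfield s bessel_J b 0 0 x = 0}) / R)
      \<longlongrightarrow> real (card {t \<in> {0..<2 * pi}. amplitude_crit s b t}) / pi) at_top)"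
proof -
  define GJ where "GJ = gfield s bessel_J b"
  define GL where "GL = gfield s (wave_limit g) b"
  have b: "weighted_summable s b" and nz: "\<And>t. amplitude s b 0 t \<noteq> 0"
    and nd: "\<And>x. GL 0 0 x = 0 \<Longrightarrow> wedge (GL 1 0 x) (GL 0 1 x) \<noteq> 0"
    using gen unfolding generic_def GL_def by auto
  have dL: "has_partials (GL 0 0) (GL 1 0 x) (GL 0 1 x) x" for x
    using gfield_has_derivative[OF cylinder_wave_limit b, of 0 g 0 x] unfolding GL_def by simp
  have cL: "continuous_on UNIV (GL 1 0)" "continuous_on UNIV (GL 0 1)"
    unfolding GL_def by (rule gfield_continuous[OF cylinder_wave_limit b]; simp)+
  \<comment> \<open>As \<open>1 + 2 \<pi> < 10\<close>, the box contains every period cell with its corner in the unit square.\<close>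
  define Zb where "Zb = {x \<in> cbox (vector [-10, -10]) (vector [10, 10]). GL 0 0 x = 0}"
  have finb: "finite Zb" unfolding Zb_def
    by (rule finite_nondegenerate_zeros[OF dL cL compact_cbox nd])
  have "infinite ({0<..<1} - (\<lambda>x. x $ 1) ` Zb)" "infinite ({0<..<1} - (\<lambda>x. x $ 2) ` Zb)"
    using finb by (auto intro!: Diff_infinite_finite)
  then obtain r0 t0 where r0: "r0 \<in> {0<..<1} - (\<lambda>x. x $ 1) ` Zb" and t0: "t0 \<in> {0<..<1} - (\<lambda>x. x $ 2) ` Zb"
    by (metis finite.emptyI ex_in_conv)
  have pi4: "pi < 4" by (rule pi_less_4)
  have r01: "0 < r0" "r0 < 1" and t01: "0 < t0" "t0 < 1" using r0 t0 by auto
  define Q where "Q = cbox (vector [r0, t0]) (vector [r0 + 2 * pi, t0 + 2 * pi] :: real ^ 2)"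
  have memQ: "x \<in> Q \<longleftrightarrow> r0 \<le> x $ 1 \<and> x $ 1 \<le> r0 + 2 * pi \<and> t0 \<le> x $ 2 \<and> x $ 2 \<le> t0 + 2 * pi" for x
    unfolding Q_def by (auto simp: mem_box_cart forall_2)
  have intQ: "x \<in> interior Q \<longleftrightarrow> r0 < x $ 1 \<and> x $ 1 < r0 + 2 * pi \<and> t0 < x $ 2 \<and> x $ 2 < t0 + 2 * pi" for x
    unfolding Q_def interior_cbox by (auto simp: mem_box_cart forall_2)
  have inZb: "x \<in> Zb" if "-10 \<le> x $ 1" "x $ 1 \<le> 10" "-10 \<le> x $ 2" "x $ 2 \<le> 10" "GL 0 0 x = 0" for x
    using that unfolding Zb_def by (auto simp: mem_box_cart forall_2)
  have zint: "z \<in> interior Q" if z: "z \<in> Q" "GL 0 0 z = 0" for z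
  proof -
    have zQ: "r0 \<le> z $ 1" "z $ 1 \<le> r0 + 2 * pi" "t0 \<le> z $ 2" "z $ 2 \<le> t0 + 2 * pi" using z(1) memQ by auto
    have zb: "z \<in> Zb" by (rule inZb) (use zQ r01 t01 pi4 z(2) in linarith)+
    hence ne: "z $ 1 \<noteq> r0" "z $ 2 \<noteq> t0" using r0 t0 by auto
    have "z $ 1 \<noteq> r0 + 2 * pi"
    proof
      assume e: "z $ 1 = r0 + 2 * pi"
      have "GL 0 0 (vector [r0, z $ 2]) = 0"
        using gfield_wave_limit_periodic[of s g b 0 0 r0 1 "z $ 2"] vector2_cases[of z] z(2) e unfolding GL_def by simp
      hence "vector [r0, z $ 2] \<in> Zb" by (intro inZb) (use zQ r01 t01 pi4 in \<open>simp_all\<close>)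
      thus False using r0 by (metis DiffD2 image_eqI vector_2(1))
    qed
    moreover have "z $ 2 \<noteq> t0 + 2 * pi"
    proof
      assume e: "z $ 2 = t0 + 2 * pi"
      have "GL 0 0 (vector [z $ 1, t0]) = 0"
        using gfield_periodic[of s "wave_limit g" b 0 0 "z $ 1" t0 1] vector2_cases[of z] z(2) e unfolding GL_def by simp
      hence "vector [z $ 1, t0] \<in> Zb" by (intro inZb) (use zQ r01 t01 pi4 in \<open>simp_all\<close>)
      thus False using t0 by (metis DiffD2 image_eqI vector_2(2))
    qed
    ultimately show ?thesis using zQ ne by (auto simp: intQ)
  qed
  have cQ: "compact Q" unfolding Q_def by (rule compact_cbox)
  define C where "C = (\<lambda>t0. {t \<in> {t0..<t0 + 2 * pi}. amplitude_crit s b t})"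
  have finC: "finite (C t0)"
  proof (rule finite_subset)
    show "finite ((\<lambda>x. x $ 2) ` {x \<in> Q. GL 0 0 x = 0})"
      by (intro finite_imageI finite_nondegenerate_zeros[OF dL cL cQ nd])
    show "C t0 \<subseteq> (\<lambda>x. x $ 2) ` {x \<in> Q. GL 0 0 x = 0}"
    proof
      fix t assume t: "t \<in> C t0"
      have "card {r \<in> {r0..<r0 + 2 * pi}. Im (g * amplitude s b 0 t * cis (- r)) = 0} = 2"
        by (rule card_two_angles) (use g nz in simp)
      hence "{r \<in> {r0..<r0 + 2 * pi}. Im (g * amplitude s b 0 t * cis (- r)) = 0} \<noteq> {}" by (metis card.empty zero_neq_numeral)
      then obtain r where r: "r \<in> {r0..<r0 + 2 * pi}" "Im (g * amplitude s b 0 t * cis (- r)) = 0" by blast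
      hence "GL 0 0 (vector [r, t]) = 0" using limit_zero_iff[OF b g nz, of r t] t unfolding GL_def C_def by simp
      moreover have "vector [r, t] \<in> Q" using r t by (auto simp: memQ C_def)
      ultimately show "t \<in> (\<lambda>x. x $ 2) ` {x \<in> Q. GL 0 0 x = 0}" by (intro image_eqI[of _ _ "vector [r, t]"]) auto
    qed
  qed
  have bijC: "bij_betw (\<lambda>t. SOME t'. t' \<in> {0..<0 + 2 * pi} \<and> cis t' = cis t) (C t0) (C 0)"
    unfolding C_def by (rule bij_betw_cell[OF amplitude_crit_cong])
  have finC0: "finite (C 0)" and cardC: "card (C t0) = card (C 0)"
    using bij_betw_finite[OF bijC] bij_betw_same_card[OF bijC] finC by auto
  have cardL: "card {x \<in> Q. GL 0 0 x = 0} = 2 * card (C 0)"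
  proof -
    have "{x \<in> Q. GL 0 0 x = 0} = {x. x $ 1 \<in> {r0..<r0 + 2 * pi} \<and> x $ 2 \<in> {t0..<t0 + 2 * pi} \<and> GL 0 0 x = 0}"
    proof (intro equalityI subsetI)
      fix x assume x: "x \<in> {x \<in> Q. GL 0 0 x = 0}"
      hence "x \<in> interior Q" using zint[of x] by blast
      thus "x \<in> {x. x $ 1 \<in> {r0..<r0 + 2 * pi} \<and> x $ 2 \<in> {t0..<t0 + 2 * pi} \<and> GL 0 0 x = 0}"
        using x unfolding intQ by simp
    next
      fix x assume "x \<in> {x. x $ 1 \<in> {r0..<r0 + 2 * pi} \<and> x $ 2 \<in> {t0..<t0 + 2 * pi} \<and> GL 0 0 x = 0}"
      thus "x \<in> {x \<in> Q. GL 0 0 x = 0}" using memQ[of x] by simp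
    qed
    moreover have "card {x :: real ^ 2. x $ 1 \<in> {r0..<r0 + 2 * pi} \<and> x $ 2 \<in> {t0..<t0 + 2 * pi} \<and> GL 0 0 x = 0} = 2 * card (C t0)"
      unfolding C_def GL_def by (rule card_limit_zeros_cell[OF gen g finC[unfolded C_def]])
    ultimately show ?thesis unfolding cardC by (simp only:)
  qed
  obtain \<epsilon> where \<epsilon>: "\<epsilon> > 0" and stab: "\<And>K K1 K2.
     (\<forall>x\<in>Q. has_partials K (K1 x) (K2 x) x \<and>
        norm (K x - GL 0 0 x) \<le> \<epsilon> \<and> norm (K1 x - GL 1 0 x) \<le> \<epsilon> \<and> norm (K2 x - GL 0 1 x) \<le> \<epsilon>) \<Longrightarrow>
     card {x \<in> Q. K x = 0} = card {x \<in> Q. GL 0 0 x = 0} \<and> {x \<in> Q. K x = 0} \<subseteq> interior Q"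
    using zero_count_stable[OF dL cL cQ nd zint] by blast
  obtain R0 where R0: "R0 > 0" and close: "\<And>r t. r \<ge> R0 \<Longrightarrow>
     norm (sqrt r *\<^sub>R GJ 0 0 (vector [r, t]) - GL 0 0 (vector [r, t])) \<le> \<epsilon> \<and>
     norm ((1 / (2 * sqrt r)) *\<^sub>R GJ 0 0 (vector [r, t]) + sqrt r *\<^sub>R GJ 1 0 (vector [r, t]) - GL 1 0 (vector [r, t])) \<le> \<epsilon> \<and>
     norm (sqrt r *\<^sub>R GJ 0 1 (vector [r, t]) - GL 0 1 (vector [r, t])) \<le> \<epsilon>"
    using rescaled_gradient_close[OF gl b \<epsilon>] unfolding GJ_def GL_def by blast
  obtain m0 :: nat where m0: "R0 / (2 * pi) \<le> real m0" using real_arch_simple by blast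
  define S where "S = {x :: real ^ 2. 0 < x $ 1 \<and> x $ 2 \<in> {t0..<t0 + 2 * pi} \<and> GJ 0 0 x = 0}"
  have cell: "card {x \<in> S. r0 + 2 * pi * real m \<le> x $ 1 \<and> x $ 1 < r0 + 2 * pi * real (Suc m)} = 2 * card (C 0)"
    if m: "m \<ge> m0" for m
  proof -
    define c where "c = 2 * pi * real m"
    define v where "v = (vector [c, 0] :: real ^ 2)"
    have "R0 \<le> 2 * pi * real m0" using m0 by (simp add: field_simps)
    also have "\<dots> \<le> c" unfolding c_def using m by (intro mult_left_mono) auto
    finally have cR: "R0 \<le> c" .
    define K where "K = (\<lambda>x :: real ^ 2. sqrt (x $ 1 + c) *\<^sub>R GJ 0 0 (x + v))"
    define K1 where "K1 = (\<lambda>x :: real ^ 2. (1 / (2 * sqrt (x $ 1 + c))) *\<^sub>R GJ 0 0 (x + v) + sqrt (x $ 1 + c) *\<^sub>R GJ 1 0 (x + v))"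
    define K2 where "K2 = (\<lambda>x :: real ^ 2. sqrt (x $ 1 + c) *\<^sub>R GJ 0 1 (x + v))"
    have big: "x $ 1 + c \<ge> R0" "x $ 1 + c > 0" if "x \<in> Q" for x using that memQ[of x] r01 cR R0 by auto
    have st: "card {x \<in> Q. K x = 0} = card {x \<in> Q. GL 0 0 x = 0} \<and> {x \<in> Q. K x = 0} \<subseteq> interior Q"
    proof (rule stab[of K K1 K2], intro ballI conjI)
      fix x assume x: "x \<in> Q"
      show "has_partials K (K1 x) (K2 x) x"
        unfolding K_def K1_def K2_def v_def GJ_def by (rule rescaled_has_derivative[OF b big(2)[OF x]])
      have sh: "x + v = vector [x $ 1 + c, x $ 2]" by (simp add: v_def vector2_add)
      have L: "GL i j (x + v) = GL i j x" for i j unfolding GL_def v_def c_def by (rule gfield_limit_shift)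
      show "norm (K x - GL 0 0 x) \<le> \<epsilon>" "norm (K1 x - GL 1 0 x) \<le> \<epsilon>" "norm (K2 x - GL 0 1 x) \<le> \<epsilon>"
        using close[OF big(1)[OF x], of "x $ 2"] unfolding K_def K1_def K2_def L[symmetric] sh by auto
    qed
    have Kz: "K x = 0 \<longleftrightarrow> GJ 0 0 (x + v) = 0" if "x \<in> Q" for x
      using big(2)[OF that] unfolding K_def by simp
    have "bij_betw (\<lambda>x. x + v) {x \<in> Q. K x = 0} {x \<in> S. r0 + 2 * pi * real m \<le> x $ 1 \<and> x $ 1 < r0 + 2 * pi * real (Suc m)}"
      unfolding bij_betw_def
    proof
      show "inj_on (\<lambda>x. x + v) {x \<in> Q. K x = 0}" by (rule inj_onI) simp
      have v12: "v $ 1 = c" "v $ 2 = 0" by (simp_all add: v_def)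
      have cS: "r0 + 2 * pi * real m = r0 + c" "r0 + 2 * pi * real (Suc m) = r0 + 2 * pi + c"
        by (simp_all add: c_def algebra_simps)
      show "(\<lambda>x. x + v) ` {x \<in> Q. K x = 0} = {x \<in> S. r0 + 2 * pi * real m \<le> x $ 1 \<and> x $ 1 < r0 + 2 * pi * real (Suc m)}"
        unfolding cS
      proof (intro equalityI subsetI)
        fix y assume "y \<in> (\<lambda>x. x + v) ` {x \<in> Q. K x = 0}"
        then obtain x where x: "x \<in> Q" "K x = 0" "y = x + v" by blast
        have "x \<in> interior Q" using st x by blast
        thus "y \<in> {x \<in> S. r0 + c \<le> x $ 1 \<and> x $ 1 < r0 + 2 * pi + c}"
          using x Kz[OF x(1)] big(2)[OF x(1)] unfolding S_def intQ by (simp add: v12)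
      next
        fix y assume y: "y \<in> {x \<in> S. r0 + c \<le> x $ 1 \<and> x $ 1 < r0 + 2 * pi + c}"
        have "y - v \<in> Q" using y unfolding memQ S_def by (simp add: v12)
        moreover from this have "K (y - v) = 0" using Kz[of "y - v"] y unfolding S_def by simp
        ultimately show "y \<in> (\<lambda>x. x + v) ` {x \<in> Q. K x = 0}" by (intro image_eqI[of _ _ "y - v"]) auto
      qed
    qed
    from bij_betw_same_card[OF this] st cardL show ?thesis by simp
  qed
  have Seq: "{x \<in> S. x $ 1 < R} = {x. 0 < x $ 1 \<and> x $ 1 < R \<and> x $ 2 \<in> {t0..<t0 + 2 * pi} \<and> gfield s bessel_J b 0 0 x = 0}" for R
    unfolding S_def GJ_def by auto
  have "((\<lambda>R. real (card {x \<in> S. x $ 1 < R}) / R) \<longlongrightarrow> real (2 * card (C 0)) / (2 * pi)) at_top"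
    by (rule counting_limit[of "2 * pi" S "\<lambda>x. x $ 1" m0 r0]) (use cell finite_bessel_zeros[OF gen] Seq in auto)
  hence "((\<lambda>R. real (card {x. 0 < x $ 1 \<and> x $ 1 < R \<and> x $ 2 \<in> {t0..<t0 + 2 * pi} \<and> gfield s bessel_J b 0 0 x = 0}) / R)
      \<longlongrightarrow> real (card (C 0)) / pi) at_top"
    unfolding Seq by simp
  thus ?thesis using finC0 unfolding C_def by auto
qed

section \<open>Critical points of the random wave\<close>

lemma density_crit_eq:
  assumes h: "hermitian a" and b: "weighted_summable s (mode_coeffs a)" and nz: "\<And>t. amplitude s (mode_coeffs a) 0 t \<noteq> 0"
  shows "density_crit s a = {t \<in> {0..<2 * pi}. amplitude_crit s (mode_coeffs a) t}"
proof -
  let ?F = "amplitude s (mode_coeffs a)"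
  have e: "(\<lambda>t. cmod (wave_density s a t)) = (\<lambda>t. cmod (?F 0 t) / (2 * pi))"
    by (simp add: fun_eq_iff wave_density_eq_amplitude[OF h b] norm_divide norm_mult)
  have d: "((\<lambda>t. cmod (?F 0 t)) has_real_derivative (sgn (?F 0 t) \<bullet> ?F 1 t)) (at t)" for t
  proof -
    have "(?F 0 has_derivative (\<lambda>h. h *\<^sub>R ?F 1 t)) (at t)"
      using amplitude_has_derivative[OF b, of 0 t] unfolding has_vector_derivative_def by simp
    from has_derivative_compose[OF this has_derivative_norm[OF nz]]
    show ?thesis unfolding has_field_derivative_def by (rule has_derivative_eq_rhs) (auto simp: fun_eq_iff inner_commute)
  qed
  have "((\<lambda>t. cmod (wave_density s a t)) has_real_derivative 0) (at t) \<longleftrightarrow> amplitude_crit s (mode_coeffs a) t" for t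
  proof -
    have D: "((\<lambda>t. cmod (wave_density s a t)) has_real_derivative (sgn (?F 0 t) \<bullet> ?F 1 t) / (2 * pi)) (at t)"
      unfolding e by (rule DERIV_cdivide[OF d])
    have "((\<lambda>t. cmod (wave_density s a t)) has_real_derivative 0) (at t) \<longleftrightarrow> (sgn (?F 0 t) \<bullet> ?F 1 t) / (2 * pi) = 0"
      using D DERIV_unique[OF D] by metis
    also have "\<dots> \<longleftrightarrow> ?F 0 t \<bullet> ?F 1 t = 0" using nz[of t] by (simp add: sgn_div_norm)
    finally show ?thesis unfolding amplitude_crit_def .
  qed
  thus ?thesis unfolding density_crit_def by simp
qed

text \<open>The maximum of \<open>\<bar>F\<bar>\<close> over the circle. This makes the growth rate positive.\<close>

lemma ex_amplitude_crit:
  assumes b: "weighted_summable s b" and nz: "\<And>t. amplitude s b 0 t \<noteq> 0"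
  shows "\<exists>t\<in>{0..<2 * pi}. amplitude_crit s b t"
proof -
  define f where "f = (\<lambda>t. amplitude s b 0 t \<bullet> amplitude s b 0 t)"
  have d: "(f has_real_derivative 2 * (amplitude s b 0 t \<bullet> amplitude s b 1 t)) (at t)" for t
  proof -
    have v: "(amplitude s b 0 has_derivative (\<lambda>h. h *\<^sub>R amplitude s b 1 t)) (at t)"
      using amplitude_has_derivative[OF b, of 0 t] unfolding has_vector_derivative_def by simp
    show ?thesis unfolding f_def has_field_derivative_def
      by (rule has_derivative_eq_rhs[OF has_derivative_inner[OF v v]]) (auto simp: inner_commute)
  qed
  have "continuous_on {0..2 * pi} f"
    using d by (meson DERIV_isCont continuous_at_imp_continuous_on)
  then obtain m where m: "m \<in> {0..2 * pi}" "\<And>t. t \<in> {0..2 * pi} \<Longrightarrow> f t \<le> f m"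
    using continuous_attains_sup[of "{0..2 * pi}" f] by auto
  have "f t \<le> f m" for t
  proof -
    obtain t' where "t' \<in> {0..<0 + 2 * pi}" "cis t' = cis t" using cell_representative by blast
    thus ?thesis using m(2)[of t'] amplitude_cis_cong[of t' t s b 0] by (simp add: f_def)
  qed
  hence "2 * (amplitude s b 0 m \<bullet> amplitude s b 1 m) = 0" by (intro DERIV_local_max[OF d, of 1]) auto
  hence c: "amplitude_crit s b m" by (simp add: amplitude_crit_def)
  obtain m' where m': "m' \<in> {0..<0 + 2 * pi}" "cis m' = cis m" using cell_representative by blast
  have "amplitude_crit s b m'" using amplitude_crit_cong[OF m'(2), of s b] c by simp
  thus ?thesis using m'(1) by (intro bexI[of _ m']) auto
qed

text \<open>Each point of the punctured disk has exactly one polar angle in the chosen interval.\<close>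

lemma bij_betw_polar_critical:
  assumes h: "hermitian a" and b: "weighted_summable s (mode_coeffs a)"
  shows "bij_betw polar {x. 0 < x $ 1 \<and> x $ 1 < R \<and> x $ 2 \<in> {t0..<t0 + 2 * pi} \<and> gfield s bessel_J (mode_coeffs a) 0 0 x = 0}
    (wave_crit s a R - {0})"
    (is "bij_betw polar ?Z _")
  unfolding bij_betw_def
proof
  show "inj_on polar ?Z"
  proof (rule inj_onI)
    fix x y assume x: "x \<in> ?Z" and y: "y \<in> ?Z" and "polar x = polar y"
    hence "rcis (x $ 1) (x $ 2) = rcis (y $ 1) (y $ 2)" using to_complex_polar by metis
    from rcis_eqD[OF this] x y have "x $ 1 = y $ 1" "cis (x $ 2) = cis (y $ 2)" by auto
    moreover from this(2) have "x $ 2 = y $ 2" using cell_inj[of "x $ 2" t0 "y $ 2"] x y by simp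
    ultimately show "x = y" by (simp add: vec2_eq_iff)
  qed
  show "polar ` ?Z = wave_crit s a R - {0}"
  proof (intro equalityI subsetI)
    fix y assume "y \<in> polar ` ?Z"
    then obtain x where x: "x \<in> ?Z" "y = polar x" by blast
    have r: "to_complex y = rcis (x $ 1) (x $ 2)" "x $ 1 > 0" using x by (auto simp: to_complex_polar)
    have "norm y = x $ 1" using norm_to_complex[of y] r by simp
    moreover have "GDERIV (wave s a) y :> 0"
      using wave_critical_iff[OF h b r] x(1) vector2_cases[of x] by simp
    ultimately show "y \<in> wave_crit s a R - {0}" using x r(2) unfolding wave_crit_def by auto
  next
    fix y assume y: "y \<in> wave_crit s a R - {0}"
    obtain t where t: "t \<in> {t0..<t0 + 2 * pi}" "cis t = cis (polar_theta y)" using cell_representative by blast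
    have "to_complex y = rcis (norm y) t"
      using to_complex_polar_coords[of y] t(2) by (simp add: rcis_def polar_r_def)
    moreover have n: "norm y > 0" "norm y < R" using y by (auto simp: wave_crit_def)
    ultimately have "gfield s bessel_J (mode_coeffs a) 0 0 (vector [norm y, t]) = 0"
      using wave_critical_iff[OF h b] y unfolding wave_crit_def by blast
    hence "vector [norm y, t] \<in> ?Z" using n t(1) by simp
    moreover have "y = polar (vector [norm y, t])"
      using \<open>to_complex y = rcis (norm y) t\<close> by (simp add: to_complex_inject[symmetric] to_complex_polar)
    ultimately show "y \<in> polar ` ?Z" by blast
  qed
qed

text \<open>The origin, where polar coordinates fail, contributes at most one critical point, which does not affect the
  rate.\<close>

theorem generic_wave_critical_points:
  assumes h: "hermitian a" and gen: "generic s g (mode_coeffs a)" and g: "g \<noteq> 0"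
    and gl: "\<And>l. ((\<lambda>r. scaled_bessel l r - Re (g * \<i> powi l * cis (- r))) \<longlongrightarrow> 0) at_top"
  shows "finite (density_crit s a) \<and> density_crit s a \<noteq> {} \<and> (\<forall>R. finite (wave_crit s a R)) \<and>
    ((\<lambda>R. real (card (wave_crit s a R)) / R) \<longlongrightarrow> real (card (density_crit s a)) / pi) at_top"
proof -
  have b: "weighted_summable s (mode_coeffs a)" and nz: "\<And>t. amplitude s (mode_coeffs a) 0 t \<noteq> 0" using gen unfolding generic_def by auto
  note D = density_crit_eq[OF h b nz]
  define Z where "Z = (\<lambda>t0 R. {x. 0 < x $ 1 \<and> x $ 1 < R \<and> x $ 2 \<in> {t0..<t0 + 2 * pi} \<and> gfield s bessel_J (mode_coeffs a) 0 0 x = 0})"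
  have fin: "finite (density_crit s a)" using bessel_zero_count[OF gen g gl] unfolding D by blast
  obtain t0 where lim: "((\<lambda>R. real (card (Z t0 R)) / R) \<longlongrightarrow> real (card (density_crit s a)) / pi) at_top"
    using bessel_zero_count[OF gen g gl] unfolding D Z_def by blast
  have ne: "density_crit s a \<noteq> {}" using ex_amplitude_crit[OF b nz] unfolding D by blast
  have bij: "bij_betw polar (Z t0 R) (wave_crit s a R - {0})" for R
    unfolding Z_def by (rule bij_betw_polar_critical[OF h b])
  have finZ: "finite (Z t0 R)" for R unfolding Z_def by (rule finite_bessel_zeros[OF gen])
  have finW: "finite (wave_crit s a R)" for R
    using bij_betw_finite[OF bij[of R]] finZ[of R] by simp
  have card: "card (Z t0 R) \<le> card (wave_crit s a R)" "card (wave_crit s a R) \<le> card (Z t0 R) + 1" for R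
  proof -
    have c: "card (Z t0 R) = card (wave_crit s a R - {0})" by (rule bij_betw_same_card[OF bij])
    show "card (Z t0 R) \<le> card (wave_crit s a R)" unfolding c by (intro card_mono finW) auto
    show "card (wave_crit s a R) \<le> card (Z t0 R) + 1" unfolding c using card_Diff1_le[of "wave_crit s a R" 0] finW[of R]
      by (cases "0 \<in> wave_crit s a R") (auto simp: card_Diff_singleton)
  qed
  have "((\<lambda>R. real (card (wave_crit s a R)) / R) \<longlongrightarrow> real (card (density_crit s a)) / pi) at_top"
  proof (rule tendsto_sandwich[OF _ _ lim])
    have "((\<lambda>R::real. 1 / R) \<longlongrightarrow> 0) at_top" by real_asymp
    from tendsto_add[OF lim this]
    show "((\<lambda>R. real (card (Z t0 R)) / R + 1 / R) \<longlongrightarrow> real (card (density_crit s a)) / pi) at_top" by simp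
    show "\<forall>\<^sub>F R in at_top. real (card (Z t0 R)) / R \<le> real (card (wave_crit s a R)) / R"
      using eventually_gt_at_top[of 0] by eventually_elim (use card(1) in \<open>simp add: divide_right_mono\<close>)
    show "\<forall>\<^sub>F R in at_top. real (card (wave_crit s a R)) / R \<le> real (card (Z t0 R)) / R + 1 / R"
      using eventually_gt_at_top[of 0]
    proof eventually_elim
      case (elim R)
      have "real (card (wave_crit s a R)) \<le> real (card (Z t0 R)) + 1" using card(2)[of R] by linarith
      thus ?case using elim by (simp add: divide_right_mono flip: add_divide_distrib)
    qed
  qed
  with fin ne finW show ?thesis by blast
qed

text \<open>The assumptions on \<open>a\<close> say that the enumerated coefficients have the law of an independent standard
  Gaussian sequence.\<close>

lemma AE_mode_coeffs:
  fixes M :: "'w measure" and a :: "int \<Rightarrow> 'w \<Rightarrow> complex"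
  assumes M: "prob_space M"
    and Re: "\<And>l. l \<ge> 1 \<Longrightarrow> distributed M lborel (\<lambda>\<omega>. Re (a l \<omega>)) std_normal_density"
    and Im: "\<And>l. l \<ge> 1 \<Longrightarrow> distributed M lborel (\<lambda>\<omega>. Im (a l \<omega>)) std_normal_density"
    and ind: "prob_space.indep_vars M (\<lambda>_. borel)
           (\<lambda>(l, is_re) \<omega>. if is_re then Re (a l \<omega>) else Im (a l \<omega>)) ({1..} \<times> (UNIV :: bool set))"
    and P: "AE b in gauss_seq. P b"
  shows "AE \<omega> in M. P (mode_coeffs (\<lambda>l. a l \<omega>))"
proof -
  interpret prob_space M by (rule M)
  define X where "X = (\<lambda>(l, is_re) \<omega>. if is_re then Re (a l \<omega>) else Im (a l \<omega>))"
  define I where "I = ({1 :: int..} \<times> (UNIV :: bool set))"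
  define f where "f = (\<lambda>k. (int (mode k), even k))"
  have law: "distr M lborel (X i) = gauss" "X i \<in> measurable M borel" if "i \<in> I" for i
  proof -
    have "distributed M lborel (X i) std_normal_density"
      using that Re Im unfolding X_def I_def by (cases i; cases "snd i") auto
    thus "distr M lborel (X i) = gauss" "X i \<in> measurable M borel"
      by (auto simp: distributed_def)
  qed
  have law': "distr M borel (X i) = gauss" if "i \<in> I" for i
    using law(1)[OF that] distr_cong[of M M borel lborel "X i" "X i"] by simp
  have I0: "I \<noteq> {}" by (auto simp: I_def)
  have mX: "(\<lambda>\<omega>. \<lambda>i\<in>I. X i \<omega>) \<in> measurable M (PiM I (\<lambda>_. borel))"
    by (intro measurable_restrict law(2))
  have "distr M (PiM I (\<lambda>_. borel)) (\<lambda>\<omega>. \<lambda>i\<in>I. X i \<omega>) = PiM I (\<lambda>i. distr M borel (X i))"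
    by (rule indep_vars_iff_distr_eq_PiM'[where M' = "\<lambda>_. borel" and X = X, OF I0 law(2), THEN iffD1])
      (use ind in \<open>simp_all only: X_def I_def\<close>)
  also have "\<dots> = PiM I (\<lambda>_. gauss)" by (rule PiM_cong) (use law' in auto)
  finally have d1: "distr M (PiM I (\<lambda>_. borel)) (\<lambda>\<omega>. \<lambda>i\<in>I. X i \<omega>) = PiM I (\<lambda>_. gauss)" .
  have inj: "inj_on f UNIV"
  proof (rule inj_onI)
    fix j k assume "f j = f k"
    hence "j div 2 = k div 2" "even j = even k" by (auto simp: f_def mode_def)
    thus "j = k" by (metis (full_types) div_mult_mod_eq even_iff_mod_2_eq_zero odd_iff_mod_2_eq_one)
  qed
  have fI: "f \<in> UNIV \<rightarrow> I" by (auto simp: f_def I_def mode_def)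
  have d2: "distr (PiM I (\<lambda>_. gauss)) gauss_seq (\<lambda>\<xi>. \<lambda>n\<in>UNIV. \<xi> (f n)) = gauss_seq"
    using distr_PiM_reindex[of I "\<lambda>_. gauss" f UNIV] inj fI prob_space_gauss by simp
  have m2: "(\<lambda>\<xi>. \<lambda>n\<in>UNIV. \<xi> (f n)) \<in> measurable (PiM I (\<lambda>_. gauss)) gauss_seq"
    by (intro measurable_restrict measurable_component_singleton) (use fI in auto)
  from P have "AE b in distr (PiM I (\<lambda>_. gauss)) gauss_seq (\<lambda>\<xi>. \<lambda>n\<in>UNIV. \<xi> (f n)). P b" unfolding d2 .
  from AE_distrD[OF m2 this] have "AE \<xi> in distr M (PiM I (\<lambda>_. borel)) (\<lambda>\<omega>. \<lambda>i\<in>I. X i \<omega>). P (\<lambda>n\<in>UNIV. \<xi> (f n))"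
    unfolding d1 .
  from AE_distrD[OF mX this] have "AE \<omega> in M. P (\<lambda>n\<in>UNIV. (\<lambda>i\<in>I. X i \<omega>) (f n))" .
  moreover have "(\<lambda>n\<in>UNIV. (\<lambda>i\<in>I. X i \<omega>) (f n)) = mode_coeffs (\<lambda>l. a l \<omega>)" for \<omega>
  proof
    fix n
    have "f n \<in> I" using fI by auto
    hence "(\<lambda>n\<in>UNIV. (\<lambda>i\<in>I. X i \<omega>) (f n)) n = X (f n) \<omega>" by simp
    thus "(\<lambda>n\<in>UNIV. (\<lambda>i\<in>I. X i \<omega>) (f n)) n = mode_coeffs (\<lambda>l. a l \<omega>) n"
      by (simp add: X_def f_def mode_coeffs_def)
  qed
  ultimately show ?thesis by simp
qed

theorem theorem1p3:
  fixes M :: "'w measure" and a :: "int \<Rightarrow> 'w \<Rightarrow> complex" and s :: real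
  assumes "prob_space M"
    and "\<And>l. l \<noteq> 0 \<Longrightarrow> a l \<in> borel_measurable M"
    and "\<And>l. l \<ge> 1 \<Longrightarrow> distributed M lborel (\<lambda>\<omega>. Re (a l \<omega>)) std_normal_density"
    and "\<And>l. l \<ge> 1 \<Longrightarrow> distributed M lborel (\<lambda>\<omega>. Im (a l \<omega>)) std_normal_density"
    and "prob_space.indep_vars M (\<lambda>_. borel)
           (\<lambda>(l, is_re) \<omega>. if is_re then Re (a l \<omega>) else Im (a l \<omega>)) ({1..} \<times> (UNIV :: bool set))"
    and "\<And>l. l \<noteq> 0 \<Longrightarrow> AE \<omega> in M. a l \<omega> = (-1) powi l * cnj (a (-l) \<omega>)"
    and "s > 5"
  shows "AE \<omega> in M.
           finite (density_crit s (\<lambda>l. a l \<omega>)) \<and>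
           (\<forall>R>0. finite (wave_crit s (\<lambda>l. a l \<omega>) R)) \<and>
           ((\<lambda>R. real (card (wave_crit s (\<lambda>l. a l \<omega>) R)) /
                  (real (card (density_crit s (\<lambda>l. a l \<omega>))) / pi * R)) \<longlongrightarrow> 1) at_top \<and>
           (\<exists>c>0. ((\<lambda>R. real (card (wave_crit s (\<lambda>l. a l \<omega>) R)) / R) \<longlongrightarrow> c) at_top)"
proof -
  obtain g where g: "g \<noteq> 0" and gl: "\<And>l. ((\<lambda>r. scaled_bessel l r - Re (g * \<i> powi l * cis (- r))) \<longlongrightarrow> 0) at_top"
    using scaled_bessel_asymptotic by blast
  have gen: "AE \<omega> in M. generic s g (mode_coeffs (\<lambda>l. a l \<omega>))"
    by (rule AE_mode_coeffs[OF assms(1,3,4,5) AE_generic[OF assms(7) g]])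
  have herm: "AE \<omega> in M. hermitian (\<lambda>l. a l \<omega>)"
    unfolding hermitian_def AE_all_countable using assms(6) by auto
  show ?thesis
  proof (rule eventually_mono[OF eventually_conj[OF gen herm]])
    fix \<omega> assume elim: "generic s g (mode_coeffs (\<lambda>l. a l \<omega>)) \<and> hermitian (\<lambda>l. a l \<omega>)"
    define A where "A = (\<lambda>l. a l \<omega>)"
    define c where "c = real (card (density_crit s A)) / pi"
    have h: "hermitian A" using elim unfolding A_def ..
    have "generic s g (mode_coeffs A)" using elim unfolding A_def ..
    from generic_wave_critical_points[OF h this g gl]
    have fin: "finite (density_crit s A)" and ne: "density_crit s A \<noteq> {}" and finW: "\<And>R. finite (wave_crit s A R)"
      and lim: "((\<lambda>R. real (card (wave_crit s A R)) / R) \<longlongrightarrow> c) at_top"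
      unfolding c_def by (blast+)
    have c: "c > 0" unfolding c_def using fin ne by (simp add: card_gt_0_iff)
    have "((\<lambda>R. real (card (wave_crit s A R)) / R / c) \<longlongrightarrow> c / c) at_top"
      by (intro tendsto_divide lim tendsto_const) (use c in simp)
    moreover have "real (card (wave_crit s A R)) / R / c = real (card (wave_crit s A R)) / (c * R)" for R
      by (simp add: mult.commute)
    moreover have "c / c = 1" using c by simp
    ultimately have "((\<lambda>R. real (card (wave_crit s A R)) / (c * R)) \<longlongrightarrow> 1) at_top" by (simp only:)
    hence "finite (density_crit s A) \<and> (\<forall>R>0. finite (wave_crit s A R)) \<and>
       ((\<lambda>R. real (card (wave_crit s A R)) / (real (card (density_crit s A)) / pi * R)) \<longlongrightarrow> 1) at_top \<and>
       (\<exists>c>0. ((\<lambda>R. real (card (wave_crit s A R)) / R) \<longlongrightarrow> c) at_top)"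
      by (intro conjI allI impI fin finW exI[of _ c] c lim) (simp only: c_def)
    thus "finite (density_crit s (\<lambda>l. a l \<omega>)) \<and>
           (\<forall>R>0. finite (wave_crit s (\<lambda>l. a l \<omega>) R)) \<and>
           ((\<lambda>R. real (card (wave_crit s (\<lambda>l. a l \<omega>) R)) /
                  (real (card (density_crit s (\<lambda>l. a l \<omega>))) / pi * R)) \<longlongrightarrow> 1) at_top \<and>
           (\<exists>c>0. ((\<lambda>R. real (card (wave_crit s (\<lambda>l. a l \<omega>) R)) / R) \<longlongrightarrow> c) at_top)"
      unfolding A_def .
  qed
qed

end
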